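(* Let $\mathbf{T}=(T_t\colon t\ge 0)$ be a subordinator with the Lévy–Khintchine exponent $\psi$ and the Laplace exponent $\phi$. Suppose that $-\phi''\in\mathrm{WLSC}(\alpha-2,c,x_0)$ for some $c\in(0,1]$, $x_0\ge 0$, and $\alpha>0$. Then the probability distribution of $T_t$ has a density $p(t,\cdot)$. Moreover, there is $C>0$ such that for all $t\in(0,1/\varphi(x_0))$ and $x\in\mathbb{R}$, $$p\big(t,x+t\,b_{1/\psi^{-1}(1/t)}\big)\le C\,\varphi^{-1}(1/t)\cdot\min\big\{1,\,t\,\zeta(|x|)\big\}.$$ In particular, for all $t\in(0,1/\varphi(x_0))$ and $x\ge 2e\,t\,\phi'(\psi^{-1}(1/t))$, $$p(t,x+tb)\le C\,\varphi^{-1}(1/t)\cdot\min\big\{1,\,t\,\zeta(x)\big\}.$$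
   Context: A subordinator is a one-dimensional Lévy process $\mathbf{T}=(T_t\colon t\ge 0)$ with $T_0=0$ and nondecreasing paths. Its Laplace exponent $\phi\colon[0,\infty)\to[0,\infty)$ is defined by $\mathbb{E}\,e^{-\lambda T_t}=e^{-t\phi(\lambda)}$, and $\phi(\lambda)=b\lambda+\int_{(0,\infty)}(1-e^{-\lambda s})\,\nu(\mathrm{d}s)$, where $b\ge 0$ and $\nu$ (the Lévy measure) satisfies $\int_{(0,\infty)}\min\{1,s\}\,\nu(\mathrm{d}s)<\infty$. Its Lévy–Khintchine exponent $\psi$ is given by $\mathbb{E}\,e^{i\xi T_t}=e^{-t\psi(\xi)}$, i.e. $\psi(\xi)=-i\xi b-\int_{(0,\infty)}(e^{i\xi x}-1)\,\nu(\mathrm{d}x)$. It is assumed that $\phi''\not\equiv 0$. $p(t,\cdot)$ denotes the continuous version of the density. For $\tau\in\mathbb{R}$, $c\in(0,1]$, $x_0\ge 0$, a nonnegative function $f$ on $(0,\infty)$ belongs to $\mathrm{WLSC}(\tau,c,x_0)$ if $f(\lambda x)\ge c\lambda^{\tau}f(x)$ for all $\lambda\ge 1$ and $x>x_0$. Notation: $\varphi(x)=x^2(-\phi''(x))$ for $x>0$, $\varphi^*(r)=\sup_{0<x\le r}\varphi(x)$, $\varphi^{-1}(x)=\sup\{r>0\colon\varphi^*(r)=x\}$; $\psi^*(r)=\sup_{|z|\le r}\Re\psi(z)$ (real $z$), $\psi^{-1}(s)=\sup\{r>0\colon\psi^*(r)=s\}$; $b_r=b+\int_{(0,r)}s\,\nu(\mathrm{d}s)$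 for $r>0$. The function $\zeta\colon[0,\infty)\to[0,\infty]$ is defined by $\zeta(0)=\infty$, $\zeta(s)=\varphi^*(1/s)$ if $0<s\le x_0^{-1}$, and $\zeta(s)=A\,\phi(1/s)$ if $s>x_0^{-1}$, where $A=\varphi^*(x_0)/\phi(x_0)\in(0,2]$. Conventions when $x_0=0$: $x_0^{-1}=\infty$, $\varphi(x_0)=0$ and $1/\varphi(x_0)=\infty$ (so only the first formula for $\zeta$ on $(0,\infty)$ is used). *)

theory Defs
  imports "HOL-Probability.Probability"
begin

definition independent_increments :: "'a measure \<Rightarrow> (real \<Rightarrow> 'a \<Rightarrow> real) \<Rightarrow> bool" where
  "independent_increments M X \<longleftrightarrow>
     (\<forall>(n::nat) (s::nat \<Rightarrow> real). 0 \<le> s 0 \<and> (\<forall>i<n. s i \<le> s (Suc i)) \<longrightarrow>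
        prob_space.indep_vars M (\<lambda>_. borel) (\<lambda>i \<omega>. X (s (Suc i)) \<omega> - X (s i) \<omega>) {..<n})"

definition stationary_increments :: "'a measure \<Rightarrow> (real \<Rightarrow> 'a \<Rightarrow> real) \<Rightarrow> bool" where
  "stationary_increments M X \<longleftrightarrow>
     (\<forall>s\<ge>0. \<forall>t\<ge>0. distr M borel (\<lambda>\<omega>. X (s + t) \<omega> - X s \<omega>) = distr M borel (X t))"

definition cadlag :: "(real \<Rightarrow> real) \<Rightarrow> bool" where
  "cadlag x \<longleftrightarrow> (\<forall>t\<ge>0. continuous (at_right t) x) \<and> (\<forall>t>0. \<exists>l. (x \<longlongrightarrow> l) (at_left t))"

text \<open>Only the times \<open>t \<ge> 0\<close> matter; path properties are required almost surely.\<close>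

definition levy_process :: "'a measure \<Rightarrow> (real \<Rightarrow> 'a \<Rightarrow> real) \<Rightarrow> bool" where
  "levy_process M X \<longleftrightarrow>
     prob_space M \<and> (\<forall>t\<ge>0. X t \<in> borel_measurable M) \<and>
     (AE \<omega> in M. X 0 \<omega> = 0) \<and>
     independent_increments M X \<and> stationary_increments M X \<and>
     (AE \<omega> in M. cadlag (\<lambda>t. X t \<omega>))"

definition subordinator :: "'a measure \<Rightarrow> (real \<Rightarrow> 'a \<Rightarrow> real) \<Rightarrow> bool" where
  "subordinator M T \<longleftrightarrow>
     levy_process M T \<and> (AE \<omega> in M. mono_on {0..} (\<lambda>t. T t \<omega>))"

definition laplace_exponent_of ::
    "'a measure \<Rightarrow> (real \<Rightarrow> 'a \<Rightarrow> real) \<Rightarrow> (real \<Rightarrow> real) \<Rightarrow> bool" where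
  "laplace_exponent_of M T \<phi> \<longleftrightarrow>
     (\<forall>t\<ge>0. \<forall>u\<ge>0. (LINT \<omega>|M. exp (- u * T t \<omega>)) = exp (- t * \<phi> u))"

text \<open>Requiring the identity for all \<open>t \<ge> 0\<close> determines \<open>\<psi>\<close> uniquely, so there is no
  choice of a branch of the complex logarithm.\<close>

definition levy_khintchine_exponent_of ::
    "'a measure \<Rightarrow> (real \<Rightarrow> 'a \<Rightarrow> real) \<Rightarrow> (real \<Rightarrow> complex) \<Rightarrow> bool" where
  "levy_khintchine_exponent_of M T \<psi> \<longleftrightarrow>
     (\<forall>t\<ge>0. \<forall>\<xi>. char (distr M borel (T t)) \<xi> = exp (- complex_of_real t * \<psi> \<xi>))"

text \<open>A measure on \<open>(0,\<infinity>)\<close> is encoded as a Borel measure on the line that does not charge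
  \<open>(-\<infinity>,0]\<close>.\<close>

definition subordinator_levy_measure :: "real measure \<Rightarrow> bool" where
  "subordinator_levy_measure \<nu> \<longleftrightarrow>
     sets \<nu> = sets borel \<and> emeasure \<nu> {..0} = 0 \<and> set_integrable \<nu> {0<..} (\<lambda>s. min 1 s)"

text \<open>\<open>b\<close> and \<open>\<nu>\<close> are the drift and the Levy measure of the subordinator with Laplace
  exponent \<open>\<phi>\<close>; they are uniquely determined by \<open>\<phi>\<close>.\<close>

definition drift_and_levy_measure_of :: "(real \<Rightarrow> real) \<Rightarrow> real \<Rightarrow> real measure \<Rightarrow> bool" where
  "drift_and_levy_measure_of \<phi> b \<nu> \<longleftrightarrow>
     0 \<le> b \<and> subordinator_levy_measure \<nu> \<and>
     (\<forall>u\<ge>0. \<phi> u = b * u + (LINT s:{0<..}|\<nu>. 1 - exp (- u * s)))"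

definition truncated_drift :: "real \<Rightarrow> real measure \<Rightarrow> real \<Rightarrow> real" where
  "truncated_drift b \<nu> r = b + (LINT s:{0<..<r}|\<nu>. s)"

definition WLSC :: "real \<Rightarrow> real \<Rightarrow> real \<Rightarrow> (real \<Rightarrow> real) set" where
  "WLSC \<tau> c x\<^sub>0 =
     {f. (\<forall>x>0. 0 \<le> f x) \<and> (\<forall>u\<ge>1. \<forall>x>x\<^sub>0. f (u * x) \<ge> c * u powr \<tau> * f x)}"

definition varphi :: "(real \<Rightarrow> real) \<Rightarrow> real \<Rightarrow> real" where
  "varphi \<phi> x = x\<^sup>2 * (- deriv (deriv \<phi>) x)"

definition varphi_star :: "(real \<Rightarrow> real) \<Rightarrow> real \<Rightarrow> real" where
  "varphi_star \<phi> r = (SUP x\<in>{0<..r}. varphi \<phi> x)"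

definition psi_star :: "(real \<Rightarrow> complex) \<Rightarrow> real \<Rightarrow> real" where
  "psi_star \<psi> r = (SUP z\<in>{z. \<bar>z\<bar> \<le> r}. Re (\<psi> z))"

definition varphi_inv :: "(real \<Rightarrow> real) \<Rightarrow> real \<Rightarrow> real" where
  "varphi_inv \<phi> y = Sup {r. 0 < r \<and> varphi_star \<phi> r = y}"

definition psi_inv :: "(real \<Rightarrow> complex) \<Rightarrow> real \<Rightarrow> real" where
  "psi_inv \<psi> s = Sup {r. 0 < r \<and> psi_star \<psi> r = s}"

text \<open>In \<^typ>\<open>ereal\<close> one has \<open>1 / 0 = \<infinity>\<close>, so for \<open>x\<^sub>0 = 0\<close> the last case below is void.\<close>

definition zeta :: "(real \<Rightarrow> real) \<Rightarrow> real \<Rightarrow> real \<Rightarrow> ereal" where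
  "zeta \<phi> x\<^sub>0 s =
     (if s = 0 then \<infinity>
      else if ereal s \<le> 1 / ereal x\<^sub>0 then ereal (varphi_star \<phi> (1 / s))
      else ereal (varphi_star \<phi> x\<^sub>0 / \<phi> x\<^sub>0 * \<phi> (1 / s)))"

text \<open>The open time interval \<open>(0, 1 / varphi(x\<^sub>0))\<close>; for \<open>x\<^sub>0 = 0\<close> we have
  \<open>varphi \<phi> 0 = 0\<close>, and the interval is \<open>(0,\<infinity>)\<close>, again because \<open>1 / 0 = \<infinity>\<close> in \<^typ>\<open>ereal\<close>.\<close>

definition time_range :: "(real \<Rightarrow> real) \<Rightarrow> real \<Rightarrow> real set" where
  "time_range \<phi> x\<^sub>0 = {t. 0 < t \<and> ereal t < 1 / ereal (varphi \<phi> x\<^sub>0)}"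

definition continuous_density_of :: "'a measure \<Rightarrow> ('a \<Rightarrow> real) \<Rightarrow> (real \<Rightarrow> real) \<Rightarrow> bool" where
  "continuous_density_of M X f \<longleftrightarrow>
     continuous_on UNIV f \<and> (\<forall>x. 0 \<le> f x) \<and> distributed M lborel X (\<lambda>x. ennreal (f x))"

end

theory Submission
  imports Defs "HOL-Complex_Analysis.Complex_Analysis"
begin

text \<open>
  Throughout, \<open>\<psi>(\<xi>) = - i b \<xi> + \<integral> (1 - exp (i \<xi> s)) \<nu>(ds)\<close>, and everything is compared with the function
  \<open>H(u) = \<integral> min 1 ((u s)\<^sup>2) \<nu>(ds)\<close> (\<open>pruitt\<close> below), which dominates
  \<open>varphi(u) = u\<^sup>2 (- \<phi>''(u))\<close> and, up to a factor 2, the real part of \<open>\<psi>\<close>.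

  Scaling. The function \<open>\<Phi>(u) = \<phi>(u) - u \<phi>'(u)\<close> is comparable with \<open>H\<close> and satisfies
  \<open>\<Phi>'(u) = varphi(u) / u\<close>. For \<open>x\<^sub>0 < x \<le> u\<close>, weak lower scaling bounds \<open>varphi(x)\<close> by a constant times
  \<open>(x/u)\<^sup>\<alpha> varphi(u)\<close>, so integrating gives \<open>H(u) \<le> C varphi(u)\<close> for \<open>u \<ge> x\<^sub>0\<close> and, with another
  constant, above any positive threshold (\<open>pruitt_le_vphi\<close>). Hence \<open>H\<close> itself scales from
  below there (\<open>pruitt_lower_scaling\<close>), and this forces \<open>H(u) \<le> C Re \<psi>(u)\<close> (\<open>pruitt_le_re_psi\<close>): if \<open>k\<close> is
  large then \<open>H(k u) \<ge> 2 H(u)\<close>, whereas the jumps larger than \<open>1/u\<close> contribute at most \<open>H(u)\<close> to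
  \<open>H(k u)\<close>. If \<open>\<rho>\<close> is the frequency with \<open>t Re \<psi>(\<rho>) = 1\<close>, then \<open>t H(\<rho>)\<close> is bounded above and below,
  \<open>\<rho>\<close> is at most a constant times the generalised inverse of \<open>varphi\<close> at \<open>1/t\<close>, and
  \<open>exp (- t Re \<psi>(\<xi>)) \<le> K (1 + (\<xi>/\<rho>)\<^sup>2)\<^sup>-\<^sup>2\<close> (\<open>exp_re_psi_decay\<close>).

  The density. The formula for \<open>\<psi>\<close> follows from the one for \<open>\<phi>\<close> by analytic continuation
  (\<open>char_from_Laplace_transform\<close>). By the last estimate the characteristic function is integrable,
  and inversion gives a continuous density (\<open>density_if_integrable_char\<close>), bounded by a constant
  times \<open>\<rho>\<close>.

  The decay. Let \<open>b'\<close> be the drift truncated at jumps of size \<open>1/\<rho>\<close>, and put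
  \<open>f(\<xi>) = exp (- t \<psi>(\<xi>) - i \<xi> t b')\<close>, the Fourier transform of the law recentred at \<open>t b'\<close>. With \<open>\<eta> = \<pi>/x\<close>,
  translating the variable of integration shows that \<open>4 \<integral> exp (- i \<xi> x) f(\<xi>) d\<xi>\<close> equals
  \<open>\<integral> exp (- i \<xi> x) (2 f(\<xi>) - f(\<xi> + \<eta>) - f(\<xi> - \<eta>)) d\<xi>\<close> (\<open>integral_second_difference\<close>). The second
  difference of the exponent is at most \<open>4 H(\<eta>)\<close>. For \<open>1/\<bar>x\<bar> \<le> \<rho>\<close> the first differences of the centred
  exponent are at most a constant times \<open>sqrt (H(\<rho>) H(\<eta>)) (1 + \<bar>\<xi>\<bar>/\<rho>)\<close>: the small jumps are compensated
  by the centring, and for the jumps larger than \<open>1/\<rho>\<close> one uses \<open>2 a \<le> \<theta> a\<^sup>2 + 1/\<theta>\<close>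
  (\<open>norm_centred_increment_le\<close>). As \<open>t H(\<rho>)\<close> is bounded, the second difference of \<open>f\<close> is bounded by a
  constant times \<open>t H(\<eta>) / (1 + (\<xi>/\<rho>)\<^sup>2)\<close>, so the recentred density at \<open>x\<close> is at most a constant times
  \<open>\<rho> t H(1/\<bar>x\<bar>)\<close>. For \<open>1/\<bar>x\<bar> > \<rho>\<close> the uniform bound suffices, because then \<open>t H(1/\<bar>x\<bar>)\<close> is bounded below.
  Finally \<open>H(1/s) \<le> C \<zeta>(s)\<close> (\<open>pruitt_le_zeta\<close>).

  The bound centred at \<open>t b\<close> follows, because for \<open>x \<ge> 2 e t \<phi>'(\<rho>)\<close> the two centres differ by at most
  \<open>x/2\<close> (\<open>truncated_drift_le\<close>).
\<close>

section \<open>Integrals depending on a parameter, and generalised inverses\<close>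

text \<open>The parameter may be real or complex: the real case gives the derivatives of the Laplace
  exponent, the complex case the holomorphy needed for analytic continuation.\<close>

lemma has_field_derivative_integral:
  fixes f f' :: "'b::{real_normed_field, banach, second_countable_topology} \<Rightarrow> 'c \<Rightarrow> 'b"
  assumes e: "0 < e"
    and int: "\<And>z. z \<in> ball z0 e \<Longrightarrow> integrable M (f z)"
    and meas: "f' z0 \<in> borel_measurable M"
    and der: "AE s in M. \<forall>z\<in>ball z0 e. ((\<lambda>z. f z s) has_field_derivative f' z s) (at z)"
    and bound: "AE s in M. \<forall>z\<in>ball z0 e. norm (f' z s) \<le> g s"
    and g: "integrable M g"
  shows "((\<lambda>z. \<integral>s. f z s \<partial>M) has_field_derivative (\<integral>s. f' z0 s \<partial>M)) (at z0)"
proof -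
  have "((\<lambda>h. ((\<integral>s. f (z0 + h) s \<partial>M) - (\<integral>s. f z0 s \<partial>M)) / h) \<longlongrightarrow> (\<integral>s. f' z0 s \<partial>M)) (at 0)"
    unfolding tendsto_at_iff_sequentially comp_def
  proof safe
    fix X :: "nat \<Rightarrow> 'b"
    assume X0: "\<forall>i. X i \<in> UNIV - {0}" and X: "X \<longlonglongrightarrow> 0"
    obtain N where N: "\<And>n. n \<ge> N \<Longrightarrow> norm (X n) < e"
      using LIMSEQ_D[OF X e] by auto
    define Y where "Y n = X (n + N)" for n
    have Y0: "Y n \<noteq> 0" for n using X0 by (auto simp: Y_def)
    have Ye: "norm (Y n) < e" for n using N by (auto simp: Y_def)
    have Y: "Y \<longlonglongrightarrow> 0" unfolding Y_def using X by (rule LIMSEQ_ignore_initial_segment)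
    have ball: "z0 + Y n \<in> ball z0 e" "z0 \<in> ball z0 e" for n
      using Ye[of n] e by (auto simp: dist_norm)
    have "(\<lambda>n. \<integral>s. (f (z0 + Y n) s - f z0 s) / Y n \<partial>M) \<longlonglongrightarrow> (\<integral>s. f' z0 s \<partial>M)"
    proof (rule integral_dominated_convergence[OF meas _ g])
      show "(\<lambda>s. (f (z0 + Y n) s - f z0 s) / Y n) \<in> borel_measurable M" for n
        using int[OF ball(1)[of n]] int[OF ball(2)] by simp
      show "AE s in M. (\<lambda>n. (f (z0 + Y n) s - f z0 s) / Y n) \<longlonglongrightarrow> f' z0 s"
        using der
      proof eventually_elim
        case (elim s)
        then have "((\<lambda>h. (f (z0 + h) s - f z0 s) / h) \<longlongrightarrow> f' z0 s) (at 0)"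
          using ball(2) unfolding DERIV_def by blast
        then show ?case using Y Y0
          unfolding tendsto_at_iff_sequentially comp_def by auto
      qed
      \<comment> \<open>The difference quotients are dominated by \<open>g\<close>, by the mean value inequality.\<close>
      show "AE s in M. norm ((f (z0 + Y n) s - f z0 s) / Y n) \<le> g s" for n
        using der bound
      proof eventually_elim
        case (elim s)
        have "norm (f (z0 + Y n) s - f z0 s) \<le> g s * norm (z0 + Y n - z0)"
        proof (rule field_differentiable_bound[of "ball z0 e"])
          show "((\<lambda>z. f z s) has_field_derivative f' z s) (at z within ball z0 e)"
            if "z \<in> ball z0 e" for z using elim that by (blast intro: has_field_derivative_at_within)
        qed (use elim ball in auto)
        then show ?case using Y0[of n] by (simp add: norm_divide field_simps)
      qed
    qed
    also have "(\<lambda>n. \<integral>s. (f (z0 + Y n) s - f z0 s) / Y n \<partial>M) =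
       (\<lambda>n. ((\<integral>s. f (z0 + Y n) s \<partial>M) - (\<integral>s. f z0 s \<partial>M)) / Y n)"
      using int[OF ball(1)] int[OF ball(2)] by (auto simp: fun_eq_iff)
    finally show "(\<lambda>n. ((\<integral>s. f (z0 + X n) s \<partial>M) - (\<integral>s. f z0 s \<partial>M)) / X n) \<longlonglongrightarrow> (\<integral>s. f' z0 s \<partial>M)"
      unfolding Y_def by (rule LIMSEQ_offset)
  qed
  then show "((\<lambda>z. \<integral>s. f z s \<partial>M) has_field_derivative (\<integral>s. f' z0 s \<partial>M)) (at z0)"
    by (simp add: DERIV_def)
qed

lemma continuous_on_lebesgue_integral:
  fixes f :: "'a::metric_space \<Rightarrow> 'c \<Rightarrow> 'b::{banach, second_countable_topology}"
  assumes meas: "\<And>x. x \<in> S \<Longrightarrow> f x \<in> borel_measurable M"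
    and cont: "AE s in M. continuous_on S (\<lambda>x. f x s)"
    and bound: "\<And>x. x \<in> S \<Longrightarrow> AE s in M. norm (f x s) \<le> g s"
    and g: "integrable M g"
  shows "continuous_on S (\<lambda>x. \<integral>s. f x s \<partial>M)"
  unfolding continuous_on_sequentially comp_def
proof safe
  fix X a assume a: "a \<in> S" and X: "\<forall>n. X n \<in> S" "X \<longlonglongrightarrow> a"
  show "(\<lambda>n. \<integral>s. f (X n) s \<partial>M) \<longlonglongrightarrow> (\<integral>s. f a s \<partial>M)"
  proof (rule integral_dominated_convergence[OF meas[OF a] _ g])
    show "AE s in M. (\<lambda>n. f (X n) s) \<longlonglongrightarrow> f a s"
      using cont
    proof eventually_elim
      case (elim s)
      then show ?case using a X unfolding continuous_on_sequentially comp_def by blast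
    qed
  qed (use X meas bound in auto)
qed

text \<open>\<open>S\<close> stands for the running supremum of \<open>F\<close>, so that \<open>r\<close> is the generalised inverse of \<open>S\<close> at \<open>y\<close>.
  Continuity turns \<open>r\<close> into a solution of \<open>F r = y\<close>.\<close>

lemma running_sup_inverse:
  fixes F :: "real \<Rightarrow> real" and S :: "real \<Rightarrow> real"
  assumes cont: "continuous_on {0..} F" and F0: "F 0 = 0"
    and S_le: "\<And>r y. 0 < r \<Longrightarrow> S r \<le> y \<longleftrightarrow> (\<forall>z\<in>{0<..r}. F z \<le> y)"
    and y: "0 < y" and unb: "\<exists>z>0. y < F z"
  defines "r \<equiv> Sup {r. 0 < r \<and> S r = y}"
  shows "0 < r" "F r = y"
proof -
  obtain R where R: "R > 0" "F R > y" using unb by auto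
  define A where "A = {r. 0 \<le> r \<and> (\<forall>z\<in>{0..r}. F z \<le> y)}"
  have A0: "0 \<in> A" using F0 y by (auto simp: A_def)
  have AR: "x \<le> R" if "x \<in> A" for x 
  proof (rule ccontr)
    assume "\<not> x \<le> R"
    then have "R \<in> {0..x}" using R by auto
    then show False using that R unfolding A_def by fastforce
  qed
  have bdd: "bdd_above A" using AR by (auto simp: bdd_above_def)
  define m where "m = Sup A"
  have m_upper: "x \<le> m" if "x \<in> A" for x unfolding m_def using that bdd by (rule cSup_upper)
  have m0: "0 \<le> m" using m_upper A0 by blast
  have below: "F z \<le> y" if zm: "0 \<le> z" "z < m" for z
  proof -
    obtain x where "x \<in> A" "z < x" 
      using less_cSupD[of A z] zm(2) A0 unfolding m_def by (metis empty_iff)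
    then show ?thesis using zm by (auto simp: A_def)
  qed
  have Fm: "F m \<le> y"
  proof (cases "m = 0")
    case False
    then have m: "m > 0" using m0 by simp
    have "isCont F m" using cont m by (intro continuous_on_interior[of "{0..}"]) (auto simp: interior_real_atLeast)
    then have "(F \<longlongrightarrow> F m) (at_left m)" by (simp add: isCont_def filterlim_at_split)
    moreover have "eventually (\<lambda>z. F z \<le> y) (at_left m)"
      using eventually_at_left_real[OF m] by eventually_elim (use below in auto)
    ultimately show ?thesis by (intro tendsto_upperbound) auto
  qed (use F0 y in auto)
  have "F z \<le> y" if "0 \<le> z" "z \<le> m" for z using that below[of z] Fm by (cases "z = m") auto
  then have mA: "m \<in> A" using m0 unfolding A_def by auto
  have Fmy: "F m = y"
  proof (rule ccontr)
    assume "F m \<noteq> y"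
    then have lt: "F m < y" using Fm by simp
    have "(F \<longlongrightarrow> F m) (at m within {0..})" using cont m0 by (auto simp: continuous_on_def)
    then have "eventually (\<lambda>z. F z < y) (at m within {0..})" by (rule order_tendstoD(2)) (rule lt)
    then obtain d where d: "d > 0" "\<And>z. z \<ge> 0 \<Longrightarrow> z \<noteq> m \<Longrightarrow> dist z m < d \<Longrightarrow> F z < y"
      by (auto simp: eventually_at)
    have "m + d/2 \<in> A" unfolding A_def
    proof (safe)
      fix z assume z: "z \<in> {0..m + d/2}"
      show "F z \<le> y" using z d below[of z] Fm d(2)[of z]
        by (cases "z < m"; cases "z = m") (auto simp: dist_real_def intro: less_imp_le)
    qed (use m0 d in auto)
    then show False using m_upper d by force
  qed
  have mpos: "0 < m" using Fmy F0 y m0 by (cases "m = 0") auto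
  have Sm: "S m = y"
  proof (rule antisym)
    show "S m \<le> y" using S_le[OF mpos] mA by (auto simp: A_def)
    show "y \<le> S m" using S_le[OF mpos, of "S m"] mpos Fmy by auto
  qed
  have "r = m" unfolding r_def
  proof (rule cSup_eq_maximum)
    show "m \<in> {r. 0 < r \<and> S r = y}" using mpos Sm by simp
    show "x \<le> m" if "x \<in> {r. 0 < r \<and> S r = y}" for x
    proof (rule m_upper)
      have "\<forall>z\<in>{0<..x}. F z \<le> y" using that S_le[of x y] by auto
      then show "x \<in> A" using that F0 y unfolding A_def by (auto simp: le_less)
    qed
  qed
  then show "0 < r" "F r = y"
    using mpos Fmy by auto
qed

text \<open>The factor \<open>exp (Re w)\<close>, as opposed to \<open>exp \<bar>Re w\<bar>\<close>, is essential: multiplied by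
  \<open>\<bar>f(\<xi>)\<bar>\<close> it will be exactly the modulus of \<open>f\<close> at a shifted point.\<close>

lemma norm_exp_minus_linear_le:
  fixes w :: complex
  shows "norm (exp w - 1 - w) \<le> (norm w)\<^sup>2 * (1 + exp (Re w))"
proof -
  define m where "m = max 0 (Re w)"
  have "norm ((\<lambda>i::nat. exp) 0 w - (\<Sum>i\<le>1. (\<lambda>i::nat. exp) i 0 * (w - 0) ^ i / fact i))
      \<le> exp m * norm (w - 0) ^ Suc 1 / fact 1"
  proof (rule complex_Taylor[of "{z. Re z \<le> m}"])
    show "convex {z. Re z \<le> m}" using convex_halfspace_Re_le .
  qed (auto simp: m_def intro!: derivative_eq_intros)
  then have "norm (exp w - 1 - w) \<le> exp m * (norm w)\<^sup>2"
    by (simp add: power2_eq_square algebra_simps)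
  also have "\<dots> \<le> (1 + exp (Re w)) * (norm w)\<^sup>2"
    by (intro mult_right_mono) (auto simp: m_def max_def)
  finally show ?thesis by (simp add: mult.commute)
qed

lemma integrable_inverse_1_plus_square_lborel:
  "integrable lborel (\<lambda>x::real. inverse (1 + x\<^sup>2))"
  using integrable_inverse_1_plus_square by (simp add: set_integrable_def)

section \<open>Densities by Fourier inversion\<close>

text \<open>The inverse of the transform \<open>char\<close>, for integrable \<open>F\<close>. It is complex valued; for the
  characteristic function of a law it is the density, whose real part is taken below.\<close>

definition inverse_fourier :: "(real \<Rightarrow> complex) \<Rightarrow> real \<Rightarrow> complex" where
  "inverse_fourier F x = 1 / (2 * pi) * (CLBINT \<xi>. iexp (- (\<xi> * x)) * F \<xi>)"

lemma norm_iexp_of_real [simp]: "norm (iexp x) = 1"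
  by simp

lemma continuous_on_inverse_fourier:
  assumes "integrable lborel F"
  shows "continuous_on UNIV (inverse_fourier F)"
  unfolding inverse_fourier_def
proof (intro continuous_intros continuous_on_lebesgue_integral[where g="\<lambda>\<xi>. norm (F \<xi>)"])
  show "AE s in lborel. continuous_on UNIV (\<lambda>x. iexp (- (s * x)) * F s)"
    by (intro AE_I2 continuous_intros)
qed (use assms in \<open>auto simp: norm_mult\<close>)

lemma norm_inverse_fourier_le:
  assumes "integrable lborel F"
  shows "norm (inverse_fourier F x) \<le> (LINT \<xi>|lborel. norm (F \<xi>))"
proof -
  have "norm (CLBINT \<xi>. iexp (- (\<xi> * x)) * F \<xi>) \<le> (LINT \<xi>|lborel. norm (iexp (- (\<xi> * x)) * F \<xi>))"
    by (rule integral_norm_bound)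
  also have "\<dots> = (LINT \<xi>|lborel. norm (F \<xi>))" by (simp add: norm_mult)
  finally have *: "norm (CLBINT \<xi>. iexp (- (\<xi> * x)) * F \<xi>) \<le> (LINT \<xi>|lborel. norm (F \<xi>))" .
  have "norm (inverse_fourier F x) = 1 / (2 * pi) * norm (CLBINT \<xi>. iexp (- (\<xi> * x)) * F \<xi>)"
    unfolding inverse_fourier_def norm_mult by (simp add: norm_divide)
  also have "\<dots> \<le> 1 * norm (CLBINT \<xi>. iexp (- (\<xi> * x)) * F \<xi>)"
    using pi_gt3 by (intro mult_right_mono) auto
  finally show ?thesis using * by simp
qed

lemma integral_iexp_interval:
  assumes "a \<le> b" "t \<noteq> 0"
  shows "(CLBINT x. indicator {a..b} x *\<^sub>R iexp (- (t * x))) =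
    (iexp (- (t * a)) - iexp (- (t * b))) / (\<i> * t)"
proof -
  have "(CLBINT x. indicator {a..b} x *\<^sub>R iexp (- (t * x))) =
     (\<i> * iexp (- (t * b)) / t) - (\<i> * iexp (- (t * a)) / t)"
  proof (rule integral_FTC_Icc[OF assms(1)])
    fix x
    have "((\<lambda>z. \<i> * exp (- (\<i> * (t * z))) / t) has_field_derivative iexp (- (t * x))) (at (of_real x))"
      using assms(2) by (auto intro!: derivative_eq_intros simp: field_simps)
    then have "((\<lambda>x. \<i> * exp (- (\<i> * (complex_of_real t * complex_of_real x))) / t) has_vector_derivative iexp (- (t * x))) (at x within {a..b})"
      by (rule has_vector_derivative_real_field)
    then show "((\<lambda>x. \<i> * iexp (- (t * x)) / complex_of_real t) has_vector_derivative iexp (- (t * x))) (at x within {a..b})"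
      by simp
  next
    show "continuous_on {a..b} (\<lambda>x. iexp (- (t * x)))" by (intro continuous_intros)
  qed
  also have "\<dots> = (iexp (- (t * a)) - iexp (- (t * b))) / (\<i> * t)"
    using assms(2) by (simp add: field_simps)
  finally show ?thesis .
qed

lemma integral_inverse_fourier_interval:
  assumes F: "integrable lborel F" and "a \<le> b"
  shows "(CLBINT x. indicator {a..b} x *\<^sub>R inverse_fourier F x) =
    1 / (2 * pi) * (CLBINT t. (iexp (- (t * a)) - iexp (- (t * b))) / (\<i> * t) * F t)"
proof -
  define G :: "real \<Rightarrow> real \<Rightarrow> complex" where "G t x = indicator {a..b} x *\<^sub>R (iexp (- (t * x)) * F t)" for t x
  have Fm[measurable]: "F \<in> borel_measurable borel" using F by auto
  have int: "integrable (lborel \<Otimes>\<^sub>M lborel) (case_prod G)"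
  proof (rule lborel_pair.Fubini_integrable)
    show "case_prod G \<in> borel_measurable (lborel \<Otimes>\<^sub>M lborel)" unfolding G_def by measurable
    have "(\<integral>x. norm (G t x) \<partial>lborel) = (b - a) * norm (F t)" for t
      unfolding G_def norm_scaleR norm_mult using assms(2) by simp
    then show "integrable lborel (\<lambda>t. \<integral>x. norm (case (t, x) of (x, y) \<Rightarrow> G x y) \<partial>lborel)"
      using F by simp
    show "AE t in lborel. integrable lborel (\<lambda>x. case (t, x) of (x, y) \<Rightarrow> G x y)"
      unfolding G_def prod.case
      by (intro AE_I2 borel_integrable_atLeastAtMost' [unfolded set_integrable_def] continuous_intros)
  qed
  have "(CLBINT t. (iexp (- (t * a)) - iexp (- (t * b))) / (\<i> * t) * F t) =
      (CLBINT t. CLBINT x. G t x)"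
  proof (rule integral_cong_AE)
    have "AE t in lborel. t \<noteq> (0::real)" by (rule AE_lborel_singleton)
    then show "AE t in lborel. (iexp (- (t * a)) - iexp (- (t * b))) / (\<i> * t) * F t = (CLBINT x. G t x)"
    proof eventually_elim
      case (elim t)
      have "(CLBINT x. G t x) = (CLBINT x. (indicator {a..b} x *\<^sub>R iexp (- (t * x))) * F t)"
        by (simp add: G_def)
      also have "\<dots> = (CLBINT x. (indicator {a..b} x *\<^sub>R iexp (- (t * x)))) * F t" 
        by (rule integral_mult_left_zero)
      also have "\<dots> = (iexp (- (t * a)) - iexp (- (t * b))) / (\<i> * t) * F t"
        by (simp only: integral_iexp_interval[OF assms(2) elim])
      finally show ?case by simp
    qed
  qed (unfold G_def, measurable)
  also have "\<dots> = (CLBINT x. CLBINT t. G t x)"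
    using lborel_pair.Fubini_integral[OF int] by simp
  also have "\<dots> = (CLBINT x. (2 * pi) * (indicator {a..b} x *\<^sub>R inverse_fourier F x))"
    by (intro Bochner_Integration.integral_cong) (auto simp: G_def inverse_fourier_def)
  also have "\<dots> = (2 * pi) * (CLBINT x. (indicator {a..b} x *\<^sub>R inverse_fourier F x))"
    by (rule integral_mult_right_zero)
  finally show ?thesis by simp
qed

context real_distribution
begin

text \<open>The truncated integrals in Levy's inversion formula converge by dominated convergence, because
  the kernel is bounded by the length of the interval.\<close>

lemma measure_Ioc_eq_inverse_fourier:
  assumes char: "integrable lborel (char M)" and ab: "a \<le> b" "measure M {a} = 0" "measure M {b} = 0"
  shows "of_real (measure M {a<..b}) = (CLBINT x. indicator {a..b} x *\<^sub>R inverse_fourier (char M) x)"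
proof -
  let ?k = "\<lambda>t. (iexp (- (t * a)) - iexp (- (t * b))) / (\<i> * t) * char M t"
  have k: "norm (?k t) \<le> (b - a) * norm (char M t)" if "t \<noteq> 0" for t
    unfolding norm_mult using Levy_Inversion_aux2[of "-b" "-a", OF _ that] ab(1)
    by (intro mult_right_mono) simp_all
  have "(\<lambda>T. CLBINT t. indicator (einterval (ereal (- real T)) (ereal (real T))) t *\<^sub>R ?k t) \<longlonglongrightarrow> (CLBINT t. ?k t)"
  proof (rule integral_dominated_convergence[where w="\<lambda>t. (b - a) * norm (char M t)"])
    have nz: "AE t in lborel. t \<noteq> (0::real)" by (rule AE_lborel_singleton)
    show "AE t in lborel. norm (indicator (einterval (ereal (- real T)) (ereal (real T))) t *\<^sub>R ?k t) \<le> (b - a) * norm (char M t)" for T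
      using nz by eventually_elim (use k ab(1) in \<open>auto split: split_indicator simp del: of_real_mult of_real_minus\<close>)
    show "AE t in lborel. (\<lambda>T. indicator (einterval (ereal (- real T)) (ereal (real T))) t *\<^sub>R ?k t) \<longlonglongrightarrow> ?k t"
    proof (rule AE_I2)
      fix t :: real
      obtain N where N: "\<bar>t\<bar> < real N" using reals_Archimedean2 by blast
      have "eventually (\<lambda>T. indicator (einterval (ereal (- real T)) (ereal (real T))) t *\<^sub>R ?k t = ?k t) sequentially"
        using eventually_ge_at_top[of N] by eventually_elim (use N in \<open>simp add: einterval_def abs_less_iff indicator_def\<close>)
      then show "(\<lambda>T. indicator (einterval (ereal (- real T)) (ereal (real T))) t *\<^sub>R ?k t) \<longlonglongrightarrow> ?k t"
        by (rule tendsto_eventually)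
    qed
  qed (use char in auto)
  then have "(\<lambda>T. 1 / (2 * pi) * (CLBINT t=-real T..real T. ?k t)) \<longlonglongrightarrow> 1 / (2 * pi) * (CLBINT t. ?k t)"
    by (intro tendsto_intros) (simp add: interval_lebesgue_integral_def set_lebesgue_integral_def)
  moreover have "(\<lambda>T. 1 / (2 * pi) * (CLBINT t=-real T..real T. ?k t)) \<longlonglongrightarrow> of_real (measure M {a<..b})"
    using Levy_Inversion[OF ab] by simp
  ultimately have "1 / (2 * pi) * (CLBINT t. ?k t) = of_real (measure M {a<..b})"
    by (rule LIMSEQ_unique)
  then show ?thesis
    by (simp only: integral_inverse_fourier_interval[OF char ab(1)])
qed

text \<open>An atom \<open>c\<close> lies in arbitrarily short intervals whose end points are not atoms, and the
  mass of those is at most a constant times their length.\<close>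

lemma no_atoms_if_integrable_char:
  assumes char: "integrable lborel (char M)"
  shows "measure M {c} = 0"
proof -
  define B where "B = (LINT \<xi>|lborel. norm (char M \<xi>))"
  have "measure M {c} \<le> B * e" if e: "e > 0" for e
  proof -
    have cnt: "countable {x. measure M {x} \<noteq> 0}" by (rule countable_support)
    obtain a where a: "c - e/2 < a" "a < c" "measure M {a} = 0"
      using open_minus_countable[OF cnt, of "{c - e/2 <..< c}"] e by auto
    obtain b where b: "c < b" "b < c + e/2" "measure M {b} = 0"
      using open_minus_countable[OF cnt, of "{c <..< c + e/2}"] e by auto
    have "measure M {c} \<le> measure M {a<..b}"
      using a b by (intro finite_measure_mono) auto
    also have "\<dots> = norm (complex_of_real (measure M {a<..b}))" by simp
    also have "\<dots> = norm (CLBINT x. indicator {a..b} x *\<^sub>R inverse_fourier (char M) x)"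
      using measure_Ioc_eq_inverse_fourier[OF char _ a(3) b(3)] a b by simp
    also have "\<dots> \<le> (LINT x|lborel. indicator {a..b} x * B)"
    proof (rule order_trans[OF integral_norm_bound integral_mono])
      show "integrable lborel (\<lambda>x. norm (indicator {a..b} x *\<^sub>R inverse_fourier (char M) x))"
        using continuous_on_inverse_fourier[OF char]
        by (intro integrable_norm borel_integrable_atLeastAtMost'[unfolded set_integrable_def]) (auto intro: continuous_on_subset)
      show "integrable lborel (\<lambda>x. indicator {a..b} x * B)"
        by (rule integrable_mult_left, rule integrable_real_indicator) (auto simp: emeasure_lborel_Icc_eq)
    qed (use norm_inverse_fourier_le[OF char] in \<open>auto simp: B_def split: split_indicator\<close>)
    also have "\<dots> = (b - a) * B" using a b by simp
    also have "\<dots> \<le> e * B" using a b by (intro mult_right_mono) (auto simp: B_def)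
    finally show ?thesis by (simp add: mult.commute)
  qed
  then have le: "measure M {c} \<le> 0 + d" if "d > 0" for d
  proof -
    have B: "B \<ge> 0" by (simp add: B_def)
    have "measure M {c} \<le> B * (d / (B + 1))" using that B by (intro \<open>\<And>e. e > 0 \<Longrightarrow> _\<close>) auto
    also have "\<dots> \<le> d" using that B by (simp add: field_simps)
    finally show ?thesis by simp
  qed
  have "measure M {c} \<le> 0" by (rule field_le_epsilon) (rule le)
  then show ?thesis using measure_nonneg[of M "{c}"] by linarith
qed

theorem density_if_integrable_char:
  assumes char: "integrable lborel (char M)"
  defines "p \<equiv> (\<lambda>x. Re (inverse_fourier (char M) x))"
  shows "continuous_on UNIV p" "\<And>x. 0 \<le> p x" "M = density lborel (\<lambda>x. ennreal (p x))"
proof -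
  show cont: "continuous_on UNIV p"
    unfolding p_def by (intro continuous_intros continuous_on_inverse_fourier char)
  then have pm[measurable]: "p \<in> borel_measurable borel" by (rule borel_measurable_continuous_onI)
  have int: "integrable lborel (\<lambda>x. indicator {a..b} x *\<^sub>R inverse_fourier (char M) x)" for a b
    using continuous_on_inverse_fourier[OF char]
    by (intro borel_integrable_atLeastAtMost'[unfolded set_integrable_def]) (auto intro: continuous_on_subset)
  have intp: "integrable lborel (\<lambda>x. indicator {a..b} x * p x)" for a b
    using integrable_Re[OF int[of a b]] by (simp add: p_def)
  have eq: "measure M {a<..b} = (LBINT x. indicator {a..b} x * p x)" if "a \<le> b" for a b
  proof -
    have "measure M {a<..b} = Re (CLBINT x. indicator {a..b} x *\<^sub>R inverse_fourier (char M) x)"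
      using measure_Ioc_eq_inverse_fourier[OF char that no_atoms_if_integrable_char[OF char] no_atoms_if_integrable_char[OF char]]
      by (metis Re_complex_of_real)
    also have "\<dots> = (LBINT x. Re (indicator {a..b} x *\<^sub>R inverse_fourier (char M) x))"
      using int by (rule integral_Re[symmetric])
    finally show ?thesis by (simp add: p_def)
  qed
  show p0: "0 \<le> p x" for x
  proof (rule ccontr)
    assume "\<not> 0 \<le> p x"
    then have neg: "p x < p x / 2" "p x < 0" by auto
    have "isCont p x" using cont by (simp add: continuous_on_eq_continuous_at)
    then have "eventually (\<lambda>y. p y < p x / 2) (at x)"
      unfolding isCont_def by (rule order_tendstoD(2)) (rule neg)
    then obtain d where d: "d > 0" "\<And>y. y \<noteq> x \<Longrightarrow> dist y x < d \<Longrightarrow> p y < p x / 2"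
      by (auto simp: eventually_at)
    have "measure M {x<..x + d/2} = (LBINT y. indicator {x..x+d/2} y * p y)"
      using d by (intro eq) auto
    also have "\<dots> \<le> (LBINT y. indicator {x..x+d/2} y * (p x / 2))"
    proof (rule integral_mono[OF intp])
      show "indicator {x..x+d/2} y * p y \<le> indicator {x..x+d/2} y * (p x / 2)" for y
        using d(1) d(2)[of y] neg by (cases "y = x") (auto split: split_indicator simp: dist_real_def)
    qed (rule integrable_mult_left, rule integrable_real_indicator, auto simp: emeasure_lborel_Icc_eq)
    also have "\<dots> = d/2 * (p x / 2)" using d by simp
    also have "\<dots> < 0" using d neg by (simp add: mult_pos_neg)
    finally show False by (simp add: not_less[symmetric])
  qed
  show "M = density lborel (\<lambda>x. ennreal (p x))" (is "M = ?N")
  proof (rule measure_eqI_lessThan)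
    show "sets M = sets borel" by simp
    show "sets ?N = sets borel" by simp
    have Ioc: "emeasure M {a<..b} = emeasure ?N {a<..b}" if "a \<le> b" for a b
    proof -
      have "emeasure ?N {a<..b} = (\<integral>\<^sup>+x. ennreal (indicator {a..b} x * p x) \<partial>lborel)"
        using AE_lborel_singleton[of a]
        by (subst emeasure_density) (auto intro!: nn_integral_cong_AE elim!: eventually_mono split: split_indicator)
      also have "\<dots> = ennreal (LBINT x. indicator {a..b} x * p x)"
        using intp p0 by (intro nn_integral_eq_integral) auto
      also have "\<dots> = emeasure M {a<..b}"
        using eq[OF that] by (simp add: emeasure_eq_measure)
      finally show ?thesis by simp
    qed
    fix x :: real
    show "emeasure M {x<..} < \<infinity>" by (simp add: less_top[symmetric])
    have U: "{x<..} = (\<Union>n. {x<..x + real n})"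
    proof safe
      fix y assume "x < y"
      then show "y \<in> (\<Union>n. {x<..x + real n})"
        using real_arch_simple[of "y - x"] by (auto simp: algebra_simps)
    qed auto
    have inc: "incseq (\<lambda>n. {x<..x + real n})" by (auto simp: incseq_def)
    show "emeasure M {x<..} = emeasure ?N {x<..}"
      unfolding U using inc Ioc
      by (subst (1 2) SUP_emeasure_incseq[symmetric]) auto
  qed
qed

end

section \<open>Levy measures on the positive half-line\<close>

lemma square_exp_minus_le:
  fixes v :: real
  assumes "0 \<le> v"
  shows "v\<^sup>2 * exp (- v) \<le> min 1 v" "v\<^sup>2 * exp (- v) \<le> min 1 (v\<^sup>2)"
proof -
  have 1: "v \<le> exp v" using exp_ge_add_one_self[of v] by linarith
  \<comment> \<open>As \<open>2 \<le> e\<close>, this yields \<open>v \<le> exp (v/2)\<close>.\<close>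
  have "v / 2 \<le> exp (v/2 - 1)" using exp_ge_add_one_self[of "v/2 - 1"] by linarith
  also have "\<dots> = exp (v/2) / exp 1" by (simp add: exp_diff)
  also have "\<dots> \<le> exp (v/2) / 2" using exp_ge_add_one_self[of 1] by (intro divide_left_mono) auto
  finally have "v \<le> exp (v/2)" by simp
  then have "v\<^sup>2 \<le> (exp (v/2))\<^sup>2" using assms by (intro power_mono) auto
  also have "\<dots> = exp v" by (simp add: exp_double[symmetric])
  finally have 2: "v\<^sup>2 \<le> exp v" .
  have "v\<^sup>2 * exp (- v) \<le> 1" using 2 by (simp add: exp_minus field_simps)
  moreover have "v * (v * exp (- v)) \<le> v * 1" using 1 assms
    by (intro mult_left_mono) (auto simp: exp_minus field_simps)
  moreover have "v\<^sup>2 * exp (- v) \<le> v\<^sup>2 * 1" using assms by (intro mult_left_mono) auto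
  ultimately show "v\<^sup>2 * exp (- v) \<le> min 1 v" "v\<^sup>2 * exp (- v) \<le> min 1 (v\<^sup>2)"
    by (simp_all add: power2_eq_square mult.assoc)
qed

lemma one_minus_exp_minus_ge:
  fixes v :: real
  assumes "0 < v"
  shows "min 1 v \<le> 2 * (1 - exp (- v))"
proof -
  have "exp (- v) \<le> 1 / (1 + v)"
    using exp_ge_add_one_self[of v] assms by (simp add: exp_minus field_simps)
  then have "2 * (1 - 1 / (1 + v)) \<le> 2 * (1 - exp (- v))" by simp
  moreover have "min 1 v \<le> 2 * (1 - 1 / (1 + v))"
    using assms by (simp add: field_simps min_def)
  ultimately show ?thesis by (rule order_trans[rotated])
qed

lemma min_one_square_le_Laplace_kernel:
  fixes v :: real
  assumes "0 < v"
  shows "min 1 (v\<^sup>2) \<le> 5 * (1 - exp (- v) - v * exp (- v))"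
proof -
  define d where "d = 1 + v + v\<^sup>2/2"
  have d: "d > 0" using assms unfolding d_def by (intro add_pos_nonneg) auto
  have "d \<le> exp v" using exp_lower_Taylor_quadratic[of v] assms by (simp add: d_def)
  then have "exp (- v) \<le> 1 / d" using d by (simp add: exp_minus field_simps)
  then have "(1 + v) * exp (- v) \<le> (1 + v) * (1 / d)" using assms by (intro mult_left_mono) auto
  moreover have "min 1 (v\<^sup>2) \<le> 5 * (1 - (1 + v) * (1 / d))"
  proof -
    have eq: "1 - (1 + v) * (1 / d) = (v\<^sup>2/2) / d"
    proof -
      have "1 - (1 + v) * (1 / d) = (d - (1 + v)) / d" using d by (simp add: field_simps)
      then show ?thesis by (simp add: d_def)
    qed
    have "min 1 (v\<^sup>2) * d \<le> 5 * (v\<^sup>2/2)"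
    proof (cases "v \<le> 1")
      case True
      then have "v\<^sup>2 \<le> 1" using assms by (simp add: power_le_one)
      moreover have "d \<le> 5/2" using True \<open>v\<^sup>2 \<le> 1\<close> by (simp add: d_def)
      ultimately show ?thesis using mult_left_mono[of d "5/2" "v\<^sup>2"] by (simp add: min_def)
    next
      case False
      then have "v * 1 \<le> v * v" "1 \<le> v\<^sup>2" by (auto intro!: mult_left_mono one_le_power)
      then show ?thesis by (simp add: min_def d_def power2_eq_square)
    qed
    then show ?thesis unfolding eq using d by (simp add: field_simps)
  qed
  ultimately have "min 1 (v\<^sup>2) \<le> 5 * (1 - (1 + v) * exp (- v))"
    by (meson order_trans mult_left_mono diff_left_mono zero_le_numeral)
  then show ?thesis by (simp add: algebra_simps)
qed

lemma one_minus_cos_le: "1 - cos v \<le> 2 * min 1 (v\<^sup>2)" for v :: real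
proof -
  have "1 - cos v = 2 * (sin (v/2))\<^sup>2" using cos_double_sin[of "v/2"] by simp
  also have "\<dots> \<le> 2 * (v/2)\<^sup>2" using abs_sin_x_le_abs_x[of "v/2"] abs_le_square_iff[of "sin (v/2)" "v/2"] by simp
  also have "\<dots> = v\<^sup>2 / 2" by (simp add: power2_eq_square)
  also have "\<dots> \<le> 2 * v\<^sup>2" by simp
  finally have "1 - cos v \<le> 2 * v\<^sup>2" .
  moreover have "1 - cos v \<le> 2" using cos_ge_minus_one[of v] by linarith
  ultimately show ?thesis by (simp add: min_def)
qed

lemma one_minus_cos_ge: 
  fixes v :: real
  assumes "\<bar>v\<bar> \<le> 1"
  shows "v\<^sup>2 / 3 \<le> 1 - cos v"
proof -
  have "Re (iexp v - (\<Sum>k\<le>2. (\<i> * v)^k / fact k)) \<le> \<bar>v\<bar>^3 / 6"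
    using order_trans[OF complex_Re_le_cmod iexp_approx1[of v 2]] by (simp add: fact_numeral)
  moreover have "Re (iexp v - (\<Sum>k\<le>2. (\<i> * v)^k / fact k)) = cos v - (1 - v\<^sup>2/2)"
    by (simp add: numeral_2_eq_2 Re_exp power2_eq_square)
  moreover have "\<bar>v\<bar>^3 \<le> v\<^sup>2"
    using assms mult_left_mono[of "\<bar>v\<bar>" 1 "v\<^sup>2"] by (simp add: power3_eq_cube power2_eq_square abs_mult[symmetric])
  ultimately show ?thesis by linarith
qed

text \<open>Levy measures of subordinators. The measure lives on the whole line and does not charge
  the non-positive numbers, so integrals over \<open>(0,\<infinity>)\<close> are written as integrals over the line;
  integrands only need to be controlled for \<open>s > 0\<close>.\<close>

locale half_line_levy_measure =
  fixes \<nu> :: "real measure"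
  assumes levy_measure: "subordinator_levy_measure \<nu>"
begin

lemma sets_levy [measurable_cong, simp]: "sets \<nu> = sets borel"
  using levy_measure by (simp add: subordinator_levy_measure_def)

lemma space_levy [simp]: "space \<nu> = UNIV"
  using sets_eq_imp_space_eq[OF sets_levy] by simp

lemma AE_positive: "AE s in \<nu>. 0 < s"
proof (rule AE_I)
  show "emeasure \<nu> {..0} = 0" using levy_measure by (simp add: subordinator_levy_measure_def)
qed auto

lemma integrable_levyI:
  fixes f :: "real \<Rightarrow> 'b::{banach, second_countable_topology}"
  assumes [measurable]: "f \<in> borel_measurable borel"
    and bound: "\<And>s. 0 < s \<Longrightarrow> norm (f s) \<le> C * min 1 s"
  shows "integrable \<nu> f"
proof (rule Bochner_Integration.integrable_bound)
  show "integrable \<nu> (\<lambda>s. C * (indicator {0<..} s * min 1 s))"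
    using levy_measure by (simp add: subordinator_levy_measure_def set_integrable_def)
  show "AE s in \<nu>. norm (f s) \<le> norm (C * (indicator {0<..} s * min 1 s))"
    using AE_positive
  proof eventually_elim
    case (elim s)
    then show ?case using bound[OF elim] by (simp add: order_trans[OF _ abs_ge_self])
  qed
qed simp

lemma integral_levy_mono:
  fixes f g :: "real \<Rightarrow> real"
  assumes "integrable \<nu> f" "integrable \<nu> g" "\<And>s. 0 < s \<Longrightarrow> f s \<le> g s"
  shows "(\<integral>s. f s \<partial>\<nu>) \<le> (\<integral>s. g s \<partial>\<nu>)"
  using assms(1,2)
  by (rule integral_mono_AE) (use AE_positive assms(3) in \<open>auto elim!: eventually_mono\<close>)

lemma min_one_le_scale: "0 < s \<Longrightarrow> min 1 (u * s) \<le> max 1 \<bar>u\<bar> * min 1 s" for s u :: real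
proof -
  assume s: "0 < s"
  have "u * s \<le> max 1 \<bar>u\<bar> * s" using s by (intro mult_right_mono) auto
  then show ?thesis by (cases "s \<le> 1") (simp_all add: min.coboundedI1 min.coboundedI2)
qed

text \<open>Pruitt's concentration function, written in terms of the frequency \<open>u\<close>, the reciprocal of the
  spatial scale.\<close>

definition pruitt :: "real \<Rightarrow> real" where "pruitt u = (\<integral>s. min 1 ((u * s)\<^sup>2) \<partial>\<nu>)"

lemma min_one_square_le: "0 < s \<Longrightarrow> min 1 ((u * s)\<^sup>2) \<le> max 1 (u\<^sup>2) * min 1 s" for s u :: real
proof -
  assume s: "0 < s"
  have "min 1 ((u * s)\<^sup>2) \<le> max 1 (u\<^sup>2) * min 1 (s\<^sup>2)"
    using min_one_le_scale[of "s\<^sup>2" "u\<^sup>2"] s by (simp add: power_mult_distrib)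
  also have "min 1 (s\<^sup>2) \<le> min 1 s"
  proof (cases "s \<le> 1")
    case True
    then have "s\<^sup>2 \<le> s" using s by (simp add: power2_eq_square mult_left_le)
    then show ?thesis by (rule min.mono[OF order_refl])
  qed simp
  finally show ?thesis by (simp add: mult_left_mono)
qed

lemma integrable_pruitt: "integrable \<nu> (\<lambda>s. min 1 ((u * s)\<^sup>2))"
  by (rule integrable_levyI[where C="max 1 (u\<^sup>2)"]) (use min_one_square_le in auto)

lemma pruitt_nonneg: "0 \<le> pruitt u"
  unfolding pruitt_def by (intro integral_nonneg_AE) auto

lemma pruitt_mono: "\<bar>u\<bar> \<le> \<bar>v\<bar> \<Longrightarrow> pruitt u \<le> pruitt v"
  unfolding pruitt_def
  by (intro integral_levy_mono integrable_pruitt min.mono)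
     (auto simp: power_mult_distrib abs_le_square_iff intro!: mult_right_mono)

lemma pruitt_scale: "1 \<le> k \<Longrightarrow> pruitt (k * u) \<le> k\<^sup>2 * pruitt u"
proof -
  assume k: "1 \<le> k"
  have "pruitt (k * u) \<le> (\<integral>s. k\<^sup>2 * min 1 ((u * s)\<^sup>2) \<partial>\<nu>)"
    unfolding pruitt_def
  proof (intro integral_levy_mono integrable_pruitt integrable_mult_right)
    fix s :: real
    have "1 \<le> k\<^sup>2" using k by simp
    then show "min 1 ((k * u * s)\<^sup>2) \<le> k\<^sup>2 * min 1 ((u * s)\<^sup>2)"
      by (auto simp: min_def power_mult_distrib mult.assoc)
  qed
  then show ?thesis by (simp add: pruitt_def)
qed

lemma pruitt_small: "0 < e \<Longrightarrow> \<exists>u>0. u \<le> 1 \<and> pruitt u < e"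
proof -
  assume e: "0 < e"
  have "continuous_on {0..1} pruitt"
    unfolding pruitt_def
  proof (rule continuous_on_lebesgue_integral[where g="\<lambda>s. min 1 ((1 * s)\<^sup>2)"])
    show "AE s in \<nu>. norm (min 1 ((u * s)\<^sup>2)) \<le> min 1 ((1 * s)\<^sup>2)" if "u \<in> {0..1}" for u
    proof (rule AE_I2)
      fix s :: real
      have "u\<^sup>2 * s\<^sup>2 \<le> s\<^sup>2" using that by (intro mult_left_le_one_le power_le_one) auto
      then show "norm (min 1 ((u * s)\<^sup>2)) \<le> min 1 ((1 * s)\<^sup>2)"
        by (simp add: power_mult_distrib min.coboundedI2)
    qed
    show "AE s in \<nu>. continuous_on {0..1} (\<lambda>x. min 1 ((x * s)\<^sup>2))" by (intro AE_I2 continuous_intros)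
  qed (auto intro: integrable_pruitt[of 1, simplified])
  then have "(pruitt \<longlongrightarrow> pruitt 0) (at 0 within {0..1})" by (auto simp: continuous_on_def)
  then have "eventually (\<lambda>u. pruitt u < e) (at 0 within {0..1})"
    by (rule order_tendstoD) (simp add: pruitt_def e)
  then obtain d where "d > 0" and d: "\<And>u. u \<in> {0..1} \<Longrightarrow> u \<noteq> 0 \<Longrightarrow> dist u 0 < d \<Longrightarrow> pruitt u < e"
    by (auto simp: eventually_at)
  then show ?thesis
    by (intro exI[of _ "min 1 (d/2)"]) auto
qed

text \<open>The function \<open>varphi(u) = u\<^sup>2 (- \<phi>''(u))\<close>, directly in terms of the Levy measure; see
  \<open>varphi_eq_vphi\<close>.\<close>

definition vphi :: "real \<Rightarrow> real" where "vphi u = (\<integral>s. (u * s)\<^sup>2 * exp (- (u * s)) \<partial>\<nu>)"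

lemma vphi_bound: "0 < s \<Longrightarrow> 0 \<le> u \<Longrightarrow> u \<le> R \<Longrightarrow> norm ((u * s)\<^sup>2 * exp (- (u * s))) \<le> max 1 R * min 1 s"
proof -
  assume s: "0 < s" and u: "0 \<le> u" "u \<le> R"
  have "(u * s)\<^sup>2 * exp (- (u * s)) \<le> max 1 u * min 1 s"
    using order_trans[OF square_exp_minus_le(1) min_one_le_scale[OF s, of u]] s u by simp
  also have "\<dots> \<le> max 1 R * min 1 s" using s u by (intro mult_right_mono) auto
  finally show ?thesis by simp
qed

lemma integrable_vphi: "0 \<le> u \<Longrightarrow> integrable \<nu> (\<lambda>s. (u * s)\<^sup>2 * exp (- (u * s)))"
  by (rule integrable_levyI[where C="max 1 u"]) (use vphi_bound in auto)

lemma vphi_nonneg: "0 \<le> vphi u"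
  unfolding vphi_def by (intro integral_nonneg_AE) auto

lemma vphi_le_pruitt: "0 \<le> u \<Longrightarrow> vphi u \<le> pruitt u"
  unfolding vphi_def pruitt_def
  by (intro integral_levy_mono integrable_vphi integrable_pruitt square_exp_minus_le(2)) auto

lemma vphi_lower_scale: "0 < u \<Longrightarrow> u \<le> v \<Longrightarrow> (u / v)\<^sup>2 * vphi v \<le> vphi u"
proof -
  assume u: "0 < u" "u \<le> v"
  have "(u / v)\<^sup>2 * vphi v = (\<integral>s. (u / v)\<^sup>2 * ((v * s)\<^sup>2 * exp (- (v * s))) \<partial>\<nu>)"
    by (simp add: vphi_def)
  also have "\<dots> \<le> vphi u" unfolding vphi_def
  proof (intro integral_levy_mono integrable_mult_right integrable_vphi)
    fix s :: real assume s: "0 < s"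
    have "(u / v)\<^sup>2 * ((v * s)\<^sup>2 * exp (- (v * s))) = (u * s)\<^sup>2 * exp (- (v * s))"
      using u by (simp add: power_divide power_mult_distrib)
    also have "\<dots> \<le> (u * s)\<^sup>2 * exp (- (u * s))" using u s by (intro mult_left_mono) auto
    finally show "(u / v)\<^sup>2 * ((v * s)\<^sup>2 * exp (- (v * s))) \<le> (u * s)\<^sup>2 * exp (- (u * s))" .
  qed (use u in auto)
  finally show ?thesis .
qed

lemma continuous_on_vphi: "continuous_on {0..} vphi"
  unfolding continuous_on_eq_continuous_within
proof
  fix z :: real assume z: "z \<in> {0..}"
  have "continuous_on {0..z+1} vphi"
    unfolding vphi_def
  proof (rule continuous_on_lebesgue_integral[where g="\<lambda>s. max 1 (z+1) * min 1 \<bar>s\<bar>"])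
    show "AE s in \<nu>. norm ((u * s)\<^sup>2 * exp (- (u * s))) \<le> max 1 (z+1) * min 1 \<bar>s\<bar>" if "u \<in> {0..z+1}" for u
      using AE_positive by eventually_elim (use vphi_bound[of _ u "z+1"] that in auto)
    show "AE s in \<nu>. continuous_on {0..z+1} (\<lambda>x. (x * s)\<^sup>2 * exp (- (x * s)))" by (intro AE_I2 continuous_intros)
    show "integrable \<nu> (\<lambda>s. max 1 (z+1) * min 1 \<bar>s\<bar>)"
      by (rule integrable_levyI[where C="max 1 (z+1)"]) auto
  qed auto
  then have "continuous (at z within {0..z+1}) vphi"
    using z by (auto simp: continuous_on_eq_continuous_within)
  moreover have "at z within {0..z+1} = at z within {0..}"
    by (rule at_within_nhd[of _ "{..<z+1}"]) auto
  ultimately show "continuous (at z within {0..}) vphi" by simp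
qed

text \<open>The real part of the Levy--Khintchine exponent.\<close>

definition re_psi :: "real \<Rightarrow> real" where "re_psi u = (\<integral>s. 1 - cos (u * s) \<partial>\<nu>)"

lemma cos_bound: "0 < s \<Longrightarrow> norm (1 - cos (u * s)) \<le> 2 * max 1 (u\<^sup>2) * min 1 s" for u s :: real
  using order_trans[OF one_minus_cos_le[of "u * s"], of "2 * max 1 (u\<^sup>2) * min 1 s"] min_one_square_le[of s u]
  by simp

lemma integrable_re_psi: "integrable \<nu> (\<lambda>s. 1 - cos (u * s))"
  by (rule integrable_levyI[where C="2 * max 1 (u\<^sup>2)"]) (use cos_bound in auto)

lemma re_psi_le_pruitt: "re_psi u \<le> 2 * pruitt u"
proof -
  have "re_psi u \<le> (\<integral>s. 2 * min 1 ((u * s)\<^sup>2) \<partial>\<nu>)"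
    unfolding re_psi_def
    by (intro integral_levy_mono integrable_re_psi integrable_mult_right integrable_pruitt one_minus_cos_le)
  then show ?thesis by (simp add: pruitt_def)
qed

lemma re_psi_uminus: "re_psi (- u) = re_psi u" by (simp add: re_psi_def)

lemma re_psi_nonneg: "0 \<le> re_psi u"
  unfolding re_psi_def by (intro integral_nonneg_AE) auto

lemma continuous_on_re_psi: "continuous_on UNIV re_psi"
  unfolding continuous_on_eq_continuous_within
proof
  fix z :: real
  define R where "R = \<bar>z\<bar> + 1"
  have "continuous_on {-R..R} re_psi"
    unfolding re_psi_def
  proof (rule continuous_on_lebesgue_integral[where g="\<lambda>s. 2 * max 1 (R\<^sup>2) * min 1 \<bar>s\<bar>"])
    show "AE s in \<nu>. norm (1 - cos (u * s)) \<le> 2 * max 1 (R\<^sup>2) * min 1 \<bar>s\<bar>" if "u \<in> {-R..R}" for u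
      using AE_positive
    proof eventually_elim
      case (elim s)
      have "u\<^sup>2 \<le> R\<^sup>2" using that by (intro abs_le_square_iff[THEN iffD1]) (auto simp: R_def)
      then have "2 * max 1 (u\<^sup>2) * min 1 s \<le> 2 * max 1 (R\<^sup>2) * min 1 s"
        using elim by (intro mult_right_mono mult_left_mono max.mono) auto
      with cos_bound[OF elim, of u] have "norm (1 - cos (u * s)) \<le> 2 * max 1 (R\<^sup>2) * min 1 s"
        by (rule order_trans)
      then show ?case using elim by simp
    qed
    show "AE s in \<nu>. continuous_on {-R..R} (\<lambda>x. 1 - cos (x * s))" by (intro AE_I2 continuous_intros)
    show "integrable \<nu> (\<lambda>s. 2 * max 1 (R\<^sup>2) * min 1 \<bar>s\<bar>)"
      by (rule integrable_levyI[where C="2 * max 1 (R\<^sup>2)"]) auto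
  qed auto
  then have "continuous (at z within {-R<..<R}) re_psi"
    by (rule continuous_on_eq_continuous_within[THEN iffD1, rule_format, OF continuous_on_subset])
       (auto simp: R_def abs_if)
  moreover have "at z within {-R<..<R} = at z within UNIV"
    by (rule at_within_nhd[of _ "{-R<..<R}"]) (auto simp: R_def abs_if)
  ultimately show "continuous (at z within UNIV) re_psi" by simp
qed

text \<open>Jumps below \<open>1/u\<close> are controlled by \<open>1 - cos (u s)\<close>; the larger ones contribute at most
  \<open>pruitt u\<close>, whatever \<open>k\<close> is. Together with lower scaling of \<open>pruitt\<close> this bounds \<open>re_psi\<close> from below.\<close>

lemma pruitt_scale_le_re_psi:
  assumes u: "0 < u" and k: "1 \<le> k"
  shows "pruitt (k * u) \<le> 3 * k\<^sup>2 * re_psi u + pruitt u"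
proof -
  have "pruitt (k * u) \<le> (\<integral>s. 3 * k\<^sup>2 * (1 - cos (u * s)) + min 1 ((u * s)\<^sup>2) \<partial>\<nu>)"
    unfolding pruitt_def
  proof (intro integral_levy_mono integrable_pruitt Bochner_Integration.integrable_add integrable_mult_right integrable_re_psi)
    fix s :: real assume s: "0 < s"
    show "min 1 ((k * u * s)\<^sup>2) \<le> 3 * k\<^sup>2 * (1 - cos (u * s)) + min 1 ((u * s)\<^sup>2)"
    proof (cases "u * s \<le> 1")
      case True
      have "(u * s)\<^sup>2 \<le> 3 * (1 - cos (u * s))"
        using one_minus_cos_ge[of "u * s"] u s True by simp
      then have "k\<^sup>2 * (u * s)\<^sup>2 \<le> k\<^sup>2 * (3 * (1 - cos (u * s)))" by (intro mult_left_mono) auto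
      moreover have "min 1 ((k * u * s)\<^sup>2) \<le> k\<^sup>2 * (u * s)\<^sup>2"
        by (simp add: power_mult_distrib mult.assoc)
      ultimately have "min 1 ((k * u * s)\<^sup>2) \<le> 3 * k\<^sup>2 * (1 - cos (u * s))"
        by (simp only: mult.assoc mult.left_commute[of 3])
      then show ?thesis by (rule order_trans) simp
    next
      case False
      then have "1 \<le> (u * s)\<^sup>2" by (simp add: one_le_power)
      moreover have "0 \<le> 3 * k\<^sup>2 * (1 - cos (u * s))" by simp
      ultimately show ?thesis by linarith
    qed
  qed
  also have "\<dots> = 3 * k\<^sup>2 * re_psi u + pruitt u"
    unfolding re_psi_def pruitt_def
    by (subst Bochner_Integration.integral_add) (auto intro: integrable_re_psi integrable_pruitt)
  finally show ?thesis .
qed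

end

section \<open>The characteristic function of a subordinator\<close>

lemma norm_one_minus_exp_le:
  fixes w :: complex
  assumes "Re w \<le> 0"
  shows "norm (1 - exp w) \<le> norm w" "norm (1 - exp w) \<le> 2"
proof -
  have "norm ((\<lambda>i::nat. exp) 0 w - (\<Sum>i\<le>0. (\<lambda>i::nat. exp) i 0 * (w - 0) ^ i / fact i))
      \<le> 1 * norm (w - 0) ^ Suc 0 / fact 0"
  proof (rule complex_Taylor[of "{z. Re z \<le> 0}"])
    show "convex {z. Re z \<le> 0}" using convex_halfspace_Re_le .
  qed (use assms in \<open>auto intro!: derivative_eq_intros\<close>)
  then show "norm (1 - exp w) \<le> norm w" by (simp add: norm_minus_commute)
  show "norm (1 - exp w) \<le> 2"
    using norm_triangle_ineq4[of 1 "exp w"] assms by simp (smt (verit) exp_le_one_iff)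
qed

lemma mult_exp_minus_le:
  fixes v e :: real
  assumes "0 < e"
  shows "v * exp (- (e * v)) \<le> 1 / e"
proof -
  have "e * v \<le> exp (e * v)" using exp_ge_add_one_self[of "e * v"] by linarith
  then show ?thesis using assms by (simp add: exp_minus field_simps)
qed

context half_line_levy_measure
begin

lemma first_kernel_bound:
  fixes s e r :: real
  assumes "0 < s" "0 < e" "e \<le> r"
  shows "s * exp (- (r * s)) \<le> max 1 (1 / e) * min 1 s"
proof -
  have "s * exp (- (r * s)) \<le> s * exp (- (e * s))" using assms by (intro mult_left_mono) auto
  moreover have "s * exp (- (e * s)) \<le> 1 / e" using assms(2) by (rule mult_exp_minus_le)
  moreover have "s * exp (- (e * s)) \<le> s * 1" using assms by (intro mult_left_mono) auto
  ultimately have "s * exp (- (r * s)) \<le> min (1/e) s" by simp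
  also have "\<dots> \<le> max 1 (1/e) * min 1 s"
  proof (cases "s \<le> 1")
    case True
    have "s * 1 \<le> s * max 1 (1/e)" using assms by (intro mult_left_mono) auto
    then show ?thesis using True by (simp add: min.coboundedI2 mult.commute)
  qed (simp add: min.coboundedI1)
  finally show ?thesis .
qed

lemma second_kernel_bound:
  fixes s e r :: real
  assumes "0 < s" "0 < e" "e \<le> r"
  shows "s\<^sup>2 * exp (- (r * s)) \<le> (max 1 e / e\<^sup>2) * min 1 s"
proof -
  have "s\<^sup>2 * exp (- (r * s)) \<le> s\<^sup>2 * exp (- (e * s))" using assms by (intro mult_left_mono) auto
  also have "\<dots> = ((e * s)\<^sup>2 * exp (- (e * s))) / e\<^sup>2" using assms by (simp add: power_mult_distrib)
  also have "\<dots> \<le> (max 1 e * min 1 s) / e\<^sup>2"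
    using vphi_bound[of s e e] assms by (intro divide_right_mono) auto
  finally show ?thesis by simp
qed

lemma integrable_first_kernel: "0 < u \<Longrightarrow> integrable \<nu> (\<lambda>s. s * exp (- (u * s)))"
  by (rule integrable_levyI[where C="max 1 (1/u)"]) (use first_kernel_bound in auto)

lemma integrable_zeroth_kernel: "0 \<le> u \<Longrightarrow> integrable \<nu> (\<lambda>s. 1 - exp (- (u * s)))"
proof (rule integrable_levyI[where C="max 1 u"])
  fix s :: real assume u: "0 \<le> u" and s: "0 < s"
  have "1 - exp (- (u * s)) \<le> min 1 (u * s)" using exp_ge_add_one_self[of "- (u * s)"] by simp
  also have "\<dots> \<le> max 1 u * min 1 s" using min_one_le_scale[OF s, of u] u by simp
  finally show "norm (1 - exp (- (u * s))) \<le> max 1 u * min 1 s" using u s by simp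
qed auto

lemma DERIV_Laplace_integral:
  assumes u: "0 < u"
  shows "((\<lambda>u. \<integral>s. 1 - exp (- (u * s)) \<partial>\<nu>) has_real_derivative (\<integral>s. s * exp (- (u * s)) \<partial>\<nu>)) (at u)"
proof (rule has_field_derivative_integral[where e="u/2" and g="\<lambda>s. max 1 (1 / (u/2)) * min 1 \<bar>s\<bar>"])
  have ball: "u/2 \<le> z" if "z \<in> ball u (u/2)" for z using that by (auto simp: dist_real_def abs_if split: if_splits)
  show "integrable \<nu> (\<lambda>s. 1 - exp (- (z * s)))" if "z \<in> ball u (u/2)" for z
    using ball[OF that] u by (intro integrable_zeroth_kernel) auto
  show "AE s in \<nu>. \<forall>z\<in>ball u (u / 2). norm (s * exp (- (z * s))) \<le> max 1 (1 / (u/2)) * min 1 \<bar>s\<bar>"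
    using AE_positive
  proof eventually_elim
    case (elim s)
    then show ?case using first_kernel_bound[OF elim, of "u/2"] ball u by simp
  qed
  show "integrable \<nu> (\<lambda>s. max 1 (1 / (u/2)) * min 1 \<bar>s\<bar>)"
    by (rule integrable_levyI[where C="max 1 (1 / (u/2))"]) auto
qed (use u in \<open>auto intro!: derivative_eq_intros AE_I2\<close>)

lemma DERIV_first_kernel_integral:
  assumes u: "0 < u"
  shows "((\<lambda>u. \<integral>s. s * exp (- (u * s)) \<partial>\<nu>) has_real_derivative - (\<integral>s. s\<^sup>2 * exp (- (u * s)) \<partial>\<nu>)) (at u)"
proof -
  let ?C = "max 1 (u/2) / (u/2)\<^sup>2"
  have ball: "u/2 \<le> z" if "z \<in> ball u (u/2)" for z using that by (auto simp: dist_real_def abs_if split: if_splits)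
  have "((\<lambda>u. \<integral>s. s * exp (- (u * s)) \<partial>\<nu>) has_real_derivative (\<integral>s. - (s\<^sup>2 * exp (- (u * s))) \<partial>\<nu>)) (at u)"
  proof (rule has_field_derivative_integral[where e="u/2" and g="\<lambda>s. ?C * min 1 \<bar>s\<bar>"])
    show "integrable \<nu> (\<lambda>s. s * exp (- (z * s)))" if "z \<in> ball u (u/2)" for z
      using ball[OF that] u by (intro integrable_first_kernel) auto
    show "AE s in \<nu>. \<forall>z\<in>ball u (u / 2). norm (- (s\<^sup>2 * exp (- (z * s)))) \<le> ?C * min 1 \<bar>s\<bar>"
      using AE_positive
    proof eventually_elim
      case (elim s)
      then show ?case using second_kernel_bound[OF elim, of "u/2"] ball u by simp
    qed
    show "integrable \<nu> (\<lambda>s. ?C * min 1 \<bar>s\<bar>)"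
      by (rule integrable_levyI[where C="?C"]) auto
  qed (use u in \<open>auto intro!: derivative_eq_intros AE_I2 simp: power2_eq_square\<close>)
  then show ?thesis by simp
qed

text \<open>The integral part of the Laplace exponent, extended to the closed right half-plane.\<close>

definition Laplace_integral :: "complex \<Rightarrow> complex" where
  "Laplace_integral z = (\<integral>s. 1 - exp (- (z * of_real s)) \<partial>\<nu>)"

lemma complex_kernel_bound: "0 < s \<Longrightarrow> 0 \<le> Re z \<Longrightarrow> norm (1 - exp (- (z * of_real s))) \<le> max 2 (norm z) * min 1 s"
proof -
  assume s: "0 < s" and z: "0 \<le> Re z"
  have re: "Re (- (z * of_real s)) \<le> 0" using s z by simp
  have 1: "norm (1 - exp (- (z * of_real s))) \<le> norm z * s"
    using norm_one_minus_exp_le(1)[OF re] s by (simp add: norm_mult)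
  have "norm z * s \<le> max 2 (norm z) * s" using s by (intro mult_right_mono) auto
  then show ?thesis using 1 norm_one_minus_exp_le(2)[OF re]
    by (cases "s \<le> 1") (simp_all add: le_max_iff_disj)
qed

lemma integrable_complex_kernel:
  "0 \<le> Re z \<Longrightarrow> integrable \<nu> (\<lambda>s. 1 - exp (- (z * of_real s)))"
  by (rule integrable_levyI[where C="max 2 (norm z)"]) (use complex_kernel_bound in auto)

lemma holomorphic_Laplace_integral: "Laplace_integral holomorphic_on {z. 0 < Re z}"
proof -
  have "(Laplace_integral has_field_derivative (\<integral>s. of_real s * exp (- (z * of_real s)) \<partial>\<nu>)) (at z)"
    if z: "0 < Re z" for z
    unfolding Laplace_integral_def
  proof (rule has_field_derivative_integral[where e="Re z/2" and g="\<lambda>s. max 1 (1 / (Re z/2)) * min 1 \<bar>s\<bar>"])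
    have ball: "Re z/2 \<le> Re w" if "w \<in> ball z (Re z/2)" for w
      using abs_Re_le_cmod[of "z - w"] that by (auto simp: dist_norm)
    show "integrable \<nu> (\<lambda>s. 1 - exp (- (w * of_real s)))" if "w \<in> ball z (Re z/2)" for w
      using ball[OF that] z by (intro integrable_complex_kernel) auto
    show "AE s in \<nu>. \<forall>w\<in>ball z (Re z / 2). norm (of_real s * exp (- (w * of_real s))) \<le> max 1 (1 / (Re z/2)) * min 1 \<bar>s\<bar>"
      using AE_positive
    proof eventually_elim
      case (elim s)
      show ?case
      proof
        fix w assume w: "w \<in> ball z (Re z / 2)"
        show "norm (of_real s * exp (- (w * of_real s))) \<le> max 1 (1 / (Re z/2)) * min 1 \<bar>s\<bar>"
          using first_kernel_bound[OF elim, of "Re z/2" "Re w"] ball[OF w] z elim by (simp add: norm_mult)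
      qed
    qed
    show "integrable \<nu> (\<lambda>s. max 1 (1 / (Re z/2)) * min 1 \<bar>s\<bar>)"
      by (rule integrable_levyI[where C="max 1 (1 / (Re z/2))"]) auto
  qed (use z in \<open>auto intro!: derivative_eq_intros AE_I2\<close>)
  then show ?thesis by (auto simp: holomorphic_on_open open_halfspace_Re_gt)
qed

lemma continuous_on_Laplace_integral:
  "continuous_on {z. 0 \<le> Re z \<and> norm z \<le> R} Laplace_integral"
  unfolding Laplace_integral_def
proof (rule continuous_on_lebesgue_integral[where g="\<lambda>s. max 2 R * min 1 \<bar>s\<bar>"])
  show "AE s in \<nu>. norm (1 - exp (- (z * of_real s))) \<le> max 2 R * min 1 \<bar>s\<bar>" if "z \<in> {z. 0 \<le> Re z \<and> norm z \<le> R}" for z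
    using AE_positive
  proof eventually_elim
    case (elim s)
    have "max 2 (norm z) * min 1 s \<le> max 2 R * min 1 s" using that elim by (intro mult_right_mono) auto
    then have "norm (1 - exp (- (z * of_real s))) \<le> max 2 R * min 1 s"
      using complex_kernel_bound[OF elim, of z] that by (auto intro: order_trans)
    then show ?case using elim by simp
  qed
  show "AE s in \<nu>. continuous_on {z. 0 \<le> Re z \<and> norm z \<le> R} (\<lambda>z. 1 - exp (- (z * of_real s)))"
    by (intro AE_I2 continuous_intros)
  show "integrable \<nu> (\<lambda>s. max 2 R * min 1 \<bar>s\<bar>)"
    by (rule integrable_levyI[where C="max 2 R"]) auto
qed auto

lemma Laplace_integral_of_real: "Laplace_integral (of_real u) = of_real (\<integral>s. 1 - exp (- (u * s)) \<partial>\<nu>)"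
proof -
  have "Laplace_integral (of_real u) = (\<integral>s. complex_of_real (1 - exp (- (u * s))) \<partial>\<nu>)"
    unfolding Laplace_integral_def by (simp add: exp_of_real[symmetric])
  then show ?thesis by (simp only: integral_complex_of_real)
qed

end

context prob_space
begin

lemma integrable_Laplace:
  fixes z :: complex and X :: "'a \<Rightarrow> real"
  assumes [measurable]: "X \<in> borel_measurable M" and X: "AE x in M. 0 \<le> X x" and "0 \<le> Re z"
  shows "integrable M (\<lambda>x. exp (- (z * of_real (X x))))"
proof (rule integrable_const_bound[where B=1])
  show "AE x in M. norm (exp (- (z * of_real (X x)))) \<le> 1"
    using X by eventually_elim (use assms(3) in simp)
qed simp

lemma holomorphic_Laplace_transform:
  fixes X :: "'a \<Rightarrow> real"
  assumes [measurable]: "X \<in> borel_measurable M" and X: "AE x in M. 0 \<le> X x"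
  shows "(\<lambda>z. CLINT x|M. exp (- (z * of_real (X x)))) holomorphic_on {z. 0 < Re z}"
proof -
  have "((\<lambda>z. CLINT x|M. exp (- (z * of_real (X x)))) has_field_derivative
      (CLINT x|M. - (of_real (X x) * exp (- (z * of_real (X x)))))) (at z)" if z: "0 < Re z" for z
  proof (rule has_field_derivative_integral[where e="Re z/2" and g="\<lambda>s. 1 / (Re z/2)"])
    have ball: "Re z/2 \<le> Re w" if "w \<in> ball z (Re z/2)" for w
      using abs_Re_le_cmod[of "z - w"] that by (auto simp: dist_norm)
    show "integrable M (\<lambda>x. exp (- (w * of_real (X x))))" if "w \<in> ball z (Re z/2)" for w
      using ball[OF that] z X by (intro integrable_Laplace) auto
    show "AE x in M. \<forall>w\<in>ball z (Re z / 2). norm (- (of_real (X x) * exp (- (w * of_real (X x))))) \<le> 1 / (Re z/2)"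
      using X
    proof eventually_elim
      case (elim x)
      show ?case
      proof
        fix w assume w: "w \<in> ball z (Re z / 2)"
        have "X x * exp (- (Re w * X x)) \<le> X x * exp (- (Re z/2 * X x))"
          using mult_right_mono[OF ball[OF w] elim] elim by (intro mult_left_mono) auto
        also have "\<dots> \<le> 1 / (Re z/2)" using z by (intro mult_exp_minus_le) simp
        finally show "norm (- (of_real (X x) * exp (- (w * of_real (X x))))) \<le> 1 / (Re z/2)"
          using elim by (simp add: norm_mult)
      qed
    qed
  qed (use z in \<open>auto intro!: derivative_eq_intros AE_I2\<close>)
  then show ?thesis by (auto simp: holomorphic_on_open open_halfspace_Re_gt)
qed

lemma continuous_on_Laplace_transform:
  fixes X :: "'a \<Rightarrow> real"
  assumes [measurable]: "X \<in> borel_measurable M" and X: "AE x in M. 0 \<le> X x"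
  shows "continuous_on {z. 0 \<le> Re z} (\<lambda>z. CLINT x|M. exp (- (z * of_real (X x))))"
proof (rule continuous_on_lebesgue_integral[where g="\<lambda>s. 1"])
  show "AE x in M. norm (exp (- (z * of_real (X x)))) \<le> 1" if "z \<in> {z. 0 \<le> Re z}" for z
    using X by eventually_elim (use that in simp)
  show "AE x in M. continuous_on {z. 0 \<le> Re z} (\<lambda>z. exp (- (z * of_real (X x))))"
    by (intro AE_I2 continuous_intros)
qed auto

text \<open>Both sides of the formula for the Laplace transform are holomorphic in the open right half-plane
  and continuous up to its boundary, so the formula carries over to the imaginary axis.\<close>

lemma char_from_Laplace_transform:
  fixes X :: "'a \<Rightarrow> real"
  assumes [measurable]: "X \<in> borel_measurable M" and X: "AE x in M. 0 \<le> X x"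
    and \<nu>: "half_line_levy_measure \<nu>"
    and lap: "\<And>u. 0 \<le> u \<Longrightarrow> (LINT x|M. exp (- (u * X x))) = exp (- (t * (b * u + (\<integral>s. 1 - exp (- (u * s)) \<partial>\<nu>))))"
  shows "char (distr M borel X) \<xi> =
    exp (- of_real t * (- \<i> * \<xi> * b + (\<integral>s. 1 - iexp (\<xi> * s) \<partial>\<nu>)))"
proof -
  interpret half_line_levy_measure \<nu> by (rule \<nu>)
  define L where "L z = (CLINT x|M. exp (- (z * of_real (X x))))" for z
  define E where "E z = exp (- of_real t * (of_real b * z + Laplace_integral z))" for z
  have pos: "L z = E z" if z: "0 < Re z" for z
  proof -
    have "(\<lambda>z. L z - E z) z = 0"
    proof (rule analytic_continuation[of "\<lambda>z. L z - E z" "{z. 0 < Re z}" "of_real ` {0<..}" 1])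
      show "(\<lambda>z. L z - E z) holomorphic_on {z. 0 < Re z}"
        unfolding L_def E_def
        by (intro holomorphic_intros holomorphic_Laplace_transform holomorphic_Laplace_integral assms)
      show "connected {z. 0 < Re z}" using convex_halfspace_Re_gt by (rule convex_connected)
      show "(1::complex) islimpt of_real ` {0<..}"
        unfolding islimpt_approachable
      proof safe
        fix e :: real assume "0 < e"
        then show "\<exists>x'\<in>complex_of_real ` {0<..}. x' \<noteq> 1 \<and> dist x' 1 < e"
          by (intro bexI[of _ "of_real (1 + e/2)"] imageI) (auto simp: dist_norm)
      qed
      fix w :: complex assume "w \<in> of_real ` {0<..}"
      then obtain u where u: "w = of_real u" "0 < u" by auto
      have "L w = (CLINT x|M. complex_of_real (exp (- (u * X x))))"
        unfolding L_def u by (simp add: exp_of_real[symmetric])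
      also have "\<dots> = of_real (exp (- (t * (b * u + (\<integral>s. 1 - exp (- (u * s)) \<partial>\<nu>)))))"
        using lap[of u] u by (simp only: integral_complex_of_real)
      also have "\<dots> = E w" unfolding E_def u Laplace_integral_of_real by (simp add: exp_of_real[symmetric])
      finally show "L w - E w = 0" by simp
    qed (use z in \<open>auto simp: open_halfspace_Re_gt\<close>)
    then show ?thesis by simp
  qed
  define Z where "Z n = of_real (1 / real (Suc n)) - \<i> * of_real \<xi>" for n
  let ?S = "{z. 0 \<le> Re z \<and> norm z \<le> 1 + \<bar>\<xi>\<bar>}"
  have Z: "Z n \<in> ?S" for n
  proof -
    have "norm (Z n) \<le> norm (complex_of_real (1 / real (Suc n))) + norm (\<i> * of_real \<xi>)"
      unfolding Z_def by (rule norm_triangle_ineq4)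
    also have "\<dots> = 1 / real (Suc n) + \<bar>\<xi>\<bar>" by (simp only: norm_of_real norm_mult) simp
    also have "\<dots> \<le> 1 + \<bar>\<xi>\<bar>" by simp
    finally show ?thesis by (simp add: Z_def)
  qed
  have Zl: "Z \<longlonglongrightarrow> of_real 0 - \<i> * of_real \<xi>"
    unfolding Z_def using LIMSEQ_Suc[OF lim_1_over_n] by (intro tendsto_intros tendsto_of_real) simp
  have c: "continuous_on ?S (\<lambda>z. L z - E z)"
    unfolding L_def E_def
    by (intro continuous_intros continuous_on_Laplace_integral continuous_on_subset[OF continuous_on_Laplace_transform] assms) auto
  have "(\<lambda>n. L (Z n) - E (Z n)) \<longlonglongrightarrow> L (of_real 0 - \<i> * of_real \<xi>) - E (of_real 0 - \<i> * of_real \<xi>)"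
    using c Zl Z unfolding continuous_on_sequentially comp_def
    by (auto simp: norm_mult)
  moreover have "(\<lambda>n. L (Z n) - E (Z n)) = (\<lambda>_. 0)"
    by (intro ext) (simp add: pos Z_def)
  ultimately have "L (- (\<i> * of_real \<xi>)) = E (- (\<i> * of_real \<xi>))"
    by (simp add: LIMSEQ_const_iff)
  moreover have "L (- (\<i> * of_real \<xi>)) = char (distr M borel X) \<xi>"
    unfolding char_def L_def by (subst integral_distr) (auto simp: mult.assoc)
  moreover have "E (- (\<i> * of_real \<xi>)) = exp (- of_real t * (- \<i> * \<xi> * b + (\<integral>s. 1 - iexp (\<xi> * s) \<partial>\<nu>)))"
    unfolding E_def Laplace_integral_def by (simp add: algebra_simps)
  ultimately show ?thesis by simp
qed

end

section \<open>Consequences of weak lower scaling\<close>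

lemma powr_power_exp_bound:
  fixes \<alpha> \<kappa> :: real
  assumes "0 < \<alpha>" "0 < \<kappa>"
  shows "\<exists>K. \<forall>v\<ge>1. v ^ 4 * exp (- (\<kappa> * v powr \<alpha>)) \<le> K"
proof -
  \<comment> \<open>With \<open>w = v powr \<alpha>\<close> one has \<open>v ^ 4 \<le> w ^ n\<close>, and \<open>w ^ n\<close> is beaten by \<open>exp (\<kappa> w)\<close>.\<close>
  define n where "n = nat \<lceil>4 / \<alpha>\<rceil> + 1"
  have n: "0 < n" "4 / \<alpha> \<le> real n"
    using real_nat_ceiling_ge[of "4 / \<alpha>"] by (auto simp: n_def)
  show ?thesis
  proof (intro exI allI impI)
    fix v :: real assume v: "1 \<le> v"
    let ?w = "v powr \<alpha>"
    have w: "1 \<le> ?w" using v assms by (simp add: ge_one_powr_ge_zero)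
    have "v ^ 4 = ?w powr (4 / \<alpha>)" using v assms by (simp add: powr_powr powr_numeral)
    also have "\<dots> \<le> ?w powr real n" using w n by (intro powr_mono) auto
    also have "\<dots> = ?w ^ n" using w by (intro powr_realpow) auto
    finally have 1: "v ^ 4 \<le> ?w ^ n" .
    have "(\<kappa> * ?w / n) ^ n \<le> (1 + \<kappa> * ?w / n) ^ n" using assms w by (intro power_mono) auto
    also have "\<dots> \<le> exp (\<kappa> * ?w)" 
      using assms w by (intro exp_ge_one_plus_x_over_n_power_n n) (auto intro: order_trans[of _ 0])
    finally have "?w ^ n * \<kappa> ^ n \<le> exp (\<kappa> * ?w) * n ^ n"
      using n by (simp add: power_divide power_mult_distrib field_simps)
    then have "?w ^ n * exp (- (\<kappa> * ?w)) \<le> n ^ n / \<kappa> ^ n"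
      using assms by (simp add: exp_minus field_simps)
    moreover have "v ^ 4 * exp (- (\<kappa> * ?w)) \<le> ?w ^ n * exp (- (\<kappa> * ?w))"
      using 1 by (intro mult_right_mono) auto
    ultimately show "v ^ 4 * exp (- (\<kappa> * ?w)) \<le> n ^ n / \<kappa> ^ n" by linarith
  qed
qed

lemma integrable_Cauchy_kernel:
  fixes \<rho> :: real
  assumes "0 < \<rho>"
  shows "integrable lborel (\<lambda>x. 1 / (1 + (x / \<rho>)\<^sup>2))"
    and "(LBINT x. 1 / (1 + (x / \<rho>)\<^sup>2)) = \<rho> * (LBINT x. 1 / (1 + x\<^sup>2))"
proof -
  have "integrable lborel (\<lambda>x::real. 1 / (1 + x\<^sup>2))"
    using integrable_inverse_1_plus_square_lborel by (simp add: inverse_eq_divide)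
  from lborel_integrable_real_affine[OF this, of "1/\<rho>" 0] assms
  show "integrable lborel (\<lambda>x. 1 / (1 + (x / \<rho>)\<^sup>2))" by simp
  show "(LBINT x. 1 / (1 + (x / \<rho>)\<^sup>2)) = \<rho> * (LBINT x. 1 / (1 + x\<^sup>2))"
    using lborel_integral_real_affine[of "1/\<rho>" "\<lambda>x. 1 / (1 + x\<^sup>2)" 0] assms by simp
qed

context half_line_levy_measure
begin

text \<open>The function \<open>\<phi>(u) - u \<phi>'(u)\<close>, which does not depend on the drift.\<close>

definition Phi :: "real \<Rightarrow> real" where "Phi u = (\<integral>s. 1 - exp (- (u * s)) - u * s * exp (- (u * s)) \<partial>\<nu>)"

lemma integrable_Phi: "0 < u \<Longrightarrow> integrable \<nu> (\<lambda>s. 1 - exp (- (u * s)) - u * s * exp (- (u * s)))"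
  using integrable_first_kernel[of u] integrable_zeroth_kernel[of u] by (simp add: mult.assoc)

lemma DERIV_Phi:
  assumes "0 < u"
  shows "(Phi has_real_derivative vphi u / u) (at u)"
proof -
  let ?A = "\<lambda>u. \<integral>s. 1 - exp (- (u * s)) \<partial>\<nu>" and ?B = "\<lambda>u. \<integral>s. s * exp (- (u * s)) \<partial>\<nu>"
  let ?D = "\<integral>s. s\<^sup>2 * exp (- (u * s)) \<partial>\<nu>"
  have "((\<lambda>u. ?A u - u * ?B u) has_real_derivative u * ?D) (at u)"
    using DERIV_Laplace_integral[OF assms] DERIV_first_kernel_integral[OF assms]
    by (auto intro!: derivative_eq_intros)
  moreover have "?A v - v * ?B v = Phi v" if "v \<in> {0<..}" for v
    using that integrable_first_kernel[of v] integrable_zeroth_kernel[of v]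
    unfolding Phi_def by (simp add: mult.assoc)
  ultimately have "(Phi has_real_derivative u * ?D) (at u)"
    using assms by (auto intro: has_field_derivative_transform_within_open[where S="{0<..}"])
  moreover have "vphi u = u\<^sup>2 * ?D" unfolding vphi_def by (simp add: power_mult_distrib mult.assoc)
  ultimately show ?thesis using assms by (simp add: power2_eq_square)
qed

lemma pruitt_le_Phi: "0 < u \<Longrightarrow> pruitt u \<le> 5 * Phi u"
proof -
  assume u: "0 < u"
  have "pruitt u \<le> (\<integral>s. 5 * (1 - exp (- (u * s)) - u * s * exp (- (u * s))) \<partial>\<nu>)"
    unfolding pruitt_def using u
    by (intro integral_levy_mono integrable_pruitt integrable_mult_right integrable_Phi min_one_square_le_Laplace_kernel) auto
  then show ?thesis by (simp only: Phi_def integral_mult_right_zero)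
qed

lemma Phi_le_pruitt: "0 < u \<Longrightarrow> Phi u \<le> pruitt u"
  unfolding pruitt_def Phi_def
proof (intro integral_levy_mono integrable_pruitt integrable_Phi)
  fix s :: real assume u: "0 < u" and s: "0 < s"
  have "(1 + u * s) * (1 - u * s) \<le> (1 + u * s) * exp (- (u * s))"
    using exp_ge_add_one_self[of "- (u * s)"] u s by (intro mult_left_mono) auto
  moreover have "0 \<le> (1 + u * s) * exp (- (u * s))" using u s by (intro mult_nonneg_nonneg) auto
  ultimately show "1 - exp (- (u * s)) - u * s * exp (- (u * s)) \<le> min 1 ((u * s)\<^sup>2)"
    by (simp add: algebra_simps power2_eq_square)
qed

end

text \<open>The scaling condition on \<open>- \<phi>''\<close> with exponent \<open>\<alpha> - 2\<close> becomes one on \<open>vphi\<close> with exponent \<open>\<alpha>\<close>;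
  positivity of \<open>vphi\<close> expresses that \<open>\<phi>''\<close> does not vanish identically.\<close>

locale scaled_levy_measure = half_line_levy_measure +
  fixes \<alpha> c x0 :: real
  assumes c: "0 < c" and x0: "0 \<le> x0" and \<alpha>: "0 < \<alpha>"
    and vphi_pos: "\<And>u. 0 < u \<Longrightarrow> 0 < vphi u"
    and vphi_scale: "\<And>k u. 1 \<le> k \<Longrightarrow> x0 < u \<Longrightarrow> c * k powr \<alpha> * vphi u \<le> vphi (k * u)"
begin

lemma pruitt_pos: "0 < u \<Longrightarrow> 0 < pruitt u"
  using vphi_pos[of u] vphi_le_pruitt[of u] by linarith

lemma vphi_upper_decay:
  assumes "x0 < x" "x \<le> u"
  shows "vphi x \<le> (x / u) powr \<alpha> * vphi u / c"
proof -
  have x: "0 < x" "0 < u" using assms x0 by auto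
  have "c * (u / x) powr \<alpha> * vphi x \<le> vphi (u / x * x)"
    using assms x by (intro vphi_scale) auto
  then show ?thesis using x c by (simp add: powr_divide field_simps)
qed

text \<open>\<open>Phi\<close> has derivative \<open>vphi x / x\<close>, which by scaling is dominated on \<open>[y, u]\<close> by the derivative
  of \<open>vphi u / (c \<alpha>) (x/u)\<^sup>\<alpha>\<close>.\<close>

lemma Phi_le_vphi:
  assumes "x0 < y" "y \<le> u"
  shows "Phi u \<le> vphi u / (c * \<alpha>) + pruitt y"
proof -
  have y: "0 < y" using assms x0 by simp
  \<comment> \<open>It suffices that \<open>D\<close> is nonincreasing on \<open>[y, u]\<close>.\<close>
  define D where "D x = Phi x - vphi u / (c * \<alpha>) * (x / u) powr \<alpha>" for x
  have "D u \<le> D y"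
  proof (rule DERIV_nonpos_imp_nonincreasing[OF assms(2)])
    fix x assume x: "y \<le> x" "x \<le> u"
    have x': "0 < x" "0 < u" "x0 < x" using x y assms by auto
    have "(D has_real_derivative vphi x / x - vphi u / (c * \<alpha>) * (\<alpha> * (x / u) powr (\<alpha> - 1) * (1 / u))) (at x)"
      unfolding D_def using x' c by (auto intro!: derivative_eq_intros DERIV_Phi simp: ac_simps)
    moreover have "vphi u / (c * \<alpha>) * (\<alpha> * (x / u) powr (\<alpha> - 1) * (1 / u)) = ((x / u) powr \<alpha> * vphi u / c) / x"
    proof -
      have "(x / u) powr \<alpha> = (x / u) powr (\<alpha> - 1) * (x / u)" using x' by (simp add: powr_diff)
      then show ?thesis using x' c \<alpha> by (simp add: ac_simps)
    qed
    moreover have "vphi x / x \<le> ((x / u) powr \<alpha> * vphi u / c) / x"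
      using vphi_upper_decay[OF x'(3) x(2)] x' by (intro divide_right_mono) auto
    ultimately show "\<exists>d. (D has_real_derivative d) (at x) \<and> d \<le> 0"
      by (intro exI[of _ "vphi x / x - vphi u / (c * \<alpha>) * (\<alpha> * (x / u) powr (\<alpha> - 1) * (1 / u))"]) auto
  qed
  then have "Phi u - vphi u / (c * \<alpha>) \<le> Phi y - vphi u / (c * \<alpha>) * (y / u) powr \<alpha>"
    using y assms by (simp add: D_def)
  moreover have "0 \<le> vphi u / (c * \<alpha>) * (y / u) powr \<alpha>"
    using vphi_nonneg c \<alpha> by (intro mult_nonneg_nonneg) auto
  ultimately show ?thesis using Phi_le_pruitt[OF y] by linarith
qed

text \<open>The additive error \<open>pruitt y\<close> of \<open>Phi_le_vphi\<close> can be made arbitrarily small if \<open>x0 = 0\<close>, and is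
  absorbed by the lower bound for \<open>vphi\<close> on \<open>[2 x0, \<infinity>)\<close> otherwise.\<close>

lemma pruitt_le_vphi_above:
  assumes "0 < x0 \<longrightarrow> 2 * x0 \<le> w" 
  obtains C where "0 < C" "\<And>u. 0 < u \<Longrightarrow> w \<le> u \<Longrightarrow> pruitt u \<le> C * vphi u"
proof (cases "x0 = 0")
  case True
  show ?thesis
  proof (rule that[of "5 / (c * \<alpha>)"])
    fix u :: real assume u: "0 < u"
    show "pruitt u \<le> 5 / (c * \<alpha>) * vphi u"
    proof (rule field_le_epsilon)
      fix e :: real assume e: "0 < e"
      obtain y where y: "0 < y" "pruitt y < e/5" using pruitt_small[of "e/5"] e by auto
      have "pruitt u \<le> 5 * (vphi u / (c * \<alpha>) + pruitt (min y u))"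
        using pruitt_le_Phi[OF u] Phi_le_vphi[of "min y u" u] u y True by simp
      moreover have "pruitt (min y u) \<le> pruitt y" using u y by (intro pruitt_mono) auto
      ultimately show "pruitt u \<le> 5 / (c * \<alpha>) * vphi u + e" using y by simp
    qed
  qed (use c \<alpha> in auto)
next
  case False
  then have p: "0 < x0" using x0 by simp
  define w0 where "w0 = 2 * x0"
  have w0: "0 < w0" "x0 < w0" "w0 \<le> w" using p assms by (auto simp: w0_def)
  show ?thesis
  proof (rule that[of "5 / (c * \<alpha>) + 5 * pruitt w0 / (c * vphi w0)"])
    show "0 < 5 / (c * \<alpha>) + 5 * pruitt w0 / (c * vphi w0)"
      using c \<alpha> pruitt_pos vphi_pos w0 by (intro add_pos_pos divide_pos_pos mult_pos_pos) auto
    fix u :: real assume u: "0 < u" "w \<le> u"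
    have "c * 1 * vphi w0 \<le> c * (u / w0) powr \<alpha> * vphi w0"
      using c \<alpha> u w0 vphi_nonneg by (intro mult_right_mono mult_left_mono ge_one_powr_ge_zero) auto
    also have "\<dots> \<le> vphi (u / w0 * w0)" using u w0 by (intro vphi_scale) auto
    finally have 1: "c * vphi w0 \<le> vphi u" using w0 by simp
    have "pruitt w0 * (c * vphi w0) \<le> pruitt w0 * vphi u"
      using 1 by (intro mult_left_mono pruitt_nonneg)
    then have 2: "pruitt w0 \<le> pruitt w0 / (c * vphi w0) * vphi u"
      using c vphi_pos[of w0] w0 by (simp add: field_simps)
    have "pruitt u \<le> 5 * (vphi u / (c * \<alpha>) + pruitt w0)"
      using pruitt_le_Phi[OF u(1)] Phi_le_vphi[of w0 u] u w0 by simp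
    also have "\<dots> \<le> 5 * (vphi u / (c * \<alpha>) + pruitt w0 / (c * vphi w0) * vphi u)"
      using 2 by simp
    also have "\<dots> = (5 / (c * \<alpha>) + 5 * pruitt w0 / (c * vphi w0)) * vphi u"
      by (simp add: distrib_right)
    finally show "pruitt u \<le> (5 / (c * \<alpha>) + 5 * pruitt w0 / (c * vphi w0)) * vphi u" .
  qed
qed

text \<open>For \<open>x0 > 0\<close> the lower end \<open>x1\<close> of the range may be any positive number, also one below \<open>x0\<close>. This
  extension is needed because the frequencies belonging to a time \<open>t < 1 / varphi(x0)\<close>
  may be smaller than \<open>x0\<close>.\<close>

lemma pruitt_le_vphi:
  assumes x1: "0 < x1 \<or> x0 = 0"
  obtains C where "0 < C" "\<And>u. 0 < u \<Longrightarrow> x1 \<le> u \<Longrightarrow> pruitt u \<le> C * vphi u"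
proof (cases "x0 = 0")
  case True
  obtain C where "0 < C" "\<And>u. 0 < u \<Longrightarrow> x1 \<le> u \<Longrightarrow> pruitt u \<le> C * vphi u"
    using pruitt_le_vphi_above[of x1] True by blast
  then show ?thesis by (rule that)
next
  case False
  then have p: "0 < x0" "0 < x1" using x0 x1 by auto
  define w0 where "w0 = 2 * x0"
  have w0: "0 < w0" using p by (simp add: w0_def)
  obtain C where C: "0 < C" "\<And>u. 0 < u \<Longrightarrow> w0 \<le> u \<Longrightarrow> pruitt u \<le> C * vphi u"
    using pruitt_le_vphi_above[of w0] unfolding w0_def by blast
  define C' where "C' = pruitt w0 / ((x1 / w0)\<^sup>2 * vphi w0)"
  have C': "0 < C'" unfolding C'_def using p w0 vphi_pos pruitt_pos by (auto intro!: divide_pos_pos mult_pos_pos)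
  show ?thesis
  proof (rule that[of "C + C'"])
    fix u :: real assume u: "0 < u" "x1 \<le> u"
    show "pruitt u \<le> (C + C') * vphi u"
    proof (cases "w0 \<le> u")
      case True
      have "pruitt u \<le> C * vphi u" using C u True by auto
      moreover have "0 \<le> C' * vphi u" using C' vphi_nonneg by auto
      ultimately show ?thesis by (simp add: algebra_simps)
    next
      case False
      have "pruitt u \<le> pruitt w0" using u False by (intro pruitt_mono) auto
      also have "\<dots> = C' * ((x1 / w0)\<^sup>2 * vphi w0)" using p w0 vphi_pos[of w0] by (simp add: C'_def)
      also have "(x1 / w0)\<^sup>2 * vphi w0 \<le> (u / w0)\<^sup>2 * vphi w0"
        using p u w0 vphi_nonneg by (intro mult_right_mono power_mono divide_right_mono) auto
      also have "\<dots> \<le> vphi u" using u False by (intro vphi_lower_scale) auto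
      finally have "pruitt u \<le> C' * vphi u" using C' by simp
      moreover have "0 \<le> C * vphi u" using C vphi_nonneg by auto
      ultimately show ?thesis by (simp add: algebra_simps)
    qed
  qed (use C C' in auto)
qed

lemma pruitt_lower_scaling:
  assumes x1: "0 < x1 \<or> x0 = 0"
  obtains d where "0 < d" "\<And>u k. 0 < u \<Longrightarrow> x1 \<le> u \<Longrightarrow> 1 \<le> k \<Longrightarrow> d * k powr \<alpha> * pruitt u \<le> pruitt (k * u)"
proof -
  define w where "w = max x1 (2 * x0)"
  have "0 < w \<or> x0 = 0" using x1 by (auto simp: w_def)
  then obtain C where C: "0 < C" "\<And>u. 0 < u \<Longrightarrow> w \<le> u \<Longrightarrow> pruitt u \<le> C * vphi u"
    using pruitt_le_vphi by blast
  define e where "e = c / C"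
  have e: "0 < e" using c C by (simp add: e_def)
  have above: "e * k powr \<alpha> * pruitt u \<le> pruitt (k * u)" if u: "0 < u" "w \<le> u" and k: "1 \<le> k" for u k
  proof -
    have xu: "x0 < u" using u x0 by (cases "x0 = 0") (auto simp: w_def)
    have "e * k powr \<alpha> * pruitt u \<le> e * k powr \<alpha> * (C * vphi u)"
      using e C(2)[OF u] by (intro mult_left_mono) auto
    also have "\<dots> = c * k powr \<alpha> * vphi u" using C by (simp add: e_def)
    also have "\<dots> \<le> vphi (k * u)" using k xu by (rule vphi_scale)
    also have "\<dots> \<le> pruitt (k * u)" using u k by (intro vphi_le_pruitt) auto
    finally show ?thesis .
  qed
  show ?thesis
  proof (cases "x1 = w \<or> x1 \<le> 0")
    case True
    show ?thesis
    proof (rule that[OF e])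
      fix u k :: real assume u: "0 < u" "x1 \<le> u" "1 \<le> k"
      have "w \<le> u" using True u x1 by (auto simp: w_def)
      then show "e * k powr \<alpha> * pruitt u \<le> pruitt (k * u)" using u by (intro above)
    qed
  next
    case False
    then have w: "0 < x1" "x1 < w" by (auto simp: w_def)
    define d where "d = min 1 e * (x1 / w) powr \<alpha>"
    have d: "0 < d" using e w by (simp add: d_def)
    show ?thesis
    proof (rule that[OF d])
      fix u k :: real assume u: "0 < u" "x1 \<le> u" and k: "1 \<le> k"
      have pn: "0 \<le> pruitt u" by (rule pruitt_nonneg)
      show "d * k powr \<alpha> * pruitt u \<le> pruitt (k * u)"
      proof (cases "w \<le> u")
        case True
        have "(x1 / w) powr \<alpha> \<le> 1" using w \<alpha> by (intro powr_le1) auto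
        then have "d \<le> e * 1" unfolding d_def using e by (intro mult_mono) auto
        then have "d * k powr \<alpha> * pruitt u \<le> e * k powr \<alpha> * pruitt u"
          using pn by (intro mult_right_mono) auto
        also have "\<dots> \<le> pruitt (k * u)" using u k True by (intro above)
        finally show ?thesis .
      next
        case uw: False
        have kx: "k * x1 \<le> k * u" using u k by (intro mult_left_mono) auto
        show ?thesis
        proof (cases "w \<le> k * u")
          case True
          have "d * k powr \<alpha> \<le> e * (k * u / w) powr \<alpha>"
          proof -
            have "d * k powr \<alpha> \<le> e * (x1 / w) powr \<alpha> * k powr \<alpha>"
              unfolding d_def by (intro mult_right_mono) auto
            also have "\<dots> = e * (k * x1 / w) powr \<alpha>"
              using w k by (simp add: powr_mult powr_divide)
            also have "\<dots> \<le> e * (k * u / w) powr \<alpha>"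
              using kx w k e \<alpha> by (intro mult_left_mono powr_mono2 divide_right_mono) auto
            finally show ?thesis .
          qed
          moreover have "pruitt u \<le> pruitt w" using u uw by (intro pruitt_mono) auto
          ultimately have "d * k powr \<alpha> * pruitt u \<le> e * (k * u / w) powr \<alpha> * pruitt w"
            using e pn mult_mono[of "d * k powr \<alpha>" "e * (k * u / w) powr \<alpha>" "pruitt u" "pruitt w"] by simp
          also have "\<dots> \<le> pruitt (k * u / w * w)" using w True by (intro above) auto
          finally show ?thesis using w by simp
        next
          case False
          have "d * k powr \<alpha> \<le> 1 * (x1 / w) powr \<alpha> * k powr \<alpha>"
            unfolding d_def by (intro mult_right_mono) auto
          also have "\<dots> = (k * x1 / w) powr \<alpha>" using w k by (simp add: powr_mult powr_divide)
          also have "\<dots> \<le> 1"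
          proof (rule powr_le1)
            have "k * x1 \<le> w" using kx False by linarith
            then show "\<bar>k * x1 / w\<bar> \<le> 1" using w k by simp
          qed (use \<alpha> k w in auto)
          finally have "d * k powr \<alpha> * pruitt u \<le> 1 * pruitt u" using pn by (intro mult_right_mono) auto
          also have "\<dots> \<le> pruitt (k * u)"
            using k u by (simp, intro pruitt_mono) (auto simp: abs_mult mult_le_cancel_right1)
          finally show ?thesis .
        qed
      qed
    qed
  qed
qed

lemma pruitt_le_re_psi:
  assumes x1: "0 < x1 \<or> x0 = 0"
  obtains d where "0 < d" "\<And>u. 0 < u \<Longrightarrow> x1 \<le> u \<Longrightarrow> d * pruitt u \<le> re_psi u"
proof -
  obtain d where d: "0 < d" "\<And>u k. 0 < u \<Longrightarrow> x1 \<le> u \<Longrightarrow> 1 \<le> k \<Longrightarrow> d * k powr \<alpha> * pruitt u \<le> pruitt (k * u)"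
    using pruitt_lower_scaling[OF x1] by blast
  \<comment> \<open>The factor \<open>k\<close> is chosen such that scaling by \<open>k\<close> at least doubles \<open>pruitt\<close>.\<close>
  define k where "k = max 1 ((2 / d) powr (1 / \<alpha>))"
  have k: "1 \<le> k" by (simp add: k_def)
  have "2 = d * ((2 / d) powr (1 / \<alpha>)) powr \<alpha>" using d \<alpha> by (simp add: powr_powr)
  also have "\<dots> \<le> d * k powr \<alpha>" using d \<alpha> by (intro mult_left_mono powr_mono2) (auto simp: k_def)
  finally have dk: "2 \<le> d * k powr \<alpha>" .
  show ?thesis
  proof (rule that[of "1 / (3 * k\<^sup>2)"])
    fix u :: real assume u: "0 < u" "x1 \<le> u"
    have "2 * pruitt u \<le> d * k powr \<alpha> * pruitt u" using dk pruitt_nonneg by (intro mult_right_mono)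
    also have "\<dots> \<le> pruitt (k * u)" using u k by (intro d)
    also have "\<dots> \<le> 3 * k\<^sup>2 * re_psi u + pruitt u" using u k by (intro pruitt_scale_le_re_psi)
    finally have "pruitt u \<le> 3 * k\<^sup>2 * re_psi u" by simp
    then show "1 / (3 * k\<^sup>2) * pruitt u \<le> re_psi u" using k by (simp add: field_simps)
  qed (use k in auto)
qed

text \<open>The constant \<open>K\<close> is uniform in \<open>t\<close> and \<open>\<rho>\<close> as long as \<open>t * pruitt \<rho>\<close> stays away from zero. The decay of fourth order
  in \<open>\<xi>\<close> leaves an integrable bound after a multiplication by \<open>1 + (\<xi> / \<rho>)\<^sup>2\<close>.\<close>

lemma exp_re_psi_decay:
  assumes x1: "0 < x1 \<or> x0 = 0" and m: "0 < m"
  obtains K where "0 < K"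
    "\<And>t \<rho> \<xi>. 0 < \<rho> \<Longrightarrow> x1 \<le> \<rho> \<Longrightarrow> 0 < t \<Longrightarrow> m \<le> t * pruitt \<rho> \<Longrightarrow> exp (- (t * re_psi \<xi>)) \<le> K / (1 + (\<xi> / \<rho>)\<^sup>2)\<^sup>2"
proof -
  obtain d where d: "0 < d" "\<And>u k. 0 < u \<Longrightarrow> x1 \<le> u \<Longrightarrow> 1 \<le> k \<Longrightarrow> d * k powr \<alpha> * pruitt u \<le> pruitt (k * u)"
    using pruitt_lower_scaling[OF x1] by blast
  obtain d' where d': "0 < d'" "\<And>u. 0 < u \<Longrightarrow> x1 \<le> u \<Longrightarrow> d' * pruitt u \<le> re_psi u"
    using pruitt_le_re_psi[OF x1] by blast
  define \<kappa> where "\<kappa> = d' * d * m"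
  have \<kappa>: "0 < \<kappa>" using d d' m by (simp add: \<kappa>_def)
  obtain K where K: "\<And>v. 1 \<le> v \<Longrightarrow> v ^ 4 * exp (- (\<kappa> * v powr \<alpha>)) \<le> K"
    using powr_power_exp_bound[OF \<alpha> \<kappa>] by blast
  have Kp: "0 < K" using K[of 1] by (rule less_le_trans[rotated]) auto
  show ?thesis
  proof (rule that[of "4 * K + 4"])
    fix t \<rho> \<xi> :: real assume \<rho>: "0 < \<rho>" "x1 \<le> \<rho>" and t: "0 < t" and mt: "m \<le> t * pruitt \<rho>"
    let ?v = "\<bar>\<xi>\<bar> / \<rho>"
    have v2: "(\<xi> / \<rho>)\<^sup>2 = ?v\<^sup>2" by (simp add: power_divide)
    have pos: "0 < (1 + ?v\<^sup>2)\<^sup>2" by (intro zero_less_power add_pos_nonneg) auto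
    have "exp (- (t * re_psi \<xi>)) * (1 + ?v\<^sup>2)\<^sup>2 \<le> 4 * K + 4"
    proof (cases "?v \<le> 1")
      case True
      have "?v\<^sup>2 \<le> 1" using True \<rho> by (intro power_le_one) auto
      then have "(1 + ?v\<^sup>2)\<^sup>2 \<le> 2\<^sup>2" by (intro power_mono) auto
      moreover have "exp (- (t * re_psi \<xi>)) \<le> 1" using t re_psi_nonneg[of \<xi>] by simp
      ultimately have "exp (- (t * re_psi \<xi>)) * (1 + ?v\<^sup>2)\<^sup>2 \<le> 1 * 2\<^sup>2" by (intro mult_mono) auto
      then show ?thesis using Kp by simp
    next
      case False
      then have v: "1 \<le> ?v" by simp
      have xi: "?v * \<rho> = \<bar>\<xi>\<bar>" "\<rho> \<le> \<bar>\<xi>\<bar>" using \<rho> v by (auto simp: field_simps)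
      have "\<kappa> * ?v powr \<alpha> \<le> d' * d * (t * pruitt \<rho>) * ?v powr \<alpha>"
        unfolding \<kappa>_def using mt d d' by (intro mult_right_mono mult_left_mono) auto
      also have "\<dots> = t * (d' * (d * ?v powr \<alpha> * pruitt \<rho>))" by simp
      also have "\<dots> \<le> t * (d' * pruitt (?v * \<rho>))"
        using t d' \<rho> v by (intro mult_left_mono d) auto
      also have "\<dots> \<le> t * re_psi \<bar>\<xi>\<bar>" unfolding xi(1) using t \<rho> xi by (intro mult_left_mono d') auto
      also have "re_psi \<bar>\<xi>\<bar> = re_psi \<xi>" using re_psi_uminus[of \<xi>] by (simp add: abs_if)
      finally have 1: "exp (- (t * re_psi \<xi>)) \<le> exp (- (\<kappa> * ?v powr \<alpha>))" by simp
      have "1 \<le> ?v\<^sup>2" using v by (simp add: one_le_power)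
      then have "(1 + ?v\<^sup>2)\<^sup>2 \<le> (2 * ?v\<^sup>2)\<^sup>2" by (intro power_mono) auto
      also have "\<dots> = 4 * ?v ^ 4" by (simp add: power_mult_distrib flip: power_mult)
      finally have "exp (- (t * re_psi \<xi>)) * (1 + ?v\<^sup>2)\<^sup>2 \<le> exp (- (\<kappa> * ?v powr \<alpha>)) * (4 * ?v ^ 4)"
        using 1 by (intro mult_mono) auto
      also have "\<dots> \<le> 4 * K" using K[OF v] by (simp add: mult.commute)
      finally show ?thesis by simp
    qed
    then show "exp (- (t * re_psi \<xi>)) \<le> (4 * K + 4) / (1 + (\<xi> / \<rho>)\<^sup>2)\<^sup>2"
      unfolding v2 using pos by (simp only: pos_le_divide_eq)
  qed (use Kp in auto)
qed

end

section \<open>Increments of the centred exponent\<close>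

lemma square_add_le: "(a + b)\<^sup>2 \<le> 2 * (a\<^sup>2 + b\<^sup>2)" for a b :: real
  using sum_squares_bound[of a b] by (simp add: power2_sum)

context half_line_levy_measure
begin

text \<open>The Levy--Khintchine exponent with drift \<open>b\<close>.\<close>

definition levy_exponent :: "real \<Rightarrow> real \<Rightarrow> complex" where
  "levy_exponent b \<xi> = - \<i> * \<xi> * b + (\<integral>s. 1 - iexp (\<xi> * s) \<partial>\<nu>)"

lemma integrable_levy_exponent: "integrable \<nu> (\<lambda>s. 1 - iexp (\<xi> * s))"
  using integrable_complex_kernel[of "- (\<i> * \<xi>)"] by (simp add: mult.assoc)

lemma Re_levy_exponent: "Re (levy_exponent b \<xi>) = re_psi \<xi>"
proof -
  have "Re (\<integral>s. 1 - iexp (\<xi> * s) \<partial>\<nu>) = (\<integral>s. Re (1 - iexp (\<xi> * s)) \<partial>\<nu>)"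
    using integrable_levy_exponent by (rule integral_Re[symmetric])
  then show ?thesis by (simp add: levy_exponent_def re_psi_def Re_exp)
qed

lemma integrable_truncated_identity: "integrable \<nu> (\<lambda>s. indicator {0<..<r} s * s)"
proof (rule integrable_levyI[where C="max 1 r"])
  fix s :: real assume s: "0 < s"
  have "1 * s \<le> max 1 r * s" using s by (intro mult_right_mono) auto
  then show "norm (indicator {0<..<r} s * s) \<le> max 1 r * min 1 s"
    using s by (cases "s \<le> 1") (auto simp: indicator_def)
qed auto

lemma truncated_drift_eq: "truncated_drift b \<nu> r = b + (\<integral>s. indicator {0<..<r} s * s \<partial>\<nu>)"
  by (simp add: truncated_drift_def set_lebesgue_integral_def)

text \<open>The increment from \<open>\<xi>\<close> to \<open>\<xi> + \<eta>\<close> of the exponent of the process centred at the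
  truncated drift, that is, of \<open>levy_exponent b \<xi> + i \<xi> truncated_drift b \<nu> r\<close>. It does not depend on \<open>b\<close>.\<close>

definition centred_increment :: "real \<Rightarrow> real \<Rightarrow> real \<Rightarrow> complex" where
  "centred_increment r \<xi> \<eta> =
     (\<integral>s. iexp (\<xi> * s) - iexp ((\<xi> + \<eta>) * s) + \<i> * \<eta> * of_real (indicator {0<..<r} s * s) \<partial>\<nu>)"

lemma integrable_centred_increment:
  "integrable \<nu> (\<lambda>s. iexp (\<xi> * s) - iexp ((\<xi> + \<eta>) * s) + \<i> * \<eta> * of_real (indicator {0<..<r} s * s))"
proof -
  have "integrable \<nu> (\<lambda>s. ((1 - iexp ((\<xi> + \<eta>) * s)) - (1 - iexp (\<xi> * s))) + \<i> * \<eta> * of_real (indicator {0<..<r} s * s))"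
    using integrable_truncated_identity[of r]
    by (intro Bochner_Integration.integrable_add Bochner_Integration.integrable_diff integrable_levy_exponent
        integrable_mult_right integrable_of_real)
  then show ?thesis by simp
qed

lemma centred_increment_eq:
  "centred_increment r \<xi> \<eta> =
     levy_exponent b (\<xi> + \<eta>) - levy_exponent b \<xi> + \<i> * \<eta> * truncated_drift b \<nu> r"
proof -
  have "centred_increment r \<xi> \<eta> = (\<integral>s. ((1 - iexp ((\<xi> + \<eta>) * s)) - (1 - iexp (\<xi> * s))) +
      \<i> * \<eta> * of_real (indicator {0<..<r} s * s) \<partial>\<nu>)"
    unfolding centred_increment_def by (intro Bochner_Integration.integral_cong) auto
  also have "\<dots> = (\<integral>s. (1 - iexp ((\<xi> + \<eta>) * s)) - (1 - iexp (\<xi> * s)) \<partial>\<nu>) +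
      (\<integral>s. \<i> * \<eta> * of_real (indicator {0<..<r} s * s) \<partial>\<nu>)"
    by (intro Bochner_Integration.integral_add Bochner_Integration.integrable_diff integrable_levy_exponent
        integrable_mult_right integrable_of_real integrable_truncated_identity)
  also have "(\<integral>s. (1 - iexp ((\<xi> + \<eta>) * s)) - (1 - iexp (\<xi> * s)) \<partial>\<nu>) =
      (\<integral>s. 1 - iexp ((\<xi> + \<eta>) * s) \<partial>\<nu>) - (\<integral>s. 1 - iexp (\<xi> * s) \<partial>\<nu>)"
    by (intro Bochner_Integration.integral_diff integrable_levy_exponent)
  also have "(\<integral>s. \<i> * \<eta> * of_real (indicator {0<..<r} s * s) \<partial>\<nu>) =
      \<i> * \<eta> * of_real (\<integral>s. indicator {0<..<r} s * s \<partial>\<nu>)"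
    by (simp only: integral_mult_right_zero integral_complex_of_real)
  finally show ?thesis by (simp add: levy_exponent_def truncated_drift_eq algebra_simps)
qed

lemma norm_second_difference_le:
  "norm (centred_increment r \<xi> \<eta> + centred_increment r \<xi> (- \<eta>)) \<le> 4 * pruitt \<eta>"
proof -
  have "centred_increment r \<xi> \<eta> + centred_increment r \<xi> (- \<eta>) =
      (\<integral>s. iexp (\<xi> * s) * of_real (2 * (1 - cos (\<eta> * s))) \<partial>\<nu>)"
    unfolding centred_increment_def
  proof (subst Bochner_Integration.integral_add[symmetric, OF integrable_centred_increment integrable_centred_increment],
      intro Bochner_Integration.integral_cong refl)
    fix s
    have "iexp ((\<xi> + \<eta>) * s) = iexp (\<xi> * s) * iexp (\<eta> * s)"
      "iexp ((\<xi> + - \<eta>) * s) = iexp (\<xi> * s) * iexp (- (\<eta> * s))"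
      by (simp_all add: exp_add[symmetric] algebra_simps)
    moreover have "iexp (\<eta> * s) + iexp (- (\<eta> * s)) = of_real (2 * cos (\<eta> * s))"
      by (simp add: complex_eq_iff Re_exp Im_exp)
    moreover have "a - X + \<i> * \<eta> * of_real d + (a - Y + \<i> * of_real (- \<eta>) * of_real d) = a * of_real (2 * (1 - c))"
      if "X = a * p" "Y = a * q" "p + q = of_real (2 * c)" for a X Y p q :: complex and c d :: real
    proof -
      have "X + Y = a * of_real (2 * c)" using that by (metis distrib_left)
      moreover have "a - X + \<i> * \<eta> * of_real d + (a - Y + \<i> * of_real (- \<eta>) * of_real d) = 2 * a - (X + Y)"
        by simp
      ultimately show ?thesis by (simp add: algebra_simps)
    qed
    ultimately show "iexp (\<xi> * s) - iexp ((\<xi> + \<eta>) * s) + \<i> * \<eta> * of_real (indicator {0<..<r} s * s) +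
        (iexp (\<xi> * s) - iexp ((\<xi> + - \<eta>) * s) + \<i> * of_real (- \<eta>) * of_real (indicator {0<..<r} s * s)) =
        iexp (\<xi> * s) * of_real (2 * (1 - cos (\<eta> * s)))"
      by blast
  qed
  also have "norm \<dots> \<le> (\<integral>s. norm (iexp (\<xi> * s) * of_real (2 * (1 - cos (\<eta> * s)))) \<partial>\<nu>)"
    by (rule integral_norm_bound)
  also have "\<dots> = (\<integral>s. 2 * (1 - cos (\<eta> * s)) \<partial>\<nu>)"
    by (intro Bochner_Integration.integral_cong) (simp_all only: norm_mult norm_of_real norm_iexp_of_real, simp)
  also have "\<dots> = 2 * re_psi \<eta>" unfolding re_psi_def by (rule integral_mult_right_zero)
  also have "\<dots> \<le> 4 * pruitt \<eta>" using re_psi_le_pruitt[of \<eta>] by simp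
  finally show ?thesis .
qed

lemma norm_one_minus_iexp: "(norm (1 - iexp x))\<^sup>2 = 2 * (1 - cos x)"
  by (simp add: cmod_power2 Re_exp Im_exp power2_diff algebra_simps)

text \<open>For jumps below \<open>1/\<rho>\<close> the centring leaves a quadratic term. For the others the kernel is
  bounded by Young's inequality with a weight \<open>\<theta>\<close> that is chosen after integration.\<close>

lemma norm_increment_kernel_le:
  assumes \<rho>: "0 < \<rho>" and \<theta>: "0 < \<theta>" and s: "0 < s"
  shows "norm (iexp (\<xi> * s) - iexp ((\<xi> + \<eta>) * s) + \<i> * \<eta> * of_real (indicator {0<..<1/\<rho>} s * s))
    \<le> ((\<eta>\<^sup>2 + \<bar>\<eta>\<bar> * \<bar>\<xi>\<bar>) / \<rho>\<^sup>2 + 1 / (2 * \<theta>)) * min 1 ((\<rho> * s)\<^sup>2) + \<theta> * (1 - cos (\<eta> * s))"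
proof -
  have e: "iexp ((\<xi> + \<eta>) * s) = iexp (\<xi> * s) * iexp (\<eta> * s)"
    by (simp add: exp_add[symmetric] algebra_simps)
  show ?thesis
  proof (cases "s < 1 / \<rho>")
    case True
    have "\<rho> * s < 1" using True \<rho> by (simp add: field_simps)
    then have m: "min 1 ((\<rho> * s)\<^sup>2) = (\<rho> * s)\<^sup>2"
      using \<rho> s by (simp add: power_le_one)
    have 1: "norm (1 + \<i> * (\<eta> * s) - iexp (\<eta> * s)) \<le> (\<eta> * s)\<^sup>2"
    proof -
      let ?n = "norm (1 + \<i> * (\<eta> * s) - iexp (\<eta> * s))"
      have "?n \<le> ?n * 2" by simp
      also have "\<dots> \<le> (\<eta> * s)\<^sup>2"
        using iexp_approx1[of "\<eta> * s" 1] by (simp add: norm_minus_commute power2_eq_square)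
      finally show ?thesis .
    qed
    have 2: "norm (iexp (\<xi> * s) - 1) \<le> \<bar>\<xi> * s\<bar>"
      using iexp_approx1[of "\<xi> * s" 0] by simp
    have "iexp (\<xi> * s) - iexp ((\<xi> + \<eta>) * s) + \<i> * \<eta> * of_real (indicator {0<..<1/\<rho>} s * s) =
       iexp (\<xi> * s) * (1 + \<i> * (\<eta> * s) - iexp (\<eta> * s)) - \<i> * (\<eta> * s) * (iexp (\<xi> * s) - 1)"
      using True s unfolding e by (simp add: algebra_simps)
    also have "norm \<dots> \<le> norm (iexp (\<xi> * s) * (1 + \<i> * (\<eta> * s) - iexp (\<eta> * s))) + norm (\<i> * (\<eta> * s) * (iexp (\<xi> * s) - 1))"
      by (rule norm_triangle_ineq4)
    also have "\<dots> = norm (1 + \<i> * (\<eta> * s) - iexp (\<eta> * s)) + \<bar>\<eta> * s\<bar> * norm (iexp (\<xi> * s) - 1)"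
      unfolding norm_mult norm_iexp_of_real norm_of_real by (simp add: abs_mult)
    also have "\<dots> \<le> (\<eta> * s)\<^sup>2 + \<bar>\<eta> * s\<bar> * \<bar>\<xi> * s\<bar>"
      by (intro add_mono 1 mult_left_mono 2) auto
    also have "\<dots> = (\<eta>\<^sup>2 + \<bar>\<eta>\<bar> * \<bar>\<xi>\<bar>) / \<rho>\<^sup>2 * (\<rho> * s)\<^sup>2"
      using \<rho> s by (simp add: power_mult_distrib abs_mult field_simps power2_eq_square)
    also have "\<dots> \<le> ((\<eta>\<^sup>2 + \<bar>\<eta>\<bar> * \<bar>\<xi>\<bar>) / \<rho>\<^sup>2 + 1 / (2 * \<theta>)) * (\<rho> * s)\<^sup>2"
      using \<theta> by (intro mult_right_mono) auto
    also have "\<dots> \<le> ((\<eta>\<^sup>2 + \<bar>\<eta>\<bar> * \<bar>\<xi>\<bar>) / \<rho>\<^sup>2 + 1 / (2 * \<theta>)) * (\<rho> * s)\<^sup>2 + \<theta> * (1 - cos (\<eta> * s))"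
      using \<theta> by simp
    finally show ?thesis unfolding m .
  next
    case False
    have "1 \<le> \<rho> * s" using False \<rho> by (simp add: field_simps)
    then have m: "min 1 ((\<rho> * s)\<^sup>2) = 1" by (simp add: one_le_power)
    define N where "N = norm (1 - iexp (\<eta> * s))"
    have "iexp (\<xi> * s) - iexp ((\<xi> + \<eta>) * s) + \<i> * \<eta> * of_real (indicator {0<..<1/\<rho>} s * s) =
       iexp (\<xi> * s) * (1 - iexp (\<eta> * s))"
      using False unfolding e by (simp add: algebra_simps)
    also have "norm \<dots> = N" unfolding norm_mult norm_iexp_of_real N_def by simp
    also have "N \<le> \<theta> * N\<^sup>2 / 2 + 1 / (2 * \<theta>)"
    proof -
      have "0 \<le> (\<theta> * N - 1)\<^sup>2" by simp
      then have "2 * \<theta> * N \<le> \<theta>\<^sup>2 * N\<^sup>2 + 1" by (simp add: power2_diff power_mult_distrib)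
      then show ?thesis using \<theta> by (simp add: field_simps power2_eq_square)
    qed
    also have "\<theta> * N\<^sup>2 / 2 = \<theta> * (1 - cos (\<eta> * s))" unfolding N_def norm_one_minus_iexp by simp
    also have "\<theta> * (1 - cos (\<eta> * s)) + 1 / (2 * \<theta>) \<le>
       ((\<eta>\<^sup>2 + \<bar>\<eta>\<bar> * \<bar>\<xi>\<bar>) / \<rho>\<^sup>2 + 1 / (2 * \<theta>)) * 1 + \<theta> * (1 - cos (\<eta> * s))"
      by simp
    finally show ?thesis unfolding m .
  qed
qed

text \<open>The condition \<open>\<bar>\<eta>\<bar> \<le> 4 \<rho>\<close> covers \<open>\<eta> = \<pi>/x\<close> with \<open>1/\<bar>x\<bar> \<le> \<rho>\<close>, since \<open>\<pi> < 4\<close>.\<close>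

lemma norm_centred_increment_le:
  assumes \<rho>: "0 < \<rho>" and \<eta>: "\<eta> \<noteq> 0" "\<bar>\<eta>\<bar> \<le> 4 * \<rho>" and pos: "0 < pruitt \<rho>" "0 < pruitt \<eta>"
  shows "(norm (centred_increment (1/\<rho>) \<xi> \<eta>))\<^sup>2 \<le> 1042 * pruitt \<rho> * pruitt \<eta> * (1 + (\<xi> / \<rho>)\<^sup>2)"
proof -
  define P Q where "P = pruitt \<rho>" and "Q = pruitt \<eta>"
  have PQ: "0 < P" "0 < Q" using pos by (auto simp: P_def Q_def)
  \<comment> \<open>This weight balances \<open>P / (2 \<theta>)\<close> and \<open>2 \<theta> Q\<close>.\<close>
  define \<theta> where "\<theta> = sqrt P / sqrt Q"
  have \<theta>: "0 < \<theta>" using PQ by (simp add: \<theta>_def)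
  define A where "A = (\<eta>\<^sup>2 + \<bar>\<eta>\<bar> * \<bar>\<xi>\<bar>) / \<rho>\<^sup>2"
  have "norm (centred_increment (1/\<rho>) \<xi> \<eta>) \<le>
      (\<integral>s. norm (iexp (\<xi> * s) - iexp ((\<xi> + \<eta>) * s) + \<i> * \<eta> * of_real (indicator {0<..<1/\<rho>} s * s)) \<partial>\<nu>)"
    unfolding centred_increment_def by (rule integral_norm_bound)
  also have "\<dots> \<le> (\<integral>s. (A + 1 / (2 * \<theta>)) * min 1 ((\<rho> * s)\<^sup>2) + \<theta> * (1 - cos (\<eta> * s)) \<partial>\<nu>)"
    unfolding A_def
    by (intro integral_levy_mono integrable_norm integrable_centred_increment Bochner_Integration.integrable_add
        integrable_mult_right integrable_pruitt integrable_re_psi norm_increment_kernel_le \<rho> \<theta>)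
  also have "\<dots> = (A + 1 / (2 * \<theta>)) * P + \<theta> * re_psi \<eta>"
    unfolding P_def pruitt_def re_psi_def
    by (subst Bochner_Integration.integral_add)
       (auto intro!: integrable_mult_right integrable_pruitt integrable_re_psi simp del: right_diff_distrib)
  also have "\<dots> \<le> (A + 1 / (2 * \<theta>)) * P + \<theta> * (2 * Q)"
    using re_psi_le_pruitt[of \<eta>] \<theta> by (simp add: Q_def)
  also have "\<dots> = A * P + (1 / (2 * \<theta>) * P + \<theta> * (2 * Q))" by (simp add: algebra_simps)
  also have "1 / (2 * \<theta>) * P = sqrt P * sqrt Q / 2"
    using PQ by (simp add: \<theta>_def field_simps)
  also have "\<theta> * (2 * Q) = 2 * (sqrt P * sqrt Q)"
  proof -
    have "\<theta> * Q = \<theta> * (sqrt Q * sqrt Q)" using PQ by simp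
    also have "\<dots> = sqrt P * sqrt Q"
    proof -
      have "p / q * (q * q) = p * q" if "0 < q" for p q :: real using that by simp
      then show ?thesis using PQ unfolding \<theta>_def by (metis real_sqrt_gt_zero)
    qed
    finally show ?thesis by simp
  qed
  finally have "norm (centred_increment (1/\<rho>) \<xi> \<eta>) \<le> A * P + 3 * (sqrt P * sqrt Q)"
  proof -
    have "0 \<le> sqrt P * sqrt Q" using PQ by simp
    moreover assume "norm (centred_increment (1/\<rho>) \<xi> \<eta>) \<le> A * P + (sqrt P * sqrt Q / 2 + 2 * (sqrt P * sqrt Q))"
    ultimately show ?thesis by linarith
  qed
  then have "(norm (centred_increment (1/\<rho>) \<xi> \<eta>))\<^sup>2 \<le> (A * P + 3 * (sqrt P * sqrt Q))\<^sup>2"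
    by (intro power_mono) auto
  also have "\<dots> \<le> 2 * ((A * P)\<^sup>2 + (3 * (sqrt P * sqrt Q))\<^sup>2)" by (rule square_add_le)
  also have "(3 * (sqrt P * sqrt Q))\<^sup>2 = 9 * P * Q" using PQ by (simp add: power_mult_distrib)
  also have "(A * P)\<^sup>2 \<le> 512 * P * Q * (1 + (\<xi> / \<rho>)\<^sup>2)"
  proof -
    have "P \<le> pruitt (4 * \<rho>)" unfolding P_def using \<rho> by (intro pruitt_mono) auto
    also have "\<dots> = pruitt (4 * \<rho> / \<bar>\<eta>\<bar> * \<bar>\<eta>\<bar>)" using \<eta> by simp
    also have "\<dots> \<le> (4 * \<rho> / \<bar>\<eta>\<bar>)\<^sup>2 * pruitt \<bar>\<eta>\<bar>" using \<eta> by (intro pruitt_scale) auto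
    also have "\<dots> \<le> (4 * \<rho> / \<bar>\<eta>\<bar>)\<^sup>2 * Q" unfolding Q_def by (intro mult_left_mono pruitt_mono) auto
    finally have "P * (\<bar>\<eta>\<bar> / \<rho>)\<^sup>2 \<le> (4 * \<rho> / \<bar>\<eta>\<bar>)\<^sup>2 * Q * (\<bar>\<eta>\<bar> / \<rho>)\<^sup>2"
      by (intro mult_right_mono) auto
    also have "\<dots> = 16 * Q" using \<rho> \<eta> by (simp add: power_divide power_mult_distrib)
    finally have 1: "P * (\<bar>\<eta>\<bar> / \<rho>)\<^sup>2 \<le> 16 * Q" .
    have "\<bar>\<eta>\<bar> / \<rho> \<le> 4" using \<rho> \<eta> by (simp add: field_simps)
    then have "(\<bar>\<eta>\<bar> / \<rho>)\<^sup>2 \<le> 4\<^sup>2" using \<rho> by (intro power_mono) auto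
    then have "(\<bar>\<eta>\<bar> / \<rho> + \<bar>\<xi>\<bar> / \<rho>)\<^sup>2 \<le> 2 * (4\<^sup>2 + (\<bar>\<xi>\<bar> / \<rho>)\<^sup>2)"
      by (intro order_trans[OF square_add_le] mult_left_mono add_right_mono) auto
    also have "\<dots> \<le> 32 * (1 + (\<xi> / \<rho>)\<^sup>2)"
    proof -
      have "2 * (4\<^sup>2 + y) \<le> 32 * (1 + y)" if "0 \<le> y" for y :: real using that by simp
      from this[of "(\<xi> / \<rho>)\<^sup>2"] show ?thesis by (simp only: power_divide power2_abs zero_le_power2) simp
    qed
    finally have 2: "(\<bar>\<eta>\<bar> / \<rho> + \<bar>\<xi>\<bar> / \<rho>)\<^sup>2 \<le> 32 * (1 + (\<xi> / \<rho>)\<^sup>2)" .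
    have "A = \<bar>\<eta>\<bar> / \<rho> * (\<bar>\<eta>\<bar> / \<rho> + \<bar>\<xi>\<bar> / \<rho>)"
      using \<rho> by (simp add: A_def field_simps power2_eq_square flip: abs_mult)
    then have "(A * P)\<^sup>2 = P * (P * (\<bar>\<eta>\<bar> / \<rho>)\<^sup>2) * (\<bar>\<eta>\<bar> / \<rho> + \<bar>\<xi>\<bar> / \<rho>)\<^sup>2"
      by (simp only: power_mult_distrib power2_eq_square[of P] mult_ac)
    also have "\<dots> \<le> P * (16 * Q) * (32 * (1 + (\<xi> / \<rho>)\<^sup>2))"
      using PQ by (intro mult_mono mult_left_mono 1 2) auto
    also have "\<dots> = 512 * P * Q * (1 + (\<xi> / \<rho>)\<^sup>2)" by (simp add: algebra_simps)
    finally show ?thesis .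
  qed
  finally have "(norm (centred_increment (1/\<rho>) \<xi> \<eta>))\<^sup>2 \<le> 1024 * P * Q * (1 + (\<xi> / \<rho>)\<^sup>2) + 18 * P * Q * 1"
    by simp
  also have "18 * P * Q * 1 \<le> 18 * P * Q * (1 + (\<xi> / \<rho>)\<^sup>2)" using PQ by (intro mult_left_mono) auto
  finally show ?thesis unfolding P_def Q_def by (simp add: algebra_simps)
qed

end

section \<open>Second differences and the decay of the density\<close>

lemma shifted_kernel_le:
  fixes v h :: real
  assumes "\<bar>h\<bar> \<le> 4"
  shows "1 / (1 + (v + h)\<^sup>2)\<^sup>2 \<le> 1089 / (1 + v\<^sup>2)\<^sup>2"
proof -
  have "v\<^sup>2 \<le> 2 * ((v + h)\<^sup>2 + (- h)\<^sup>2)" using square_add_le[of "v + h" "- h"] by simp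
  moreover have "h\<^sup>2 \<le> 16" using assms abs_le_square_iff[of h 4] by simp
  moreover have "1 + p \<le> 33 * (1 + q)" if "p \<le> 2 * (q + r)" "r \<le> 16" "0 \<le> q" for p q r :: real
    using that by simp
  ultimately have "1 + v\<^sup>2 \<le> 33 * (1 + (v + h)\<^sup>2)"
    by (metis power2_minus zero_le_power2)
  then have "(1 + v\<^sup>2)\<^sup>2 \<le> (33 * (1 + (v + h)\<^sup>2))\<^sup>2" by (intro power_mono) auto
  also have "\<dots> = 1089 * (1 + (v + h)\<^sup>2)\<^sup>2" by (simp only: power_mult_distrib) simp
  finally have "(1 + v\<^sup>2)\<^sup>2 \<le> 1089 * (1 + (v + h)\<^sup>2)\<^sup>2" .
  moreover have "0 < 1 + v\<^sup>2" "0 < 1 + (v + h)\<^sup>2"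
    by (auto intro!: add_pos_nonneg)
  ultimately show ?thesis by (simp add: divide_simps)
qed

context half_line_levy_measure
begin

text \<open>Expanding \<open>f(\<xi> \<plusminus> \<eta>) = f(\<xi>) exp (- t A)\<close> to first order in \<open>t A\<close>, where \<open>A\<close> is the centred increment
  over \<open>\<plusminus> \<eta>\<close>, the
  linear terms add up to \<open>- t\<close> times the second difference of the exponent, and the remainders are
  quadratic in \<open>t A\<close>.\<close>

lemma second_difference_pointwise:
  fixes t \<rho> \<eta> K N b :: real
  assumes t: "0 < t" and \<rho>: "0 < \<rho>" and \<eta>: "\<eta> \<noteq> 0" "\<bar>\<eta>\<bar> \<le> 4 * \<rho>"
    and pos: "0 < pruitt \<rho>" "0 < pruitt \<eta>"
    and K: "0 \<le> K" and decay: "\<And>\<xi>. exp (- (t * re_psi \<xi>)) \<le> K / (1 + (\<xi> / \<rho>)\<^sup>2)\<^sup>2"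
    and N: "t * pruitt \<rho> \<le> N"
  defines "f \<equiv> (\<lambda>\<xi>. exp (- (of_real t * levy_exponent b \<xi>) - \<i> * of_real (\<xi> * (t * truncated_drift b \<nu> (1 / \<rho>)))))"
  shows "norm (2 * f \<xi> - f (\<xi> + \<eta>) - f (\<xi> - \<eta>)) \<le>
    (4 + 2271560 * N) * K * (t * pruitt \<eta>) * (1 / (1 + (\<xi> / \<rho>)\<^sup>2))"
proof -
  define P Q where "P = pruitt \<rho>" and "Q = pruitt \<eta>"
  have PQ: "0 < P" "0 < Q" using pos by (auto simp: P_def Q_def)
  define W where "W = 1 + (\<xi> / \<rho>)\<^sup>2"
  have W: "1 \<le> W" by (simp add: W_def)
  have N0: "0 \<le> N" using N t PQ unfolding P_def by (meson less_imp_le mult_nonneg_nonneg order_trans)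
  define A where "A h = centred_increment (1/\<rho>) \<xi> h" for h
  have nf: "norm (f u) = exp (- (t * re_psi u))" for u
    unfolding f_def by (simp add: Re_levy_exponent)
  have fA: "f (\<xi> + h) = f \<xi> * exp (- (of_real t * A h))" for h
    unfolding f_def A_def centred_increment_eq[of _ _ _ b] exp_add[symmetric]
    by (rule arg_cong[where f=exp]) (simp add: algebra_simps)
  have T: "norm (f \<xi> * (exp (- (of_real t * A h)) - 1 - (- (of_real t * A h)))) \<le> 1135780 * N * K * (t * Q) * (1 / W)"
    if h: "h \<noteq> 0" "\<bar>h\<bar> \<le> 4 * \<rho>" "pruitt h = Q" for h
  proof -
    have "norm (exp (- (of_real t * A h)) - 1 - (- (of_real t * A h))) \<le>
        (norm (of_real t * A h))\<^sup>2 * (1 + exp (Re (- (of_real t * A h))))"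
      using norm_exp_minus_linear_le[of "- (of_real t * A h)"] by simp
    then have "norm (f \<xi> * (exp (- (of_real t * A h)) - 1 - (- (of_real t * A h)))) \<le>
        norm (f \<xi>) * ((norm (of_real t * A h))\<^sup>2 * (1 + exp (Re (- (of_real t * A h)))))"
      unfolding norm_mult[of "f \<xi>"] by (intro mult_left_mono) auto
    also have "\<dots> = (norm (of_real t * A h))\<^sup>2 * (norm (f \<xi>) + norm (f \<xi>) * exp (Re (- (of_real t * A h))))"
      by (simp add: algebra_simps)
    also have "norm (f \<xi>) * exp (Re (- (of_real t * A h))) = norm (f (\<xi> + h))"
      unfolding fA norm_mult by simp
    also have "(norm (of_real t * A h))\<^sup>2 \<le> 1042 * N * (t * Q) * W"
    proof -
      have "(norm (of_real t * A h))\<^sup>2 = t\<^sup>2 * (norm (A h))\<^sup>2" by (simp add: norm_mult power_mult_distrib)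
      also have "\<dots> \<le> t\<^sup>2 * (1042 * P * Q * W)"
        unfolding A_def P_def W_def h(3)[symmetric]
        using pos h by (intro mult_left_mono norm_centred_increment_le \<rho>) (auto simp: Q_def)
      also have "\<dots> = (t * P) * (1042 * (t * Q) * W)" by (simp add: power2_eq_square)
      also have "\<dots> \<le> N * (1042 * (t * Q) * W)"
        using N t PQ W by (intro mult_right_mono) (auto simp: P_def)
      finally show ?thesis by simp
    qed
    also have "norm (f \<xi>) + norm (f (\<xi> + h)) \<le> 1090 * K * (1 / W\<^sup>2)"
    proof -
      have "norm (f \<xi>) \<le> K * (1 / W\<^sup>2)" unfolding nf W_def using decay[of \<xi>] by simp
      moreover have "norm (f (\<xi> + h)) \<le> K * (1089 / W\<^sup>2)"
      proof -
        have "norm (f (\<xi> + h)) \<le> K * (1 / (1 + (\<xi> / \<rho> + h / \<rho>)\<^sup>2)\<^sup>2)"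
          unfolding nf using decay[of "\<xi> + h"] by (simp add: add_divide_distrib)
        also have "\<dots> \<le> K * (1089 / W\<^sup>2)"
          unfolding W_def using h \<rho> K by (intro mult_left_mono shifted_kernel_le) (auto simp: field_simps)
        finally show ?thesis .
      qed
      ultimately have "norm (f \<xi>) + norm (f (\<xi> + h)) \<le> K * (1 / W\<^sup>2) + K * (1089 / W\<^sup>2)"
        by (rule add_mono)
      also have "\<dots> = 1090 * K * (1 / W\<^sup>2)" by (simp add: add_divide_distrib[symmetric])
      finally show ?thesis .
    qed
    finally have "norm (f \<xi> * (exp (- (of_real t * A h)) - 1 - (- (of_real t * A h)))) \<le>
       1042 * N * (t * Q) * W * (1090 * K * (1 / W\<^sup>2))"
      using N0 t PQ W by (simp add: mult_left_mono mult_right_mono)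
    also have "\<dots> = 1135780 * N * K * (t * Q) * (1 / W)"
      using W by (simp add: power2_eq_square field_simps)
    finally show ?thesis .
  qed
  have S: "norm (f \<xi> * (of_real t * (A \<eta> + A (- \<eta>)))) \<le> 4 * K * (t * Q) * (1 / W)"
  proof -
    have "norm (f \<xi> * (of_real t * (A \<eta> + A (- \<eta>)))) = norm (f \<xi>) * (t * norm (A \<eta> + A (- \<eta>)))"
      using t by (simp add: norm_mult)
    also have "\<dots> \<le> (K / W\<^sup>2) * (t * (4 * Q))"
      unfolding nf A_def Q_def W_def using t K
      by (intro mult_mono decay mult_left_mono norm_second_difference_le) auto
    also have "\<dots> \<le> (K / W) * (t * (4 * Q))"
    proof (intro mult_right_mono divide_left_mono)
      show "W \<le> W\<^sup>2" using W by (simp add: power2_eq_square)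
    qed (use W t PQ K in auto)
    finally show ?thesis by (simp add: mult_ac)
  qed
  have eq: "2 * f \<xi> - f (\<xi> + \<eta>) - f (\<xi> - \<eta>) =
      f \<xi> * (of_real t * (A \<eta> + A (- \<eta>)))
      - f \<xi> * (exp (- (of_real t * A \<eta>)) - 1 - (- (of_real t * A \<eta>)))
      - f \<xi> * (exp (- (of_real t * A (- \<eta>))) - 1 - (- (of_real t * A (- \<eta>))))"
    using fA[of \<eta>] fA[of "- \<eta>"] by (simp add: algebra_simps)
  have "norm (2 * f \<xi> - f (\<xi> + \<eta>) - f (\<xi> - \<eta>)) \<le>
      norm (f \<xi> * (of_real t * (A \<eta> + A (- \<eta>)))) +
      norm (f \<xi> * (exp (- (of_real t * A \<eta>)) - 1 - (- (of_real t * A \<eta>)))) +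
      norm (f \<xi> * (exp (- (of_real t * A (- \<eta>))) - 1 - (- (of_real t * A (- \<eta>)))))"
    unfolding eq by (intro order_trans[OF norm_triangle_ineq4] add_mono norm_triangle_ineq4 order_refl)
  also have "\<dots> \<le> 4 * K * (t * Q) * (1 / W) + 1135780 * N * K * (t * Q) * (1 / W) + 1135780 * N * K * (t * Q) * (1 / W)"
  proof (intro add_mono S T)
    show "pruitt (- \<eta>) = Q" unfolding Q_def by (intro antisym pruitt_mono) auto
  qed (use \<eta> in \<open>auto simp: Q_def\<close>)
  also have "\<dots> = (4 + 2271560 * N) * K * (t * Q) * (1 / W)" by (simp add: algebra_simps)
  finally show ?thesis unfolding Q_def W_def .
qed

end

text \<open>Translation of the integrand by \<open>\<plusminus> \<pi>/x\<close> multiplies \<open>exp (- i \<xi> x)\<close> by \<open>-1\<close>.\<close>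

lemma integral_second_difference:
  fixes f :: "real \<Rightarrow> complex" and x :: real
  assumes x: "x \<noteq> 0" and f: "integrable lborel f"
  shows "4 * (CLBINT \<xi>. iexp (- (\<xi> * x)) * f \<xi>) =
    (CLBINT \<xi>. iexp (- (\<xi> * x)) * (2 * f \<xi> - f (\<xi> + pi / x) - f (\<xi> - pi / x)))"
proof -
  define g where "g \<xi> = iexp (- (\<xi> * x)) * f \<xi>" for \<xi>
  have fm[measurable]: "f \<in> borel_measurable borel" using f by auto
  have g: "integrable lborel g"
    unfolding g_def by (rule Bochner_Integration.integrable_bound[OF f]) (auto simp: norm_mult)
  have sh: "integrable lborel (\<lambda>\<xi>. iexp (- (\<xi> * x)) * f (\<xi> + e * (pi / x)))"
    "(CLBINT \<xi>. iexp (- (\<xi> * x)) * f (\<xi> + e * (pi / x))) = - (CLBINT \<xi>. g \<xi>)"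
    if e: "e = 1 \<or> e = -1" for e :: real
  proof -
    have "iexp (- (e * pi)) = -1" using e by (auto simp: complex_eq_iff Re_exp Im_exp)
    then have *: "iexp (- (\<xi> * x)) * f (\<xi> + e * (pi / x)) = - g (e * (pi / x) + 1 * \<xi>)" for \<xi>
    proof -
      have "(e * (pi / x) + \<xi>) * x = \<xi> * x + e * pi" using x by (simp add: field_simps)
      then have "iexp (- ((e * (pi / x) + \<xi>) * x)) = iexp (- (\<xi> * x)) * iexp (- (e * pi))"
        by (simp only: exp_add[symmetric]) (simp add: algebra_simps)
      then show ?thesis using \<open>iexp (- (e * pi)) = -1\<close> unfolding g_def by (simp add: add.commute)
    qed
    show "integrable lborel (\<lambda>\<xi>. iexp (- (\<xi> * x)) * f (\<xi> + e * (pi / x)))"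
      unfolding * using lborel_integrable_real_affine[OF g, of 1 "e * (pi / x)"] by simp
    show "(CLBINT \<xi>. iexp (- (\<xi> * x)) * f (\<xi> + e * (pi / x))) = - (CLBINT \<xi>. g \<xi>)"
      unfolding * using lborel_integral_real_affine[of 1 g "e * (pi / x)"] by simp
  qed
  have "(CLBINT \<xi>. iexp (- (\<xi> * x)) * (2 * f \<xi> - f (\<xi> + pi / x) - f (\<xi> - pi / x))) =
     (CLBINT \<xi>. 2 * g \<xi> - iexp (- (\<xi> * x)) * f (\<xi> + 1 * (pi / x)) - iexp (- (\<xi> * x)) * f (\<xi> + (-1) * (pi / x)))"
    by (intro Bochner_Integration.integral_cong) (auto simp: g_def algebra_simps)
  also have "\<dots> = (CLBINT \<xi>. 2 * g \<xi> - iexp (- (\<xi> * x)) * f (\<xi> + 1 * (pi / x))) -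
     (CLBINT \<xi>. iexp (- (\<xi> * x)) * f (\<xi> + (-1) * (pi / x)))"
    by (intro Bochner_Integration.integral_diff Bochner_Integration.integrable_diff integrable_mult_right g sh) auto
  also have "(CLBINT \<xi>. 2 * g \<xi> - iexp (- (\<xi> * x)) * f (\<xi> + 1 * (pi / x))) =
     (CLBINT \<xi>. 2 * g \<xi>) - (CLBINT \<xi>. iexp (- (\<xi> * x)) * f (\<xi> + 1 * (pi / x)))"
    by (intro Bochner_Integration.integral_diff integrable_mult_right g sh) auto
  also have "(CLBINT \<xi>. 2 * g \<xi>) = 2 * (CLBINT \<xi>. g \<xi>)" by (rule integral_mult_right_zero)
  finally show ?thesis using sh(2)[of 1] sh(2)[of "-1"] by (simp add: g_def)
qed

context half_line_levy_measure
begin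

text \<open>The total mass of the Cauchy kernel (its value \<open>\<pi>\<close> plays no role).\<close>

definition Cauchy_mass :: real where "Cauchy_mass = (LBINT x. 1 / (1 + x\<^sup>2))"

lemma Cauchy_mass_nonneg: "0 \<le> Cauchy_mass"
  unfolding Cauchy_mass_def by (intro integral_nonneg_AE) auto

context
  fixes F :: "real \<Rightarrow> complex" and t b \<rho> K N :: real
  assumes Fm: "F \<in> borel_measurable borel"
    and F: "\<And>\<xi>. F \<xi> = exp (- (of_real t * levy_exponent b \<xi>))"
    and t: "0 < t" and \<rho>: "0 < \<rho>" and K: "0 \<le> K"
    and decay: "\<And>\<xi>. exp (- (t * re_psi \<xi>)) \<le> K / (1 + (\<xi> / \<rho>)\<^sup>2)\<^sup>2"
begin

lemma norm_exp_levy_exponent_le: "norm (F \<xi>) \<le> K * (1 / (1 + (\<xi> / \<rho>)\<^sup>2))"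
proof -
  define W where "W = 1 + (\<xi> / \<rho>)\<^sup>2"
  have W: "1 \<le> W" by (simp add: W_def)
  have "norm (F \<xi>) \<le> K / W\<^sup>2" using decay[of \<xi>] by (simp add: F Re_levy_exponent W_def)
  also have "\<dots> \<le> K / W"
  proof (intro divide_left_mono)
    show "W \<le> W\<^sup>2" using W by (simp add: power2_eq_square)
  qed (use W K in auto)
  finally show ?thesis by (simp add: W_def)
qed

lemma integrable_if_decay: "integrable lborel F"
proof (rule Bochner_Integration.integrable_bound)
  show "integrable lborel (\<lambda>\<xi>. K * (1 / (1 + (\<xi> / \<rho>)\<^sup>2)))"
    by (intro integrable_mult_right integrable_Cauchy_kernel \<rho>)
  show "AE \<xi> in lborel. norm (F \<xi>) \<le> norm (K * (1 / (1 + (\<xi> / \<rho>)\<^sup>2)))"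
    using norm_exp_levy_exponent_le by (intro AE_I2) (metis abs_ge_self order_trans real_norm_def)
qed (use Fm in simp)

lemma inverse_fourier_sup_bound: "norm (inverse_fourier F y) \<le> K * Cauchy_mass * \<rho>"
proof -
  have "norm (inverse_fourier F y) \<le> (LINT \<xi>|lborel. norm (F \<xi>))"
    by (rule norm_inverse_fourier_le[OF integrable_if_decay])
  also have "\<dots> \<le> (LBINT \<xi>. K * (1 / (1 + (\<xi> / \<rho>)\<^sup>2)))"
    by (intro integral_mono integrable_norm integrable_if_decay integrable_mult_right integrable_Cauchy_kernel \<rho> norm_exp_levy_exponent_le)
  also have "\<dots> = K * (\<rho> * Cauchy_mass)"
    by (simp only: integral_mult_right_zero integrable_Cauchy_kernel(2)[OF \<rho>] Cauchy_mass_def)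
  finally show ?thesis by (simp add: mult_ac)
qed

lemma inverse_fourier_decay_bound:
  assumes N: "t * pruitt \<rho> \<le> N" and pos: "\<And>u. 0 < u \<Longrightarrow> 0 < pruitt u"
    and x: "x \<noteq> 0" "1 / \<bar>x\<bar> \<le> \<rho>"
  shows "norm (inverse_fourier F (x + t * truncated_drift b \<nu> (1 / \<rho>))) \<le>
    (4 + 2271560 * N) * K * 16 * Cauchy_mass * \<rho> * (t * pruitt (1 / \<bar>x\<bar>))"
proof -
  define B where "B = t * truncated_drift b \<nu> (1 / \<rho>)"
  define f where "f \<xi> = exp (- (of_real t * levy_exponent b \<xi>) - \<i> * of_real (\<xi> * B))" for \<xi>
  define \<eta> where "\<eta> = pi / x"
  define D where "D = (4 + 2271560 * N) * K"
  have \<eta>: "\<eta> \<noteq> 0" "\<bar>\<eta>\<bar> \<le> 4 * \<rho>"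
  proof -
    have "\<bar>\<eta>\<bar> = pi * (1 / \<bar>x\<bar>)" by (simp add: \<eta>_def)
    also have "\<dots> \<le> 4 * \<rho>" using x \<rho> pi_less_4 by (intro mult_mono) auto
    finally show "\<bar>\<eta>\<bar> \<le> 4 * \<rho>" .
  qed (use x in \<open>simp add: \<eta>_def\<close>)
  have peta: "0 < pruitt \<eta>"
    using pos[of "\<bar>\<eta>\<bar>"] \<eta> pruitt_mono[of "\<bar>\<eta>\<bar>" \<eta>] by simp
  have N0: "0 \<le> N" using N t pruitt_nonneg[of \<rho>] by (meson less_imp_le mult_nonneg_nonneg order_trans)
  have fF: "f \<xi> = F \<xi> * iexp (- (\<xi> * B))" for \<xi>
    unfolding f_def F by (simp add: exp_add[symmetric])
  have fi: "integrable lborel f"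
    unfolding fF using Fm by (intro Bochner_Integration.integrable_bound[OF integrable_if_decay]) (auto simp: norm_mult)
  have fm[measurable]: "f \<in> borel_measurable borel" using fi by auto
  have "(CLBINT \<xi>. iexp (- (\<xi> * (x + B))) * F \<xi>) = (CLBINT \<xi>. iexp (- (\<xi> * x)) * f \<xi>)"
  proof (intro Bochner_Integration.integral_cong refl)
    fix \<xi>
    have "iexp (- (\<xi> * (x + B))) = iexp (- (\<xi> * x)) * iexp (- (\<xi> * B))"
      by (simp add: exp_add[symmetric] algebra_simps)
    then show "iexp (- (\<xi> * (x + B))) * F \<xi> = iexp (- (\<xi> * x)) * f \<xi>" unfolding fF by simp
  qed
  then have "inverse_fourier F (x + B) = 1 / (2 * pi) * (CLBINT \<xi>. iexp (- (\<xi> * x)) * f \<xi>)"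
    unfolding inverse_fourier_def by (simp only:)
  then have "norm (inverse_fourier F (x + B)) = 1 / (2 * pi) * norm (CLBINT \<xi>. iexp (- (\<xi> * x)) * f \<xi>)"
    by (simp only: norm_mult) (simp add: norm_divide)
  also have "\<dots> \<le> 1 * norm (CLBINT \<xi>. iexp (- (\<xi> * x)) * f \<xi>)"
    using pi_gt3 by (intro mult_right_mono) auto
  also have "\<dots> \<le> norm (4 * (CLBINT \<xi>. iexp (- (\<xi> * x)) * f \<xi>))" by (simp only: norm_mult) simp
  also have "4 * (CLBINT \<xi>. iexp (- (\<xi> * x)) * f \<xi>) =
      (CLBINT \<xi>. iexp (- (\<xi> * x)) * (2 * f \<xi> - f (\<xi> + \<eta>) - f (\<xi> - \<eta>)))"
    unfolding \<eta>_def by (rule integral_second_difference[OF x(1) fi])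
  also have "norm \<dots> \<le> (LBINT \<xi>. norm (iexp (- (\<xi> * x)) * (2 * f \<xi> - f (\<xi> + \<eta>) - f (\<xi> - \<eta>))))"
    by (rule integral_norm_bound)
  also have "\<dots> \<le> (LBINT \<xi>. D * (t * pruitt \<eta>) * (1 / (1 + (\<xi> / \<rho>)\<^sup>2)))"
  proof (rule integral_mono)
    have i: "integrable lborel (\<lambda>\<xi>. D * (t * pruitt \<eta>) * (1 / (1 + (\<xi> / \<rho>)\<^sup>2)))"
      by (intro integrable_mult_right integrable_Cauchy_kernel \<rho>)
    then show "integrable lborel (\<lambda>\<xi>. D * (t * pruitt \<eta>) * (1 / (1 + (\<xi> / \<rho>)\<^sup>2)))" .
    show b: "norm (iexp (- (\<xi> * x)) * (2 * f \<xi> - f (\<xi> + \<eta>) - f (\<xi> - \<eta>))) \<le> D * (t * pruitt \<eta>) * (1 / (1 + (\<xi> / \<rho>)\<^sup>2))" for \<xi>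
      unfolding norm_mult norm_iexp_of_real D_def f_def B_def
      using second_difference_pointwise[OF t \<rho> \<eta> pos[OF \<rho>] peta K decay N] by simp
    show "integrable lborel (\<lambda>\<xi>. norm (iexp (- (\<xi> * x)) * (2 * f \<xi> - f (\<xi> + \<eta>) - f (\<xi> - \<eta>))))"
    proof (intro integrable_norm Bochner_Integration.integrable_bound[OF i] AE_I2)
      show "norm (iexp (- (\<xi> * x)) * (2 * f \<xi> - f (\<xi> + \<eta>) - f (\<xi> - \<eta>))) \<le> norm (D * (t * pruitt \<eta>) * (1 / (1 + (\<xi> / \<rho>)\<^sup>2)))" for \<xi>
        using order_trans[OF b[of \<xi>] abs_ge_self] by (simp only: real_norm_def)
    qed measurable
  qed
  also have "\<dots> = D * (t * pruitt \<eta>) * (\<rho> * Cauchy_mass)"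
    by (simp only: integral_mult_right_zero integrable_Cauchy_kernel(2)[OF \<rho>] Cauchy_mass_def)
  also have "\<dots> \<le> D * (t * (16 * pruitt (1 / \<bar>x\<bar>))) * (\<rho> * Cauchy_mass)"
  proof (intro mult_right_mono mult_left_mono)
    have "pruitt \<eta> \<le> pruitt (4 * (1 / \<bar>x\<bar>))"
      using x pi_less_4 by (intro pruitt_mono) (simp add: \<eta>_def field_simps)
    also have "\<dots> \<le> 4\<^sup>2 * pruitt (1 / \<bar>x\<bar>)" by (rule pruitt_scale) simp
    finally show "pruitt \<eta> \<le> 16 * pruitt (1 / \<bar>x\<bar>)" by simp
  qed (use t \<rho> K N0 Cauchy_mass_nonneg in \<open>auto simp: D_def\<close>)
  finally show ?thesis unfolding B_def D_def by (simp only: mult_ac)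
qed

end
end

section \<open>Uniform bounds at the natural frequency\<close>

context half_line_levy_measure
begin

lemma vphi_pos_if_nonzero:
  assumes "vphi v \<noteq> 0" "0 < u"
  shows "0 < vphi u"
proof (rule ccontr)
  assume "\<not> 0 < vphi u"
  then have "vphi u = 0" using vphi_nonneg[of u] by simp
  then have "AE s in \<nu>. (u * s)\<^sup>2 * exp (- (u * s)) = 0"
    unfolding vphi_def using integrable_vphi[of u] assms(2)
    by (subst (asm) integral_nonneg_eq_0_iff_AE) auto
  then have "AE s in \<nu>. False" using AE_positive by eventually_elim (use assms(2) in auto)
  then have "AE s in \<nu>. (v * s)\<^sup>2 * exp (- (v * s)) = 0" by (rule eventually_mono) simp
  then have "vphi v = (\<integral>s. 0 \<partial>\<nu>)" unfolding vphi_def by (intro integral_cong_AE) simp_all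
  then show False using assms(1) by simp
qed

lemma pruitt_le_Laplace:
  assumes "0 < u"
  shows "pruitt u \<le> 2 * (\<integral>s. 1 - exp (- (u * s)) \<partial>\<nu>)"
proof -
  have "pruitt u \<le> (\<integral>s. 2 * (1 - exp (- (u * s))) \<partial>\<nu>)"
    unfolding pruitt_def
  proof (intro integral_levy_mono integrable_pruitt integrable_mult_right integrable_zeroth_kernel)
    fix s :: real assume "0 < s"
    then have us: "0 < u * s" using assms by simp
    have "min 1 ((u * s)\<^sup>2) \<le> min 1 (u * s)"
      using us by (cases "u * s \<le> 1") (auto simp: power2_eq_square mult_left_le min.coboundedI2)
    also have "\<dots> \<le> 2 * (1 - exp (- (u * s)))" by (rule one_minus_exp_minus_ge[OF us])
    finally show "min 1 ((u * s)\<^sup>2) \<le> 2 * (1 - exp (- (u * s)))" .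
  qed (use assms in auto)
  then show ?thesis by (simp only: integral_mult_right_zero)
qed

text \<open>The jumps shorter than \<open>1/\<rho>\<close> satisfy \<open>s \<le> e s exp (- \<rho> s)\<close>, so the two drifts differ by at most
  \<open>e (\<phi>'(\<rho>) - b)\<close>.\<close>

lemma truncated_drift_le:
  assumes "0 < \<rho>"
  shows "truncated_drift b \<nu> (1 / \<rho>) \<le> b + exp 1 * (\<integral>s. s * exp (- (\<rho> * s)) \<partial>\<nu>)"
    and "b \<le> truncated_drift b \<nu> (1 / \<rho>)"
proof -
  have "(\<integral>s. indicator {0<..<1/\<rho>} s * s \<partial>\<nu>) \<le> (\<integral>s. exp 1 * (s * exp (- (\<rho> * s))) \<partial>\<nu>)"
  proof (intro integral_levy_mono integrable_truncated_identity integrable_mult_right integrable_first_kernel assms)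
    fix s :: real assume s: "0 < s"
    show "indicator {0<..<1/\<rho>} s * s \<le> exp 1 * (s * exp (- (\<rho> * s)))"
    proof (cases "s < 1 / \<rho>")
      case True
      then have "\<rho> * s \<le> 1" using assms by (simp add: field_simps)
      then have "s * 1 \<le> s * exp (1 - \<rho> * s)" using s by (intro mult_left_mono) auto
      then show ?thesis using True s by (simp add: exp_diff exp_minus field_simps)
    qed (use s in auto)
  qed
  then show "truncated_drift b \<nu> (1 / \<rho>) \<le> b + exp 1 * (\<integral>s. s * exp (- (\<rho> * s)) \<partial>\<nu>)"
    by (simp add: truncated_drift_eq)
  have "0 \<le> (\<integral>s. indicator {0<..<1/\<rho>} s * s \<partial>\<nu>)"
    by (intro integral_nonneg_AE AE_I2) (auto simp: indicator_def)
  then show "b \<le> truncated_drift b \<nu> (1 / \<rho>)" by (simp add: truncated_drift_eq)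
qed

end

context scaled_levy_measure
begin

lemma vphi_unbounded: "\<exists>z\<ge>1. y < vphi z"
proof -
  define u where "u = x0 + 1"
  have u: "0 < u" "x0 < u" "1 \<le> u" using x0 by (auto simp: u_def)
  have v: "0 < vphi u" using u vphi_pos by auto
  define q where "q = (\<bar>y\<bar> + 1) / (c * vphi u)"
  define k where "k = max 1 (q powr (1 / \<alpha>))"
  have k: "1 \<le> k" by (simp add: k_def)
  have p: "0 < q" using c v by (auto simp: q_def intro!: divide_pos_pos mult_pos_pos)
  have "q = (q powr (1 / \<alpha>)) powr \<alpha>"
    using p \<alpha> by (simp add: powr_powr)
  also have "\<dots> \<le> k powr \<alpha>" using \<alpha> by (intro powr_mono2) (auto simp: k_def)
  finally have "\<bar>y\<bar> + 1 \<le> c * k powr \<alpha> * vphi u" using c v by (simp add: q_def field_simps)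
  also have "\<dots> \<le> vphi (k * u)" using k u by (intro vphi_scale) auto
  finally have "y < vphi (k * u)" by linarith
  moreover have "1 * 1 \<le> k * u" using k u by (intro mult_mono) auto
  ultimately show ?thesis by (intro exI[of _ "k * u"]) simp
qed

lemma re_psi_unbounded: "\<exists>z>0. y < re_psi z"
proof -
  obtain d where d: "0 < d" "\<And>u. 0 < u \<Longrightarrow> 1 \<le> u \<Longrightarrow> d * pruitt u \<le> re_psi u"
    using pruitt_le_re_psi[of 1] by auto
  obtain z where z: "1 \<le> z" "y / d < vphi z" using vphi_unbounded by blast
  have "y < d * vphi z" using z d by (simp add: field_simps)
  also have "\<dots> \<le> d * pruitt z" using z d by (intro mult_left_mono vphi_le_pruitt) auto
  also have "\<dots> \<le> re_psi z" using z by (intro d) auto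
  finally show ?thesis using z by (intro exI[of _ z]) auto
qed

lemma integrable_exp_levy_exponent:
  assumes Fm: "F \<in> borel_measurable borel"
    and F: "\<And>\<xi>. F \<xi> = exp (- (of_real t * levy_exponent b \<xi>))" and t: "0 < t"
  shows "integrable lborel F"
proof -
  have "0 < t * pruitt 1" using t pruitt_pos by simp
  then obtain K where K: "0 < K" "\<And>\<xi>. exp (- (t * re_psi \<xi>)) \<le> K / (1 + (\<xi> / 1)\<^sup>2)\<^sup>2"
    using exp_re_psi_decay[of 1 "t * pruitt 1"] t by (metis order_refl zero_less_one)
  show ?thesis by (rule integrable_if_decay[OF Fm F t, of 1 K]) (use K in auto)
qed

text \<open>In the range \<open>s \<le> 1 / x0\<close> this is the comparison of \<open>pruitt\<close> and \<open>vphi\<close>; beyond it, \<open>\<phi>(1/s)\<close>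
  always dominates \<open>pruitt (1/s)\<close>, up to a factor 2.\<close>

lemma pruitt_le_zeta:
  assumes \<phi>: "\<And>u. 0 < u \<Longrightarrow> (\<integral>s. 1 - exp (- (u * s)) \<partial>\<nu>) \<le> \<phi> u" and v: "\<And>u. 0 < u \<Longrightarrow> varphi \<phi> u = vphi u"
  obtains C where "0 < C" "\<And>s. 0 < s \<Longrightarrow> \<exists>z. zeta \<phi> x0 s = ereal z \<and> pruitt (1 / s) \<le> C * z"
proof -
  have star: "vphi u \<le> varphi_star \<phi> u" if "0 < u" for u
    unfolding varphi_star_def
  proof (rule cSUP_upper2[of _ _ u])
    show "bdd_above (varphi \<phi> ` {0<..u})"
    proof (rule bdd_aboveI2)
      fix z assume "z \<in> {0<..u}"
      then show "varphi \<phi> z \<le> pruitt u"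
        using vphi_le_pruitt[of z] pruitt_mono[of z u] by (simp add: v)
    qed
  qed (use that in \<open>auto simp: v\<close>)
  have \<phi>pos: "0 < \<phi> u" if "0 < u" for u
    using pruitt_le_Laplace[OF that] pruitt_pos[OF that] \<phi>[OF that] by linarith
  obtain C1 where C1: "0 < C1" "\<And>u. 0 < u \<Longrightarrow> x0 \<le> u \<Longrightarrow> pruitt u \<le> C1 * vphi u"
    using pruitt_le_vphi[of x0] x0 by (auto simp: less_le)
  define A where "A = varphi_star \<phi> x0 / \<phi> x0"
  define C where "C = C1 + (if x0 = 0 then 0 else 2 / A)"
  have A: "0 < A" if "0 < x0" unfolding A_def
    using star[OF that] vphi_pos[OF that] \<phi>pos[OF that] by (intro divide_pos_pos) auto
  show ?thesis
  proof (rule that[of C])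
    show C: "0 < C"
    proof (cases "x0 = 0")
      case False
      then show ?thesis using C1 A x0 by (simp add: C_def add_pos_pos)
    qed (use C1 in \<open>simp add: C_def\<close>)
    fix s :: real assume s: "0 < s"
    show "\<exists>z. zeta \<phi> x0 s = ereal z \<and> pruitt (1 / s) \<le> C * z"
    proof (cases "ereal s \<le> 1 / ereal x0")
      case True
      have "x0 \<le> 1 / s"
        using True s x0 by (cases "x0 = 0") (auto simp: one_ereal_def field_simps)
      then have "pruitt (1 / s) \<le> C1 * vphi (1 / s)" using s by (intro C1) auto
      also have "\<dots> \<le> C1 * varphi_star \<phi> (1 / s)" using C1 s by (intro mult_left_mono star) auto
      also have "\<dots> \<le> C * varphi_star \<phi> (1 / s)"
      proof (rule mult_right_mono)
        show "C1 \<le> C" using A x0 by (auto simp: C_def less_le)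
        show "0 \<le> varphi_star \<phi> (1 / s)" using star[of "1/s"] vphi_nonneg[of "1/s"] s by simp
      qed
      finally show ?thesis using True s by (auto simp: zeta_def)
    next
      case False
      have "1 / ereal 0 = \<infinity>" by (simp add: divide_ereal_def)
      then have "x0 \<noteq> 0" using False by (metis ereal_less_eq(1))
      then have p: "0 < x0" using x0 by simp
      have "pruitt (1 / s) \<le> 2 * \<phi> (1 / s)"
        using pruitt_le_Laplace[of "1/s"] \<phi>[of "1/s"] s by simp
      also have "\<dots> = 2 / A * (A * \<phi> (1 / s))" using A[OF p] by simp
      also have "\<dots> \<le> C * (A * \<phi> (1 / s))"
        using C1 A[OF p] \<phi>pos[of "1/s"] s p by (intro mult_right_mono) (auto simp: C_def)
      finally show ?thesis using False s by (auto simp: zeta_def A_def)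
    qed
  qed
qed

text \<open>The two estimates of the density in terms of the frequencies \<open>\<rho>\<close> and \<open>r\<close> at which \<open>re_psi\<close> and \<open>vphi\<close> take
  the value \<open>1/t\<close>. The constant is uniform in \<open>t\<close>.\<close>

lemma inverse_fourier_bounds:
  obtains C where "0 < C"
    "\<And>t \<rho> r F b y. 0 < t \<Longrightarrow> vphi x0 < 1 / t \<Longrightarrow> 0 < \<rho> \<Longrightarrow> re_psi \<rho> = 1 / t \<Longrightarrow> 0 < r \<Longrightarrow> vphi r = 1 / t \<Longrightarrow>
      F \<in> borel_measurable borel \<Longrightarrow> F = (\<lambda>\<xi>. exp (- (of_real t * levy_exponent b \<xi>))) \<Longrightarrow>
      norm (inverse_fourier F y) \<le> C * r"
    "\<And>t \<rho> r F b x. 0 < t \<Longrightarrow> vphi x0 < 1 / t \<Longrightarrow> 0 < \<rho> \<Longrightarrow> re_psi \<rho> = 1 / t \<Longrightarrow> 0 < r \<Longrightarrow> vphi r = 1 / t \<Longrightarrow>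
      F \<in> borel_measurable borel \<Longrightarrow> F = (\<lambda>\<xi>. exp (- (of_real t * levy_exponent b \<xi>))) \<Longrightarrow> x \<noteq> 0 \<Longrightarrow>
      norm (inverse_fourier F (x + t * truncated_drift b \<nu> (1 / \<rho>))) \<le> C * r * (t * pruitt (1 / \<bar>x\<bar>))"
proof -
  \<comment> \<open>For \<open>x0 > 0\<close>, a threshold \<open>x1\<close> so small that all relevant frequencies exceed it.\<close>
  obtain x1 where x1: "0 < x1 \<or> x0 = 0" "x0 = 0 \<longrightarrow> x1 = 0" "x0 \<noteq> 0 \<longrightarrow> pruitt x1 < vphi x0 / 2"
  proof (cases "x0 = 0")
    case False
    then have "0 < vphi x0 / 2" using x0 vphi_pos by simp
    then obtain x1 where "0 < x1" "pruitt x1 < vphi x0 / 2" using pruitt_small by blast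
    then show ?thesis using that False by blast
  qed (use that[of 0] in auto)
  obtain d where d: "0 < d" "\<And>u k. 0 < u \<Longrightarrow> x1 \<le> u \<Longrightarrow> 1 \<le> k \<Longrightarrow> d * k powr \<alpha> * pruitt u \<le> pruitt (k * u)"
    using pruitt_lower_scaling[OF x1(1)] by blast
  obtain d' where d': "0 < d'" "\<And>u. 0 < u \<Longrightarrow> x1 \<le> u \<Longrightarrow> d' * pruitt u \<le> re_psi u"
    using pruitt_le_re_psi[OF x1(1)] by blast
  obtain K where K: "0 < K"
    "\<And>t \<rho> \<xi>. 0 < \<rho> \<Longrightarrow> x1 \<le> \<rho> \<Longrightarrow> 0 < t \<Longrightarrow> 1/2 \<le> t * pruitt \<rho> \<Longrightarrow> exp (- (t * re_psi \<xi>)) \<le> K / (1 + (\<xi> / \<rho>)\<^sup>2)\<^sup>2"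
    using exp_re_psi_decay[OF x1(1), of "1/2"] by auto
  define R where "R = max 1 ((1 / (d * d')) powr (1 / \<alpha>))"
  have R: "1 \<le> R" by (simp add: R_def)
  have freq: "x1 \<le> \<rho>" "1/2 \<le> t * pruitt \<rho>" "t * pruitt \<rho> \<le> 1 / d'" "\<rho> \<le> R * r"
    if t: "0 < t" "vphi x0 < 1 / t" and \<rho>: "0 < \<rho>" "re_psi \<rho> = 1 / t" and r: "0 < r" "vphi r = 1 / t" for t \<rho> r
  proof -
    have H\<rho>: "1 / t \<le> 2 * pruitt \<rho>" using re_psi_le_pruitt[of \<rho>] \<rho> by simp
    then show "1/2 \<le> t * pruitt \<rho>" using t by (simp add: field_simps)
    have Hr: "1 / t \<le> pruitt r" using vphi_le_pruitt[of r] r by simp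
    show x1\<rho>: "x1 \<le> \<rho>"
    proof (rule ccontr)
      assume n: "\<not> x1 \<le> \<rho>"
      then have "x0 \<noteq> 0" using x1 \<rho> by auto
      moreover have "pruitt \<rho> \<le> pruitt x1" using n \<rho> by (intro pruitt_mono) auto
      ultimately show False using x1(3) H\<rho> t by linarith
    qed
    have x1r: "x1 \<le> r"
    proof (rule ccontr)
      assume n: "\<not> x1 \<le> r"
      then have "x0 \<noteq> 0" using x1 r by auto
      moreover have "pruitt r \<le> pruitt x1" using n r by (intro pruitt_mono) auto
      ultimately show False using x1(3) Hr t vphi_nonneg[of x0] by linarith
    qed
    have U: "d' * pruitt \<rho> \<le> 1 / t" using d'(2)[OF \<rho>(1) x1\<rho>] \<rho> by simp
    then show "t * pruitt \<rho> \<le> 1 / d'" using t d' by (simp add: field_simps)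
    show "\<rho> \<le> R * r"
    proof (cases "\<rho> \<le> r")
      case True
      also have "r \<le> R * r" using mult_right_mono[OF R, of r] r(1) by simp
      finally show ?thesis .
    next
      case False
      define k where "k = \<rho> / r"
      have k: "1 \<le> k" "k * r = \<rho>" using False r by (auto simp: k_def)
      have "d' * (d * k powr \<alpha> * (1 / t)) \<le> d' * (d * k powr \<alpha> * pruitt r)"
        using Hr d d' by (intro mult_left_mono) auto
      also have "\<dots> \<le> d' * pruitt \<rho>" using d(2)[OF r(1) x1r k(1)] d' k by (intro mult_left_mono) auto
      also have "\<dots> \<le> 1 / t" by (rule U)
      finally have "k powr \<alpha> \<le> 1 / (d * d')" using t d d' by (simp add: field_simps)
      then have "(k powr \<alpha>) powr (1 / \<alpha>) \<le> (1 / (d * d')) powr (1 / \<alpha>)"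
        using \<alpha> by (intro powr_mono2) auto
      then have "k \<le> R" using k \<alpha> by (simp add: powr_powr R_def)
      then show ?thesis using r by (simp add: k_def field_simps)
    qed
  qed
  define S where "S = K * Cauchy_mass"
  define D where "D = (4 + 2271560 * (1 / d')) * K * 16 * Cauchy_mass"
  have SD: "0 \<le> S" "0 \<le> D" using K Cauchy_mass_nonneg d' by (auto simp: S_def D_def)
  define C where "C = (2 * S + D + 1) * R"
  have C: "0 < C" "S * R \<le> C" "2 * S * R \<le> C" "D * R \<le> C"
    using SD R by (auto simp: C_def intro!: mult_pos_pos mult_right_mono)
  show ?thesis
  proof (rule that[OF C(1)])
    fix t \<rho> r b y :: real and F :: "real \<Rightarrow> complex"
    assume h: "0 < t" "vphi x0 < 1 / t" "0 < \<rho>" "re_psi \<rho> = 1 / t" "0 < r" "vphi r = 1 / t"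
      and Fm: "F \<in> borel_measurable borel" and Feq: "F = (\<lambda>\<xi>. exp (- (of_real t * levy_exponent b \<xi>)))"
    note F = Fm fun_cong[OF Feq]
    note fr = freq[OF h]
    have sup: "norm (inverse_fourier F y) \<le> S * \<rho>" for y
      unfolding S_def
      by (rule inverse_fourier_sup_bound[OF F h(1,3)]) (use K fr h in auto)
    have S\<rho>: "S * \<rho> \<le> S * (R * r)" using fr SD by (intro mult_left_mono) auto
    also have "\<dots> \<le> C * r" using mult_right_mono[OF C(2), of r] h by (simp add: mult.assoc)
    finally show "norm (inverse_fourier F y) \<le> C * r" using sup[of y] by linarith
    fix x :: real assume x: "x \<noteq> 0"
    have tp: "0 \<le> t * pruitt (1 / \<bar>x\<bar>)" using h pruitt_nonneg by simp
    show "norm (inverse_fourier F (x + t * truncated_drift b \<nu> (1 / \<rho>))) \<le> C * r * (t * pruitt (1 / \<bar>x\<bar>))"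
    proof (cases "1 / \<bar>x\<bar> \<le> \<rho>")
      case True
      have "norm (inverse_fourier F (x + t * truncated_drift b \<nu> (1 / \<rho>))) \<le> D * \<rho> * (t * pruitt (1 / \<bar>x\<bar>))"
        unfolding D_def
        by (rule inverse_fourier_decay_bound[OF F h(1,3)]) (use K fr h pruitt_pos x True in auto)
      also have "\<dots> \<le> D * (R * r) * (t * pruitt (1 / \<bar>x\<bar>))"
        using fr SD tp by (intro mult_right_mono mult_left_mono) auto
      also have "\<dots> \<le> C * r * (t * pruitt (1 / \<bar>x\<bar>))"
        using mult_right_mono[OF C(4), of r] h tp by (intro mult_right_mono) (auto simp: mult.assoc)
      finally show ?thesis .
    next
      case False
      have "pruitt \<rho> \<le> pruitt (1 / \<bar>x\<bar>)" using False h by (intro pruitt_mono) auto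
      then have "t * pruitt \<rho> \<le> t * pruitt (1 / \<bar>x\<bar>)" using h by (intro mult_left_mono) auto
      then have "1 \<le> 2 * (t * pruitt (1 / \<bar>x\<bar>))" using fr by linarith
      then have "S * (R * r) * 1 \<le> S * (R * r) * (2 * (t * pruitt (1 / \<bar>x\<bar>)))"
        using SD R h by (intro mult_left_mono) auto
      also have "\<dots> = (2 * S * R) * r * (t * pruitt (1 / \<bar>x\<bar>))" by simp
      also have "\<dots> \<le> C * r * (t * pruitt (1 / \<bar>x\<bar>))"
        using C(3) h tp by (intro mult_right_mono) auto
      finally show ?thesis using sup S\<rho> by (smt (verit))
    qed
  qed
qed

end

section \<open>Transition densities of subordinators\<close>

context half_line_levy_measure
begin

lemma set_Laplace_integral_eq:
  "(LINT s:{0<..}|\<nu>. 1 - exp (- u * s)) = (\<integral>s. 1 - exp (- (u * s)) \<partial>\<nu>)"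
  unfolding set_lebesgue_integral_def
proof (rule integral_cong_AE)
  show "AE s in \<nu>. indicator {0<..} s *\<^sub>R (1 - exp (- u * s)) = 1 - exp (- (u * s))"
    using AE_positive by eventually_elim simp
qed auto

context
  fixes \<phi> :: "real \<Rightarrow> real" and b :: real
  assumes \<phi>: "drift_and_levy_measure_of \<phi> b \<nu>"
begin

lemma Laplace_exponent_eq: "0 \<le> u \<Longrightarrow> \<phi> u = b * u + (\<integral>s. 1 - exp (- (u * s)) \<partial>\<nu>)"
  using \<phi> unfolding drift_and_levy_measure_of_def set_Laplace_integral_eq by blast

lemma deriv_Laplace_exponent:
  assumes u: "0 < u"
  shows "deriv \<phi> u = b + (\<integral>s. s * exp (- (u * s)) \<partial>\<nu>)"
proof (rule DERIV_imp_deriv)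
  have "((\<lambda>u. b * u + (\<integral>s. 1 - exp (- (u * s)) \<partial>\<nu>)) has_real_derivative b + (\<integral>s. s * exp (- (u * s)) \<partial>\<nu>)) (at u)"
    using DERIV_Laplace_integral[OF u] by (auto intro!: derivative_eq_intros)
  then show "(\<phi> has_real_derivative b + (\<integral>s. s * exp (- (u * s)) \<partial>\<nu>)) (at u)"
    by (rule has_field_derivative_transform_within_open[where S="{0<..}"]) (use u Laplace_exponent_eq in auto)
qed

lemma deriv_deriv_Laplace_exponent:
  assumes u: "0 < u"
  shows "deriv (deriv \<phi>) u = - (\<integral>s. s\<^sup>2 * exp (- (u * s)) \<partial>\<nu>)"
proof (rule DERIV_imp_deriv)
  have "((\<lambda>u. b + (\<integral>s. s * exp (- (u * s)) \<partial>\<nu>)) has_real_derivative - (\<integral>s. s\<^sup>2 * exp (- (u * s)) \<partial>\<nu>)) (at u)"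
    using DERIV_first_kernel_integral[OF u] by (auto intro!: derivative_eq_intros)
  then show "(deriv \<phi> has_real_derivative - (\<integral>s. s\<^sup>2 * exp (- (u * s)) \<partial>\<nu>)) (at u)"
    by (rule has_field_derivative_transform_within_open[where S="{0<..}"]) (use u deriv_Laplace_exponent in auto)
qed

lemma varphi_eq_vphi: "0 \<le> u \<Longrightarrow> varphi \<phi> u = vphi u"
proof (cases "u = 0")
  case True
  then show ?thesis by (simp add: varphi_def vphi_def)
next
  case False
  assume "0 \<le> u"
  with False show ?thesis
    unfolding varphi_def vphi_def
    by (simp add: deriv_deriv_Laplace_exponent power_mult_distrib mult.assoc)
qed

lemma varphi_star_le_iff: "0 < r \<Longrightarrow> varphi_star \<phi> r \<le> y \<longleftrightarrow> (\<forall>z\<in>{0<..r}. vphi z \<le> y)"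
  unfolding varphi_star_def
proof (subst cSUP_le_iff)
  show "bdd_above (varphi \<phi> ` {0<..r})"
  proof (rule bdd_aboveI2)
    fix z assume "z \<in> {0<..r}"
    then show "varphi \<phi> z \<le> pruitt r"
      using vphi_le_pruitt[of z] pruitt_mono[of z r] by (simp add: varphi_eq_vphi)
  qed
qed (auto simp: varphi_eq_vphi)

end

lemma psi_star_le_iff:
  assumes \<psi>: "\<And>\<xi>. Re (\<psi> \<xi>) = re_psi \<xi>" and r: "0 < r"
  shows "psi_star \<psi> r \<le> y \<longleftrightarrow> (\<forall>z\<in>{0<..r}. re_psi z \<le> y)"
proof -
  have "psi_star \<psi> r \<le> y \<longleftrightarrow> (\<forall>z\<in>{z. \<bar>z\<bar> \<le> r}. re_psi z \<le> y)"
    unfolding psi_star_def \<psi>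
  proof (rule cSUP_le_iff)
    show "bdd_above (re_psi ` {z. \<bar>z\<bar> \<le> r})"
    proof (rule bdd_aboveI2)
      fix z assume "z \<in> {z. \<bar>z\<bar> \<le> r}"
      then show "re_psi z \<le> 2 * pruitt r"
        using re_psi_le_pruitt[of z] pruitt_mono[of z r] r by simp
    qed
    show "{z. \<bar>z\<bar> \<le> r} \<noteq> {}" using r by (auto intro: exI[of _ 0])
  qed
  also have "\<dots> \<longleftrightarrow> (\<forall>z\<in>{0<..r}. re_psi z \<le> y)"
  proof safe
    fix z assume *: "\<forall>z\<in>{0<..r}. re_psi z \<le> y" and z: "\<bar>z\<bar> \<le> r"
    have "re_psi z = re_psi \<bar>z\<bar>" by (simp add: abs_if re_psi_uminus)
    moreover have "re_psi 0 \<le> re_psi r" using re_psi_nonneg[of r] by (simp add: re_psi_def)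
    moreover have "re_psi r \<le> y" using * r by auto
    ultimately show "re_psi z \<le> y" using * z by (cases "z = 0") auto
  qed auto
  finally show ?thesis .
qed

end

text \<open>Combines a uniform bound and a decay bound into a bound by a minimum, in extended real
  arithmetic.\<close>

lemma ereal_min_bound:
  assumes "p \<le> C * r" "p \<le> C * r * (t * q)" "q \<le> D * z" "0 \<le> q" "0 < C" "0 < r" "0 < t" "0 < D"
    and E: "C * max 1 D \<le> E"
  shows "ereal p \<le> ereal E * ereal r * min 1 (ereal t * ereal z)"
proof -
  have z: "0 \<le> z" using assms by (metis order_trans zero_le_mult_iff less_imp_le not_less)
  have "p \<le> E * r * min 1 (t * z)"
  proof (cases "1 \<le> t * z")
    case True
    have "C * 1 \<le> C * max 1 D" using assms by (intro mult_left_mono) auto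
    then have "C \<le> E" using E by simp
    then have "C * r \<le> E * r" using assms by (intro mult_right_mono) auto
    with assms(1) have "p \<le> E * r" by (rule order_trans)
    then show ?thesis using True by simp
  next
    case False
    have "p \<le> C * r * (t * (D * z))" using assms by (auto intro: order_trans mult_left_mono)
    also have "\<dots> = (C * D) * (r * (t * z))" by simp
    also have "\<dots> \<le> E * (r * (t * z))"
    proof (rule mult_right_mono)
      have "C * D \<le> C * max 1 D" using assms by (intro mult_left_mono) auto
      then show "C * D \<le> E" using E by simp
    qed (use assms z in auto)
    finally show ?thesis using False by simp
  qed
  also have "ereal (E * r * min 1 (t * z)) = ereal E * ereal r * min 1 (ereal t * ereal z)"
    by (simp add: min_def one_ereal_def)
  finally show ?thesis by simp
qed

lemma time_range_iff:
  assumes "0 \<le> varphi \<phi> x"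
  shows "t \<in> time_range \<phi> x \<longleftrightarrow> 0 < t \<and> varphi \<phi> x < 1 / t"
proof (cases "varphi \<phi> x = 0")
  case True
  have "1 / ereal 0 = \<infinity>" by (simp add: divide_ereal_def)
  then show ?thesis unfolding time_range_def mem_Collect_eq True by (metis less_ereal.simps(4) zero_less_divide_1_iff)
next
  case False
  then show ?thesis using assms by (auto simp: time_range_def one_ereal_def field_simps)
qed

lemma subordinator_nonneg:
  assumes "subordinator M T" "0 \<le> t"
  shows "AE \<omega> in M. 0 \<le> T t \<omega>"
proof -
  have "AE \<omega> in M. T 0 \<omega> = 0" "AE \<omega> in M. mono_on {0..} (\<lambda>t. T t \<omega>)"
    using assms(1) by (auto simp: subordinator_def levy_process_def)
  then show ?thesis
  proof eventually_elim
    case (elim \<omega>)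
    then show ?case using mono_onD[OF elim(2), of 0 t] assms(2) by simp
  qed
qed

theorem theorem4p7:
  fixes M :: "'a measure" and T :: "real \<Rightarrow> 'a \<Rightarrow> real"
    and \<phi> :: "real \<Rightarrow> real" and \<psi> :: "real \<Rightarrow> complex"
    and b :: real and \<nu> :: "real measure"
    and \<alpha> c x\<^sub>0 :: real
  assumes "subordinator M T"
    and "laplace_exponent_of M T \<phi>"
    and "levy_khintchine_exponent_of M T \<psi>"
    and "drift_and_levy_measure_of \<phi> b \<nu>"
    and "\<exists>x>0. deriv (deriv \<phi>) x \<noteq> 0"
    and "0 < c" and "c \<le> 1" and "0 \<le> x\<^sub>0" and "0 < \<alpha>"
    and "(\<lambda>x. - deriv (deriv \<phi>) x) \<in> WLSC (\<alpha> - 2) c x\<^sub>0"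
  shows "\<exists>p. (\<forall>t>0. continuous_density_of M (T t) (p t)) \<and>
    (\<exists>C>0.
      (\<forall>t\<in>time_range \<phi> x\<^sub>0. \<forall>x.
         ereal (p t (x + t * truncated_drift b \<nu> (1 / psi_inv \<psi> (1 / t))))
           \<le> ereal C * ereal (varphi_inv \<phi> (1 / t)) * min 1 (ereal t * zeta \<phi> x\<^sub>0 \<bar>x\<bar>)) \<and>
      (\<forall>t\<in>time_range \<phi> x\<^sub>0. \<forall>x\<ge>2 * exp 1 * t * deriv \<phi> (psi_inv \<psi> (1 / t)).
         ereal (p t (x + t * b))
           \<le> ereal C * ereal (varphi_inv \<phi> (1 / t)) * min 1 (ereal t * zeta \<phi> x\<^sub>0 x)))"
proof -
  note drift = assms(4)
  interpret prob_space M using assms(1) by (simp add: subordinator_def levy_process_def)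
  have \<nu>: "half_line_levy_measure \<nu>"
    using drift by (simp add: half_line_levy_measure_def drift_and_levy_measure_of_def)
  interpret half_line_levy_measure \<nu> by (rule \<nu>)
  have b: "0 \<le> b" using drift by (simp add: drift_and_levy_measure_of_def)
  have Tm: "T t \<in> borel_measurable M" if "0 \<le> t" for t
    using assms(1) that by (simp add: subordinator_def levy_process_def)
  obtain v where v: "0 < v" "deriv (deriv \<phi>) v \<noteq> 0" using assms(5) by blast
  have vphi_v: "vphi v \<noteq> 0"
    using v varphi_eq_vphi[OF drift, of v, symmetric] by (simp add: varphi_def)
  interpret scaled_levy_measure \<nu> \<alpha> c x\<^sub>0
  proof
    show "0 < vphi u" if "0 < u" for u using vphi_v that by (rule vphi_pos_if_nonzero)
    fix k u :: real assume k: "1 \<le> k" and u: "x\<^sub>0 < u"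
    then have u0: "0 < u" and k0: "0 < k" using assms(8) by auto
    have "c * k powr (\<alpha> - 2) * (- deriv (deriv \<phi>) u) \<le> - deriv (deriv \<phi>) (k * u)"
      using assms(10) k u unfolding WLSC_def by blast
    then have "(k * u)\<^sup>2 * (c * k powr (\<alpha> - 2) * (- deriv (deriv \<phi>) u)) \<le> varphi \<phi> (k * u)"
      unfolding varphi_def by (intro mult_left_mono) auto
    moreover have k2: "k powr \<alpha> = k\<^sup>2 * k powr (\<alpha> - 2)"
      using k0 by (simp add: powr_diff powr_numeral)
    have "c * k powr \<alpha> * varphi \<phi> u = (k * u)\<^sup>2 * (c * k powr (\<alpha> - 2) * (- deriv (deriv \<phi>) u))"
      unfolding varphi_def k2 power_mult_distrib by (simp only: mult_ac)
    ultimately have "c * k powr \<alpha> * varphi \<phi> u \<le> varphi \<phi> (k * u)"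
      by simp
    then show "c * k powr \<alpha> * vphi u \<le> vphi (k * u)"
      using u0 k0 varphi_eq_vphi[OF drift] by simp
  qed (use assms in auto)
  define F where "F t = char (distr M borel (T t))" for t
  define p where "p t x = Re (inverse_fourier (F t) x)" for t x
  have rd: "real_distribution (distr M borel (T t))" if "0 \<le> t" for t
    using Tm[OF that] by (intro real_distribution_distr) auto
  have F: "F t \<xi> = exp (- (of_real t * levy_exponent b \<xi>))" if "0 \<le> t" for t \<xi>
  proof -
    have "(LINT \<omega>|M. exp (- (u * T t \<omega>))) = exp (- (t * (b * u + (\<integral>s. 1 - exp (- (u * s)) \<partial>\<nu>))))" if "0 \<le> u" for u
      using assms(2) \<open>0 \<le> t\<close> that Laplace_exponent_eq[OF drift that]
      unfolding laplace_exponent_of_def by simp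
    from char_from_Laplace_transform[OF Tm[OF that] subordinator_nonneg[OF assms(1) that] \<nu> this, of \<xi>]
    show ?thesis by (simp add: F_def levy_exponent_def)
  qed
  have Fm: "F t \<in> borel_measurable borel" if "0 \<le> t" for t
    unfolding F_def using rd[OF that] by (rule real_distribution.char_measurable)
  have psi: "Re (\<psi> \<xi>) = re_psi \<xi>" for \<xi>
  proof -
    have "exp (- \<psi> \<xi>) = F 1 \<xi>"
      using assms(3) unfolding levy_khintchine_exponent_of_def F_def by (metis mult_minus1 of_real_1 zero_le_one)
    then have "norm (exp (- \<psi> \<xi>)) = norm (exp (- levy_exponent b \<xi>))" by (simp add: F)
    then show ?thesis by (simp add: Re_levy_exponent)
  qed
  have dens: "continuous_density_of M (T t) (p t)" if t: "0 < t" for t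
  proof -
    interpret D: real_distribution "distr M borel (T t)" using rd t by simp
    have i: "integrable lborel (F t)"
      using Fm[of t] F[of t] t by (intro integrable_exp_levy_exponent) auto
    note d = D.density_if_integrable_char[OF i[unfolded F_def], folded F_def]
    have "distr M lborel (T t) = distr M borel (T t)" by (rule distr_cong) auto
    then have "distributed M lborel (T t) (\<lambda>x. ennreal (p t x))"
      using d(3) Tm[of t] t borel_measurable_continuous_onI[OF d(1)] unfolding distributed_def p_def
      by simp
    then show ?thesis using d(1,2) unfolding continuous_density_of_def p_def by auto
  qed
  obtain C where C: "0 < C"
    and B1: "\<And>t \<rho> r G b y. 0 < t \<Longrightarrow> vphi x\<^sub>0 < 1 / t \<Longrightarrow> 0 < \<rho> \<Longrightarrow> re_psi \<rho> = 1 / t \<Longrightarrow> 0 < r \<Longrightarrow> vphi r = 1 / t \<Longrightarrow>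
      G \<in> borel_measurable borel \<Longrightarrow> G = (\<lambda>\<xi>. exp (- (of_real t * levy_exponent b \<xi>))) \<Longrightarrow>
      norm (inverse_fourier G y) \<le> C * r"
    and B2: "\<And>t \<rho> r G b x. 0 < t \<Longrightarrow> vphi x\<^sub>0 < 1 / t \<Longrightarrow> 0 < \<rho> \<Longrightarrow> re_psi \<rho> = 1 / t \<Longrightarrow> 0 < r \<Longrightarrow> vphi r = 1 / t \<Longrightarrow>
      G \<in> borel_measurable borel \<Longrightarrow> G = (\<lambda>\<xi>. exp (- (of_real t * levy_exponent b \<xi>))) \<Longrightarrow> x \<noteq> 0 \<Longrightarrow>
      norm (inverse_fourier G (x + t * truncated_drift b \<nu> (1 / \<rho>))) \<le> C * r * (t * pruitt (1 / \<bar>x\<bar>))"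
    by (rule inverse_fourier_bounds) (rule that)
  obtain D where D: "0 < D" "\<And>s. 0 < s \<Longrightarrow> \<exists>z. zeta \<phi> x\<^sub>0 s = ereal z \<and> pruitt (1 / s) \<le> D * z"
    using pruitt_le_zeta[of \<phi>] Laplace_exponent_eq[OF drift] varphi_eq_vphi[OF drift] b
    by (smt (verit) mult_nonneg_nonneg)
  define E where "E = C * max 1 (4 * D)"
  have E: "0 < E" "C * 1 \<le> E" "C * max 1 D \<le> E" "C * max 1 (4 * D) \<le> E"
    using C D by (auto simp: E_def intro!: mult_left_mono)
  have main: "ereal (p t (x + t * truncated_drift b \<nu> (1 / psi_inv \<psi> (1 / t))))
           \<le> ereal E * ereal (varphi_inv \<phi> (1 / t)) * min 1 (ereal t * zeta \<phi> x\<^sub>0 \<bar>x\<bar>)"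
     "2 * exp 1 * t * deriv \<phi> (psi_inv \<psi> (1 / t)) \<le> x \<Longrightarrow> ereal (p t (x + t * b))
           \<le> ereal E * ereal (varphi_inv \<phi> (1 / t)) * min 1 (ereal t * zeta \<phi> x\<^sub>0 x)"
    if "t \<in> time_range \<phi> x\<^sub>0" for t x
  proof -
    have t: "0 < t" "vphi x\<^sub>0 < 1 / t"
      using that varphi_eq_vphi[OF drift assms(8)] vphi_nonneg[of x\<^sub>0] time_range_iff[of \<phi> x\<^sub>0 t] by auto
    define \<rho> where "\<rho> = psi_inv \<psi> (1 / t)"
    define r where "r = varphi_inv \<phi> (1 / t)"
    have t1: "0 < 1 / t" using t by simp
    have "continuous_on {0..} re_psi" using continuous_on_re_psi by (rule continuous_on_subset) simp
    moreover have "re_psi 0 = 0" by (simp add: re_psi_def)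
    ultimately have \<rho>: "0 < \<rho>" "re_psi \<rho> = 1 / t"
      unfolding \<rho>_def psi_inv_def
      using running_sup_inverse[OF _ _ psi_star_le_iff[OF psi] t1 re_psi_unbounded] by blast+
    have "vphi 0 = 0" by (simp add: vphi_def)
    moreover have "\<exists>z>0. 1 / t < vphi z"
      using vphi_unbounded[of "1 / t"] by (meson less_le_trans zero_less_one)
    ultimately have r: "0 < r" "vphi r = 1 / t"
      unfolding r_def varphi_inv_def
      using running_sup_inverse[OF continuous_on_vphi _ varphi_star_le_iff[OF drift] t1] by blast+
    have P: "p t y \<le> norm (inverse_fourier (F t) y)" for y unfolding p_def by (rule complex_Re_le_cmod)
    have sup: "p t y \<le> C * r" for y
      using P[of y] B1[OF t \<rho> r Fm ext[OF F], of y] t by simp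
    have dec: "p t (y + t * truncated_drift b \<nu> (1 / \<rho>)) \<le> C * r * (t * pruitt (1 / \<bar>y\<bar>))" if "y \<noteq> 0" for y
      using P[of "y + t * truncated_drift b \<nu> (1 / \<rho>)"] B2[OF t \<rho> r Fm ext[OF F] that] t by simp
    \<comment> \<open>At \<open>x = 0\<close> the function \<open>zeta\<close> is infinite and only the uniform bound is claimed.\<close>
    have zero: "ereal (p t y) \<le> ereal E * ereal r * min 1 (ereal t * zeta \<phi> x\<^sub>0 0)" for y
    proof -
      have "p t y \<le> E * r" using sup[of y] E r by (smt (verit) mult_right_mono)
      then show ?thesis using t by (simp add: zeta_def min_def)
    qed
    show "ereal (p t (x + t * truncated_drift b \<nu> (1 / psi_inv \<psi> (1 / t))))
           \<le> ereal E * ereal (varphi_inv \<phi> (1 / t)) * min 1 (ereal t * zeta \<phi> x\<^sub>0 \<bar>x\<bar>)"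
      unfolding \<rho>_def[symmetric] r_def[symmetric]
    proof (cases "x = 0")
      case False
      obtain z where z: "zeta \<phi> x\<^sub>0 \<bar>x\<bar> = ereal z" "pruitt (1 / \<bar>x\<bar>) \<le> D * z"
        using D(2)[of "\<bar>x\<bar>"] False by auto
      show "ereal (p t (x + t * truncated_drift b \<nu> (1 / \<rho>))) \<le> ereal E * ereal r * min 1 (ereal t * zeta \<phi> x\<^sub>0 \<bar>x\<bar>)"
        unfolding z(1)
        by (rule ereal_min_bound[OF sup dec[OF False] z(2) pruitt_nonneg C r(1) t(1) D(1) E(3)])
    qed (use zero in auto)
    assume "2 * exp 1 * t * deriv \<phi> (psi_inv \<psi> (1 / t)) \<le> x"
    then have x: "2 * exp 1 * t * deriv \<phi> \<rho> \<le> x" by (simp add: \<rho>_def)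
    define I where "I = (\<integral>s. s * exp (- (\<rho> * s)) \<partial>\<nu>)"
    have I: "0 \<le> I" "deriv \<phi> \<rho> = b + I"
      unfolding I_def using AE_positive
      by (auto intro!: integral_nonneg_AE simp: deriv_Laplace_exponent[OF drift \<rho>(1)] elim!: eventually_mono)
    \<comment> \<open>The point \<open>x + t b\<close>, measured from \<open>t\<close> times the truncated drift; it satisfies \<open>x/2 \<le> y \<le> x\<close>.\<close>
    define y where "y = x - t * (truncated_drift b \<nu> (1 / \<rho>) - b)"
    have y_eq: "y + t * truncated_drift b \<nu> (1 / \<rho>) = x + t * b" by (simp add: y_def algebra_simps)
    have "t * (truncated_drift b \<nu> (1 / \<rho>) - b) \<le> t * (exp 1 * (b + I))"
    proof (rule mult_left_mono)
      have "0 \<le> exp 1 * b" using b by simp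
      then show "truncated_drift b \<nu> (1 / \<rho>) - b \<le> exp 1 * (b + I)"
        using truncated_drift_le(1)[OF \<rho>(1), of b] by (simp add: I_def distrib_left)
    qed (use t in simp)
    also have "\<dots> \<le> x / 2" using x I(2) by (simp add: mult_ac)
    finally have y_ge: "x / 2 \<le> y" by (simp add: y_def)
    have "0 \<le> t * (truncated_drift b \<nu> (1 / \<rho>) - b)" using truncated_drift_le(2)[OF \<rho>(1), of b] t by simp
    then have y_le: "y \<le> x" by (simp add: y_def)
    show "ereal (p t (x + t * b)) \<le> ereal E * ereal (varphi_inv \<phi> (1 / t)) * min 1 (ereal t * zeta \<phi> x\<^sub>0 x)"
      unfolding r_def[symmetric]
    proof (cases "x = 0")
      case False
      have "0 \<le> 2 * exp 1 * t * deriv \<phi> \<rho>" unfolding I(2) using t b I by simp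
      then have x0: "0 < x" using x False by linarith
      obtain z where z: "zeta \<phi> x\<^sub>0 x = ereal z" "pruitt (1 / x) \<le> D * z"
        using D(2)[of x] x0 by auto
      have "pruitt (1 / \<bar>y\<bar>) \<le> pruitt (2 * (1 / x))"
        using y_ge x0 by (intro pruitt_mono) (simp add: field_simps)
      also have "\<dots> \<le> 2\<^sup>2 * pruitt (1 / x)" by (rule pruitt_scale) simp
      also have "\<dots> \<le> (4 * D) * z" using z(2) by simp
      finally have q: "pruitt (1 / \<bar>y\<bar>) \<le> (4 * D) * z" .
      have y0: "y \<noteq> 0" using y_ge x0 by auto
      have D4: "0 < 4 * D" using D by simp
      show "ereal (p t (x + t * b)) \<le> ereal E * ereal r * min 1 (ereal t * zeta \<phi> x\<^sub>0 x)"
        unfolding z(1)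
        by (rule ereal_min_bound[OF sup dec[OF y0, unfolded y_eq] q pruitt_nonneg C r(1) t(1) D4 E(4)])
    qed (use zero in auto)
  qed
  show ?thesis
    by (intro exI[of _ p] conjI exI[of _ E] allI impI ballI dens main E(1)) assumption+
qed

end
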